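(* Let $\hat\beta^{(\varepsilon)}=\{\hat\beta^{(\varepsilon)}_{jk}\}$ be the wavelet general empirical Bayes (GEB) estimator defined in the context. Then for every Besov ball $B=B^\alpha_{p,q}(C)$ with $0<\alpha<\infty$, $1/(\alpha+1/2)<p\le\infty$, $0<q\le\infty$, $0<C<\infty$, $$\sup_{\beta\in B}\{R^{(\varepsilon)}(\hat\beta^{(\varepsilon)},\beta)-R^{(\varepsilon,* )}(\beta)\}=o(1)\,\mathcal R^{(\varepsilon)}(B)\qquad\text{as }\varepsilon\to0+.$$
   Context: Model: $y_{jk}=\beta_{jk}+\varepsilon z_{jk}$, $1\le k\le\max(2^j,1)$, $j=-1,0,1,\dots$, with $\varepsilon>0$ known, $z_{jk}$ i.i.d. $N(0,1)$; $\beta$ deterministic; $E^{(\varepsilon)}_\beta$ is the expectation. Risk: $R^{(\varepsilon)}(\hat\beta,\beta)\equiv\sum_{j=-1}^\infty\sum_{k=1}^{2^j\vee1}E_\beta^{(\varepsilon)}(\hat\beta_{jk}-\beta_{jk})^2$. Ideal risk: $R^{(\varepsilon,* )}(\beta)\equiv\inf R^{(\varepsilon)}(\hat\beta,\beta)$ over all separable estimators $\hat\beta_{jk}=h_j(y_{jk})$ with Borel $h_j$ (allowed to depend on $\beta$). Minimax risk: $\mathcal R^{(\varepsilon)}(B)\equiv\inf_{\hat\beta}\sup_{\beta\in B}R^{(\varepsilon)}(\hat\beta,\beta)$ over all estimators based on $y$. Besov balls: $B^\alpha_{p,q}(C)=\{\beta:\|\beta\|^\alpha_{p,q}\le C\}$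 with $$\|\beta\|^\alpha_{p,q}\equiv\Big[|\beta_{-1,1}|^q+\sum_{j=0}^\infty\Big(2^{j(\alpha+1/2-1/p)}\Big(\sum_{k=1}^{2^j}|\beta_{jk}|^p\Big)^{1/p}\Big)^q\Big]^{1/q}$$ (usual modifications if $p$ or $q$ is $\infty$). GEB estimator: fix constants $n_*>2$, $\rho_0>0$, $b_0>0$ and $\eta_n\to0$; let $j_*$ be the largest integer with $2^{j_*}\le n_*$, $\rho(n)=(1+\eta_n)\rho_0\sqrt{2(\log n)/n}>0$, $b(n)=b_0(\log n)/\sqrt n$. Put $\hat\beta^{(\varepsilon)}_{jk}=y_{jk}$ for $j<j_*$ and $\hat\beta^{(\varepsilon)}_{jk}=\varepsilon\,\hat t_{[j]}(y_{jk}/\varepsilon)$ for $j\ge j_*$, where with $n_j=2^j$, $$\hat t_{[j]}(x)\equiv\begin{cases}x+\hat\varphi_{[j]}'(x)/\max\{\rho(n_j),\hat\varphi_{[j]}(x)\},&\hat\kappa_{[j]}>b(n_j),\\ \operatorname{sgn}(x)(|x|-\sqrt{2\log n_j})^+,&\hat\kappa_{[j]}\le b(n_j),\end{cases}$$ $$\hat\varphi_{[j]}(x)\equiv\frac{\sqrt{2\log n_j}}{n_j}\sum_{k=1}^{2^j}K\big(\sqrt{2\log n_j}(x-y_{jk}/\varepsilon)\big),\quad K(x)\equiv\frac{\sin x}{\pi x},\qquad\hat\kappa_{[j]}\equiv1-\frac{\sqrt2}{n_j}\sum_{k=1}^{2^j}e^{-(y_{jk}/\varepsilon)^2/2}.$$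 *)

theory Defs
  imports "HOL-Probability.Probability"
begin

text \<open>Coefficient arrays are functions on pairs \<open>(j, k)\<close>; only the entries with index in
  \<open>coeff_index\<close> are ever used. For \<open>j = -1\<close> we have \<open>nat j = 0\<close>, so \<open>2 ^ nat j\<close> is
  \<open>max (2 ^ j) 1\<close> for every \<open>j \<ge> -1\<close>.\<close>

type_synonym coeffs = "int \<times> nat \<Rightarrow> real"

definition level_size :: "int \<Rightarrow> nat" where
  "level_size j = 2 ^ nat j"

definition coeff_index :: "(int \<times> nat) set" where
  "coeff_index = (SIGMA j:{-1..}. {1..level_size j})"

subsection \<open>The white noise model and its risks\<close>

definition noise :: "coeffs measure" where
  "noise = (\<Pi>\<^sub>M i\<in>coeff_index. density lborel (\<lambda>x. ennreal (std_normal_density x)))"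

definition observation :: "real \<Rightarrow> coeffs \<Rightarrow> coeffs \<Rightarrow> coeffs" where
  "observation \<epsilon> \<beta> z = (\<lambda>i\<in>coeff_index. \<beta> i + \<epsilon> * z i)"

text \<open>An estimator maps the observed array \<open>y\<close> to an array of estimates.\<close>

definition estimators :: "(coeffs \<Rightarrow> coeffs) set" where
  "estimators = {d. \<forall>i\<in>coeff_index.
     (\<lambda>y. d y i) \<in> borel_measurable (\<Pi>\<^sub>M i\<in>coeff_index. (borel :: real measure))}"

definition risk :: "real \<Rightarrow> (coeffs \<Rightarrow> coeffs) \<Rightarrow> coeffs \<Rightarrow> ennreal" where
  "risk \<epsilon> d \<beta> = (\<Sum>\<^sub>\<infinity>j\<in>{-1..}. \<Sum>k=1..level_size j.
     \<integral>\<^sup>+ z. ennreal ((d (observation \<epsilon> \<beta> z) (j, k) - \<beta> (j, k))\<^sup>2) \<partial>noise)"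

definition separable_estimator :: "(int \<Rightarrow> real \<Rightarrow> real) \<Rightarrow> coeffs \<Rightarrow> coeffs" where
  "separable_estimator h y = (\<lambda>(j, k). h j (y (j, k)))"

definition ideal_risk :: "real \<Rightarrow> coeffs \<Rightarrow> ennreal" where
  "ideal_risk \<epsilon> \<beta> = (INF h\<in>{h. \<forall>j\<ge>-1. h j \<in> borel_measurable borel}.
     risk \<epsilon> (separable_estimator h) \<beta>)"

definition minimax_risk :: "real \<Rightarrow> coeffs set \<Rightarrow> ennreal" where
  "minimax_risk \<epsilon> B = (INF d\<in>estimators. SUP \<beta>\<in>B. risk \<epsilon> d \<beta>)"

subsection \<open>Besov balls\<close>

text \<open>Powers with a positive real exponent.\<close>

definition ennreal_powr :: "ennreal \<Rightarrow> real \<Rightarrow> ennreal" where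
  "ennreal_powr x r = (if x = \<infinity> then \<infinity> else ennreal (enn2real x powr r))"

text \<open>The \<open>\<ell>\<^sup>p\<close> (quasi-)norm of a nonnegative family, for \<open>0 < p \<le> \<infinity>\<close>.\<close>

definition lp_norm :: "ennreal \<Rightarrow> 'a set \<Rightarrow> ('a \<Rightarrow> ennreal) \<Rightarrow> ennreal" where
  "lp_norm p A f =
     (if p = \<infinity> then SUP i\<in>A. f i
      else ennreal_powr (\<Sum>\<^sub>\<infinity>i\<in>A. ennreal_powr (f i) (enn2real p)) (1 / enn2real p))"

text \<open>The term \<open>enn2real (1 / p)\<close> is \<open>0\<close> for \<open>p = \<infinity>\<close>.\<close>

definition besov_norm :: "real \<Rightarrow> ennreal \<Rightarrow> ennreal \<Rightarrow> coeffs \<Rightarrow> ennreal" where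
  "besov_norm \<alpha> p q \<beta> = lp_norm q {-1..} (\<lambda>j.
     if j = -1 then ennreal \<bar>\<beta> (-1, 1)\<bar>
     else ennreal (2 powr (real_of_int j * (\<alpha> + 1/2 - enn2real (1 / p))))
            * lp_norm p {1..level_size j} (\<lambda>k. ennreal \<bar>\<beta> (j, k)\<bar>))"

definition besov_ball :: "real \<Rightarrow> ennreal \<Rightarrow> ennreal \<Rightarrow> real \<Rightarrow> coeffs set" where
  "besov_ball \<alpha> p q C = {\<beta>. besov_norm \<alpha> p q \<beta> \<le> ennreal C}"

subsection \<open>The general empirical Bayes estimator\<close>

text \<open>The kernel \<open>sin x / (\<pi> x)\<close>, extended continuously to \<open>x = 0\<close>.\<close>

definition sinc_kernel :: "real \<Rightarrow> real" where
  "sinc_kernel x = (if x = 0 then 1 / pi else sin x / (pi * x))"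

text \<open>In the next three definitions \<open>n\<close> is the size of a level and \<open>u 1, \<dots>, u n\<close> are its
  rescaled observations \<open>y (j, k) / \<epsilon>\<close>.\<close>

definition phi_hat :: "nat \<Rightarrow> (nat \<Rightarrow> real) \<Rightarrow> real \<Rightarrow> real" where
  "phi_hat n u x = sqrt (2 * ln n) / n * (\<Sum>k=1..n. sinc_kernel (sqrt (2 * ln n) * (x - u k)))"

definition kappa_hat :: "nat \<Rightarrow> (nat \<Rightarrow> real) \<Rightarrow> real" where
  "kappa_hat n u = 1 - sqrt 2 / n * (\<Sum>k=1..n. exp (- (u k)\<^sup>2 / 2))"

definition t_hat ::
  "(nat \<Rightarrow> real) \<Rightarrow> (nat \<Rightarrow> real) \<Rightarrow> nat \<Rightarrow> (nat \<Rightarrow> real) \<Rightarrow> real \<Rightarrow> real" where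
  "t_hat \<rho> b n u x =
     (if kappa_hat n u > b n then x + deriv (phi_hat n u) x / max (\<rho> n) (phi_hat n u x)
      else sgn x * max 0 (\<bar>x\<bar> - sqrt (2 * ln n)))"

definition geb_rho :: "real \<Rightarrow> (nat \<Rightarrow> real) \<Rightarrow> nat \<Rightarrow> real" where
  "geb_rho \<rho>\<^sub>0 \<eta> n = (1 + \<eta> n) * \<rho>\<^sub>0 * sqrt (2 * ln n / n)"

definition geb_b :: "real \<Rightarrow> nat \<Rightarrow> real" where
  "geb_b b\<^sub>0 n = b\<^sub>0 * ln n / sqrt n"

text \<open>\<open>N\<close> is the constant \<open>n_*\<close>; levels below \<open>j_star N\<close> are left untouched.\<close>

definition j_star :: "real \<Rightarrow> int" where
  "j_star N = (GREATEST j. 2 powi j \<le> N)"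

definition geb_estimator ::
  "real \<Rightarrow> real \<Rightarrow> real \<Rightarrow> (nat \<Rightarrow> real) \<Rightarrow> real \<Rightarrow> coeffs \<Rightarrow> coeffs" where
  "geb_estimator N \<rho>\<^sub>0 b\<^sub>0 \<eta> \<epsilon> y = (\<lambda>(j, k).
     if j < j_star N then y (j, k)
     else \<epsilon> * t_hat (geb_rho \<rho>\<^sub>0 \<eta>) (geb_b b\<^sub>0) (level_size j)
                (\<lambda>l. y (j, l) / \<epsilon>) (y (j, k) / \<epsilon>))"

end

theory Submission
  imports Defs "HOL-Real_Asymp.Real_Asymp"
begin

text \<open>Scale the noise to unit variance and consider a level with \<open>n\<close> coefficients
  \<open>\<theta> 1, \<dots>, \<theta> n\<close>. The best separable rule is the posterior mean \<open>x + f' x / f x\<close> for the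
  normal mixture \<open>f\<close> with means \<open>\<theta> k\<close>, so the estimator pays for replacing the score \<open>f' / f\<close> by
  its truncated kernel estimate. Leaving out the \<open>k\<close>-th observation changes that estimate by a factor
  \<open>1 + O(n powr (- 1/2 + o(1)))\<close> only, and makes it independent of the point of evaluation. Since the
  sinc kernel is a Fourier cut-off at frequency \<open>sqrt (2 * ln n)\<close>, where the characteristic function
  of the noise is \<open>1 / n\<close>, its bias is negligible, and Hoeffding's inequality bounds the fluctuations by
  \<open>n powr (- 1/2 + o(1))\<close>. Outside the range of the means Gaussian tails take over. The excess risk is
  therefore at most \<open>n powr (1/2 + o(1))\<close> plus the number of means larger than \<open>n powr \<tau>\<close>.
  At a level whose energy lies below the detection boundary the estimator thresholds, and
  its risk is of the order of that energy, up to a logarithmic factor, plus a summable term.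

  Let \<open>T = \<epsilon> powr (- 1 / (\<alpha> + 1/2))\<close>. The Besov constraint bounds a weak moment of every level, and
  summing the excess over the levels gives \<open>\<epsilon>\<^sup>2 * O(T powr a)\<close> with \<open>a < 1\<close>. On the other hand a
  cube of vertices \<open>0, c * \<epsilon>\<close> at the level with about \<open>T\<close> coefficients lies in the ball, and testing each
  coordinate separately shows that the minimax risk is at least a multiple of \<open>\<epsilon>\<^sup>2 * T\<close>.\<close>

text \<open>The Besov parameters act through a single exponent \<open>s\<close> with
  \<open>1 / (\<alpha> + 1/2) < s < 2\<close> and \<open>s \<le> p\<close>. Put
  \<open>\<delta> = s * (\<alpha> + 1/2) - 1\<close>; then the sum of all
  \<open>\<bar>\<theta> k\<bar> powr s\<close> over a rescaled level of size \<open>n\<close> is at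
  most a constant times \<open>T powr (1 + \<delta>) * n powr (- \<delta>)\<close>. The oracle
  error, about \<open>sqrt n\<close>, stays below \<open>T\<close> only while \<open>n\<close> is
  below \<open>T\<^sup>2\<close>, and infinitely many finer levels remain. The moment bound drops
  below \<open>sqrt n\<close> once \<open>n\<close> exceeds
  \<open>T powr ((2 + 2 * \<delta>) / (1 + 2 * \<delta>))\<close>. This exponent is less than 2, so
  the regimes overlap by a power of \<open>T\<close>, which absorbs all logarithms and all factors
  \<open>n powr \<tau>\<close>. Hence error terms may be treated generously, with two exceptions.
  The factor in front of the separable risk must tend to 1, so squares are split with a small weight
  instead of doubled. And soft thresholding of pure noise must cost a summable amount per level,
  which requires the sharp order \<open>(ln n) powr (- 3 / 2)\<close>.\<close>

section \<open>Integrals against unit-variance Gaussians\<close>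

abbreviation gauss :: "real \<Rightarrow> real measure" where
  "gauss m \<equiv> density lborel (\<lambda>x. ennreal (normal_density m 1 x))"

lemma prob_space_gauss: "prob_space (gauss m)"
  by (rule prob_space_normal_density) simp

lemma nn_integral_gauss:
  "f \<in> borel_measurable borel \<Longrightarrow> (\<integral>\<^sup>+x. f x \<partial>gauss m) = (\<integral>\<^sup>+x. ennreal (normal_density m 1 x) * f x \<partial>lborel)"
  by (subst nn_integral_density) auto

lemma integral_gauss:
  fixes f :: "real \<Rightarrow> real"
  shows "f \<in> borel_measurable borel \<Longrightarrow> (\<integral>x. f x \<partial>gauss m) = (\<integral>x. normal_density m 1 x * f x \<partial>lborel)"
  by (subst integral_density) auto

lemma normal_density_shift: "normal_density m s (m + z) = normal_density 0 s z"
  by (simp add: normal_density_def)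

lemma nn_integral_gauss_shift:
  assumes [measurable]: "f \<in> borel_measurable borel"
  shows "(\<integral>\<^sup>+x. f x \<partial>gauss m) = (\<integral>\<^sup>+z. f (m + z) \<partial>gauss 0)"
proof -
  have "(\<integral>\<^sup>+x. f x \<partial>gauss m) = (\<integral>\<^sup>+x. ennreal (normal_density m 1 x) * f x \<partial>lborel)"
    by (subst nn_integral_gauss) auto
  also have "\<dots> = (\<integral>\<^sup>+z. ennreal (normal_density m 1 (m + z)) * f (m + z) \<partial>lborel)"
    by (subst nn_integral_real_affine[where c=1 and t=m]) auto
  also have "\<dots> = (\<integral>\<^sup>+z. f (m + z) \<partial>gauss 0)"
    by (subst nn_integral_gauss) (auto simp: normal_density_shift)
  finally show ?thesis .
qed

lemma integral_gauss_shift: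
  fixes f :: "real \<Rightarrow> real"
  assumes [measurable]: "f \<in> borel_measurable borel"
  shows "(\<integral>x. f x \<partial>gauss m) = (\<integral>z. f (m + z) \<partial>gauss 0)"
proof -
  have "(\<integral>x. f x \<partial>gauss m) = (\<integral>x. normal_density m 1 x * f x \<partial>lborel)"
    by (subst integral_gauss) auto
  also have "\<dots> = (\<integral>z. normal_density m 1 (m + z) * f (m + z) \<partial>lborel)"
    by (subst lborel_integral_real_affine[where c=1 and t=m]) auto
  also have "\<dots> = (\<integral>z. f (m + z) \<partial>gauss 0)"
    by (subst integral_gauss) (auto simp: normal_density_shift)
  finally show ?thesis .
qed

lemma integrable_gauss_bounded:
  fixes f :: "real \<Rightarrow> real"
  assumes "f \<in> borel_measurable borel" "\<And>x. \<bar>f x\<bar> \<le> B"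
  shows "integrable (gauss m) f"
proof -
  interpret prob_space "gauss m" by (rule prob_space_gauss)
  show ?thesis by (rule integrable_const_bound[where B=B]) (use assms in auto)
qed

text \<open>This is the real part of the characteristic function of the standard normal. The phase
  \<open>s\<close> is handled by the addition formula, since the sine part integrates to 0.\<close>

lemma integral_gauss_cos: "(\<integral>z. cos (s + t * z) \<partial>gauss 0) = cos s * exp (- t\<^sup>2 / 2)"
proof -
  interpret prob_space "gauss 0" by (rule prob_space_gauss)
  have int: "integrable (gauss 0) (\<lambda>x. iexp (t * x))"
    by (rule integrable_const_bound[where B=1]) auto
  have c: "(CLINT x|gauss 0. iexp (t * x)) = complex_of_real (exp (- t\<^sup>2 / 2))"
    using char_std_normal_distribution by (simp add: char_def fun_eq_iff)
  have "(\<integral>x. Re (iexp (t * x)) \<partial>gauss 0) = exp (- t\<^sup>2 / 2)"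
    using c integral_Re[OF int] by simp
  then have 1: "(\<integral>x. cos (t * x) \<partial>gauss 0) = exp (- t\<^sup>2 / 2)"
    by (simp add: Re_exp)
  have "(\<integral>x. Im (iexp (t * x)) \<partial>gauss 0) = 0"
    using c integral_Im[OF int] by simp
  then have 2: "(\<integral>x. sin (t * x) \<partial>gauss 0) = 0"
    by (simp add: Im_exp)
  have i1: "integrable (gauss 0) (\<lambda>x. cos (t * x))" "integrable (gauss 0) (\<lambda>x. sin (t * x))"
    by (rule integrable_gauss_bounded[where B=1]; simp)+
  show ?thesis
    by (simp add: cos_add i1 1 2)
qed

lemma integral_gauss_sin: "(\<integral>z. sin (s + t * z) \<partial>gauss 0) = sin s * exp (- t\<^sup>2 / 2)"
proof -
  have "sin (s + t * z) = cos ((s - pi/2) + t * z)" for z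
    using cos_diff[of "s + t * z" "pi/2"] by (simp add: algebra_simps)
  then show ?thesis
    using integral_gauss_cos[of "s - pi/2" t] cos_diff[of s "pi/2"] by simp
qed

subsection \<open>The sinc kernel and its Fourier representation\<close>

definition sinc_kernel_deriv :: "real \<Rightarrow> real" where
  "sinc_kernel_deriv x = (if x = 0 then 0 else (x * cos x - sin x) / (pi * x\<^sup>2))"

lemma DERIV_sinc_kernel: "(sinc_kernel has_real_derivative sinc_kernel_deriv x) (at x)"
proof (cases "x = 0")
  case False
  have "((\<lambda>x. sin x / (pi * x)) has_real_derivative sinc_kernel_deriv x) (at x)"
    using False by (auto intro!: derivative_eq_intros simp: sinc_kernel_deriv_def field_simps power2_eq_square)
  moreover have "eventually (\<lambda>y. y \<in> - {0}) (nhds x)"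
    using False by (intro eventually_nhds_in_open) auto
  then have "eventually (\<lambda>y. sinc_kernel y = sin y / (pi * y)) (nhds x)"
    by eventually_elim (auto simp: sinc_kernel_def)
  ultimately show ?thesis
    by (subst DERIV_cong_ev[OF refl _ refl]) auto
next
  case True
  \<comment> \<open>Up to the factor \<open>pi\<close> this is the difference quotient of
    \<open>sinc_kernel\<close> at its removable singularity.\<close>
  have "((\<lambda>h::real. (sin h - h) / (h * h)) \<longlongrightarrow> 0) (at 0)"
    by real_asymp
  then have "((\<lambda>h::real. (sin h - h) / (h * h) / pi) \<longlongrightarrow> 0) (at 0)"
    using tendsto_divide[OF _ tendsto_const, of _ 0 _ pi] by fastforce
  then have "((\<lambda>h. (sinc_kernel h - sinc_kernel 0) / h) \<longlongrightarrow> 0) (at 0)"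
    by (rule Lim_transform_eventually) (auto simp: eventually_at_filter sinc_kernel_def field_simps)
  then show ?thesis
    using True by (simp add: DERIV_def sinc_kernel_deriv_def)
qed

lemma sinc_kernel_measurable [measurable]: "sinc_kernel \<in> borel_measurable borel"
  by (intro borel_measurable_continuous_onI continuous_at_imp_continuous_on ballI)
     (use DERIV_sinc_kernel DERIV_isCont in blast)

lemma sinc_kernel_deriv_measurable [measurable]: "sinc_kernel_deriv \<in> borel_measurable borel"
  unfolding sinc_kernel_deriv_def by measurable

text \<open>The scaled kernel is the inverse Fourier transform of the indicator of
  \<open>{-a..a}\<close>. Both its size and its bias are read off this integral.\<close>

lemma sinc_kernel_window:
  assumes "a \<ge> 0"
  shows "a * sinc_kernel (a * w) = (\<integral>t. indicator {-a..a} t * cos (t * w) \<partial>lborel) / (2 * pi)"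
proof (cases "w = 0")
  case True
  then show ?thesis using assms by (simp add: sinc_kernel_def)
next
  case False
  have "(\<integral>t. indicator {-a..a} t *\<^sub>R cos (t * w) \<partial>lborel) = sin (a * w) / w - sin (- a * w) / w"
    by (rule integral_FTC_atLeastAtMost)
       (use assms False in \<open>auto intro!: derivative_eq_intros continuous_intros
         simp: has_real_derivative_iff_has_vector_derivative[symmetric]\<close>)
  then show ?thesis using False assms by (auto simp: sinc_kernel_def field_simps)
qed

text \<open>This is the previous formula differentiated in \<open>w\<close>; an explicit primitive
  replaces differentiation under the integral.\<close>

lemma sinc_kernel_deriv_window:
  assumes "a \<ge> 0"
  shows "a\<^sup>2 * sinc_kernel_deriv (a * w) =
    - (\<integral>t. indicator {-a..a} t * (t * sin (t * w)) \<partial>lborel) / (2 * pi)"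
proof (cases "w = 0")
  case True
  then show ?thesis using assms by (simp add: sinc_kernel_deriv_def)
next
  case False
  let ?F = "\<lambda>t. (sin (t * w) - t * w * cos (t * w)) / w\<^sup>2"
  have "(\<integral>t. indicator {-a..a} t *\<^sub>R (t * sin (t * w)) \<partial>lborel) = ?F a - ?F (- a)"
    by (rule integral_FTC_atLeastAtMost)
       (use assms False in \<open>auto intro!: derivative_eq_intros continuous_intros
         simp: has_real_derivative_iff_has_vector_derivative[symmetric] field_simps power2_eq_square\<close>)
  then have "(\<integral>t. indicator {-a..a} t * (t * sin (t * w)) \<partial>lborel) =
      2 * ((sin (a * w) - a * w * cos (a * w)) / w\<^sup>2)"
    by (simp add: diff_divide_distrib mult_ac)
  then have "- (\<integral>t. indicator {-a..a} t * (t * sin (t * w)) \<partial>lborel) / (2 * pi) =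
      (a * w * cos (a * w) - sin (a * w)) / (pi * w\<^sup>2)"
    using False by (simp only:) (simp add: field_simps)
  moreover have "a\<^sup>2 * sinc_kernel_deriv (a * w) = (a * w * cos (a * w) - sin (a * w)) / (pi * w\<^sup>2)"
    using False by (cases "a = 0") (auto simp: sinc_kernel_deriv_def power_mult_distrib)
  ultimately show ?thesis by simp
qed

lemma window_integral_le:
  fixes f :: "real \<Rightarrow> real"
  assumes "a \<ge> 0" and [measurable]: "f \<in> borel_measurable borel"
    and "\<And>t. \<bar>t\<bar> \<le> a \<Longrightarrow> \<bar>f t\<bar> \<le> B"
  shows "\<bar>\<integral>t. indicator {-a..a} t * f t \<partial>lborel\<bar> \<le> 2 * a * B"
proof -
  have "\<bar>\<integral>t. indicator {-a..a} t * f t \<partial>lborel\<bar> \<le> (\<integral>t. indicator {-a..a} t * B \<partial>lborel)"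
  proof -
    have i: "integrable lborel (\<lambda>t. indicator {-a..a} t * B)"
      using assms(1) by simp
    have le: "norm (indicator {-a..a} t * f t) \<le> indicator {-a..a} t * B" for t
      using assms(3)[of t] by (auto split: split_indicator)
    have i2: "integrable lborel (\<lambda>t. indicator {-a..a} t * f t)"
      by (rule Bochner_Integration.integrable_bound[OF i])
         (use le in \<open>auto intro!: AE_I2 intro: order_trans[OF _ abs_ge_self]\<close>)
    show ?thesis
      using Bochner_Integration.integral_norm_bound_integral[OF i2 i] le by auto
  qed
  then show ?thesis using assms(1) by simp
qed

lemma abs_sinc_kernel_le:
  assumes "a \<ge> 0" shows "\<bar>a * sinc_kernel (a * w)\<bar> \<le> a"
proof -
  have "\<bar>a * sinc_kernel (a * w)\<bar> \<le> (2 * a * 1) / (2 * pi)"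
    unfolding sinc_kernel_window[OF assms] abs_divide
    by (rule frac_le) (use assms window_integral_le[of a "\<lambda>t. cos (t * w)" 1] in auto)
  also have "\<dots> \<le> a" using assms mult_right_mono[of 1 pi a] pi_ge_two by (simp add: field_simps)
  finally show ?thesis .
qed

lemma abs_sinc_kernel_deriv_le:
  assumes "a \<ge> 0" shows "\<bar>a\<^sup>2 * sinc_kernel_deriv (a * w)\<bar> \<le> a\<^sup>2"
proof -
  have "\<bar>t * sin (t * w)\<bar> \<le> a" if "\<bar>t\<bar> \<le> a" for t
    using that abs_sin_le_one[of "t * w"] mult_mono[of "\<bar>t\<bar>" a "\<bar>sin (t * w)\<bar>" 1]
    by (simp add: abs_mult)
  then have "\<bar>a\<^sup>2 * sinc_kernel_deriv (a * w)\<bar> \<le> (2 * a * a) / (2 * pi)"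
    unfolding sinc_kernel_deriv_window[OF assms] abs_divide abs_minus
    by (intro frac_le) (use assms window_integral_le[of a "\<lambda>t. t * sin (t * w)" a] in auto)
  also have "\<dots> \<le> a\<^sup>2"
  proof -
    have "a * a * 1 \<le> a * a * pi" by (rule mult_left_mono) (use pi_ge_two in auto)
    then show ?thesis by (simp add: field_simps power2_eq_square)
  qed
  finally show ?thesis .
qed


subsection \<open>Bias of the kernel estimates\<close>

text \<open>Restricted to the window, Lebesgue measure is finite, so a bounded integrand is
  integrable for the product measure.\<close>

lemma window_Fubini:
  fixes h :: "real \<Rightarrow> real \<Rightarrow> real"
  assumes [measurable]: "case_prod h \<in> borel_measurable (borel \<Otimes>\<^sub>M borel)"
    and bound: "\<And>t x. \<bar>t\<bar> \<le> a \<Longrightarrow> \<bar>h t x\<bar> \<le> B"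
  shows "(\<integral>x. (\<integral>t. indicator {-a..a} t * h t x \<partial>lborel) \<partial>gauss m) =
    (\<integral>t. indicator {-a..a} t * (\<integral>x. h t x \<partial>gauss m) \<partial>lborel)"
proof -
  define N where "N = density lborel (\<lambda>t. ennreal (indicator {-a..a} t))"
  have [measurable_cong]: "sets N = sets borel" by (simp add: N_def)
  interpret G: prob_space "gauss m" by (rule prob_space_gauss)
  interpret N: finite_measure N
    by standard (simp add: N_def emeasure_density ennreal_indicator emeasure_lborel_Icc_eq)
  interpret P: pair_sigma_finite N "gauss m" ..
  interpret F: finite_measure "N \<Otimes>\<^sub>M gauss m"
    by (rule finite_measure_pair_measure) (rule G.finite_measure_axioms N.finite_measure_axioms)+
  have intN: "(\<integral>t. g t \<partial>N) = (\<integral>t. indicator {-a..a} t * g t \<partial>lborel)"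
    if "g \<in> borel_measurable borel" for g :: "real \<Rightarrow> real"
    unfolding N_def using that by (subst integral_density) auto
  have [measurable]: "(\<lambda>t. h t x) \<in> borel_measurable borel" for x by measurable
  have toN: "(\<integral>t. indicator {-a..a} t * h t x \<partial>lborel) = (\<integral>t. indicator {-a..a} t * h t x \<partial>N)" for x
    by (subst intN) (auto intro!: Bochner_Integration.integral_cong split: split_indicator)
  \<comment> \<open>The indicator is kept inside the integrand because nothing bounds
    \<open>h\<close> outside the window.\<close>
  have hb: "\<bar>indicator {-a..a} t * h t x\<bar> \<le> \<bar>B\<bar>" for t x
    using bound[of t x] by (cases "\<bar>t\<bar> \<le> a") (auto simp: indicator_def)
  have int: "integrable (N \<Otimes>\<^sub>M gauss m) (\<lambda>(t, x). indicator {-a..a} t * h t x)"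
    by (rule F.integrable_const_bound[where B="\<bar>B\<bar>"])
       (use hb in \<open>auto intro!: AE_I2 simp del: abs_mult\<close>)
  have "(\<integral>x. (\<integral>t. indicator {-a..a} t * h t x \<partial>lborel) \<partial>gauss m) =
      (\<integral>x. (\<integral>t. indicator {-a..a} t * h t x \<partial>N) \<partial>gauss m)"
    by (simp add: toN)
  also have "\<dots> = (\<integral>t. (\<integral>x. indicator {-a..a} t * h t x \<partial>gauss m) \<partial>N)"
    by (rule P.Fubini_integral[OF int])
  also have "\<dots> = (\<integral>t. indicator {-a..a} t * (\<integral>x. indicator {-a..a} t * h t x \<partial>gauss m) \<partial>lborel)"
    by (subst intN) auto
  also have "\<dots> = (\<integral>t. indicator {-a..a} t * (\<integral>x. h t x \<partial>gauss m) \<partial>lborel)"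
    by (auto intro!: Bochner_Integration.integral_cong split: split_indicator)
  finally show ?thesis .
qed

text \<open>The weight \<open>\<bar>t\<bar>\<close> turns the majorant into an exact derivative, so
  each half-line contributes exactly \<open>exp (- a\<^sup>2 / 2)\<close>.\<close>

lemma gauss_tail_integral_le:
  fixes g :: "real \<Rightarrow> real"
  assumes "a \<ge> 0" and int: "integrable lborel (\<lambda>t. g t * indicator (- {-a..a}) t)"
    and g: "\<And>t. a < \<bar>t\<bar> \<Longrightarrow> \<bar>g t\<bar> \<le> \<bar>t\<bar> * exp (- t\<^sup>2 / 2)"
  shows "\<bar>\<integral>t. g t * indicator (- {-a..a}) t \<partial>lborel\<bar> \<le> 2 * exp (- a\<^sup>2 / 2)"
proof -
  let ?e = "\<lambda>t::real. t * exp (- t\<^sup>2 / 2)"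
  have half: "(\<integral>\<^sup>+t. ennreal (?e t) * indicator {a..} t \<partial>lborel) = ennreal (exp (- a\<^sup>2 / 2))"
  proof (subst nn_integral_FTC_atLeast[where F="\<lambda>t. - exp (- t\<^sup>2 / 2)" and T=0])
    show "((\<lambda>t::real. - exp (- t\<^sup>2 / 2)) \<longlongrightarrow> 0) at_top" by real_asymp
  qed (use assms(1) in \<open>auto intro!: derivative_eq_intros simp: \<close>)
  have "(\<integral>\<^sup>+t. ennreal (?e (- t)) * indicator {a..} (- t) \<partial>lborel) = ennreal (exp (- a\<^sup>2 / 2))"
    using half nn_integral_real_affine[of "\<lambda>t. ennreal (?e t) * indicator {a..} t" "-1" 0] by simp
  with half have both: "(\<integral>\<^sup>+t. ennreal (?e t) * indicator {a..} t + ennreal (?e (- t)) * indicator {a..} (- t) \<partial>lborel)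
      = ennreal (2 * exp (- a\<^sup>2 / 2))"
    by (subst nn_integral_add) (auto simp flip: ennreal_plus)
  have "ennreal \<bar>\<integral>t. g t * indicator (- {-a..a}) t \<partial>lborel\<bar>
      \<le> (\<integral>\<^sup>+t. ennreal \<bar>g t * indicator (- {-a..a}) t\<bar> \<partial>lborel)"
    using integral_norm_bound_ennreal[OF int] by simp
  also have "\<dots> \<le> ennreal (2 * exp (- a\<^sup>2 / 2))"
    unfolding both[symmetric]
  proof (rule nn_integral_mono)
    fix t :: real
    show "ennreal \<bar>g t * indicator (- {-a..a}) t\<bar> \<le>
        ennreal (?e t) * indicator {a..} t + ennreal (?e (- t)) * indicator {a..} (- t)"
      using g[of t] assms(1) by (cases "t \<ge> 0") (auto split: split_indicator intro!: ennreal_leI)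
  qed
  finally show ?thesis by (simp add: ennreal_le_iff)
qed

lemma integral_cos_exp:
  shows "integrable lborel (\<lambda>t. cos (t * w) * exp (- t\<^sup>2 / 2))" (is ?I)
    and "(\<integral>t. cos (t * w) * exp (- t\<^sup>2 / 2) \<partial>lborel) = sqrt (2 * pi) * exp (- w\<^sup>2 / 2)" (is ?E)
proof -
  have eq: "cos (t * w) * exp (- t\<^sup>2 / 2) = sqrt (2 * pi) * (std_normal_density t * cos (0 + w * t))" for t
    by (simp add: std_normal_density_def mult_ac)
  have "integrable (gauss 0) (\<lambda>t. cos (0 + w * t))"
    by (rule integrable_gauss_bounded[where B=1]) auto
  then have "integrable lborel (\<lambda>t. std_normal_density t * cos (0 + w * t))"
    by (subst (asm) integrable_density) auto
  then show ?I unfolding eq by simp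
  show ?E unfolding eq
    using integral_gauss_cos[of 0 w] by (subst (asm) integral_gauss) auto
qed

lemma integrable_abs_exp: "integrable lborel (\<lambda>t::real. \<bar>t\<bar> * exp (- t\<^sup>2 / 2))"
proof -
  have "integrable lborel (\<lambda>t. sqrt (2 * pi) * (std_normal_density t * \<bar>t\<bar> ^ 1))"
    by (intro integrable_mult_right integrable_std_normal_moment_abs)
  then show ?thesis by (simp add: std_normal_density_def mult_ac)
qed

text \<open>Integration by parts: \<open>?F\<close> vanishes at both ends, so its derivative
  \<open>?f\<close> integrates to 0, and the cosine part of \<open>?f\<close> is already
  known.\<close>

lemma integral_sin_exp:
  shows "integrable lborel (\<lambda>t. t * sin (t * w) * exp (- t\<^sup>2 / 2))" (is ?I)
    and "(\<integral>t. t * sin (t * w) * exp (- t\<^sup>2 / 2) \<partial>lborel) = w * (sqrt (2 * pi) * exp (- w\<^sup>2 / 2))" (is ?E)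
proof -
  show I: ?I
    by (rule Bochner_Integration.integrable_bound[OF integrable_abs_exp])
       (auto simp: abs_mult intro!: AE_I2 mult_right_mono mult_left_le)
  let ?f = "\<lambda>t. w * (cos (t * w) * exp (- t\<^sup>2 / 2)) - t * sin (t * w) * exp (- t\<^sup>2 / 2)"
  let ?F = "\<lambda>t. sin (t * w) * exp (- t\<^sup>2 / 2)"
  have b: "\<bar>?F t\<bar> \<le> exp (- t\<^sup>2 / 2)" for t by (simp add: abs_mult)
  have e: "((\<lambda>t::real. exp (- t\<^sup>2 / 2)) \<longlongrightarrow> 0) at_top" "((\<lambda>t::real. exp (- t\<^sup>2 / 2)) \<longlongrightarrow> 0) at_bot"
    by real_asymp+
  have lim: "(?F \<longlongrightarrow> 0) at_top" "(?F \<longlongrightarrow> 0) at_bot"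
    using b by (auto intro!: Lim_null_comparison[OF _ e(1)] Lim_null_comparison[OF _ e(2)] simp del: abs_mult)
  have "integrable lborel ?f" using I integral_cos_exp(1)[of w] by auto
  moreover have "(LBINT t=-\<infinity>..\<infinity>. ?f t) = 0 - 0"
  proof (rule interval_integral_FTC_integrable[where F="?F"])
    show "(?F has_vector_derivative ?f t) (at t)" for t
      by (auto intro!: derivative_eq_intros simp: has_real_derivative_iff_has_vector_derivative[symmetric] algebra_simps)
    show "isCont ?f t" for t by (intro continuous_intros) auto
    show "set_integrable lborel (einterval (-\<infinity>) \<infinity>) ?f"
      using \<open>integrable lborel ?f\<close> by (simp add: set_integrable_def)
    show "((?F \<circ> real_of_ereal) \<longlongrightarrow> 0) (at_right (-\<infinity>))" "((?F \<circ> real_of_ereal) \<longlongrightarrow> 0) (at_left \<infinity>)"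
      using lim by (simp_all add: ereal_tendsto_simps)
  qed auto
  ultimately have "(\<integral>t. ?f t \<partial>lborel) = 0"
    by (simp add: interval_lebesgue_integral_def set_lebesgue_integral_def)
  then show ?E using I integral_cos_exp[of w] by simp
qed

lemma abs_divide_2pi_le: "\<bar>x\<bar> \<le> 2 * e \<Longrightarrow> \<bar>x / (2 * pi)\<bar> \<le> e"
proof -
  assume x: "\<bar>x\<bar> \<le> 2 * e"
  then have "2 * e * 1 \<le> 2 * e * pi"
    by (intro mult_left_mono) (use pi_ge_two in auto)
  with x show ?thesis by (simp add: abs_mult divide_le_eq mult_ac)
qed

text \<open>By Fourier inversion the mean of the kernel is the normal density with its frequencies
  beyond \<open>a\<close> removed, so the bias is a tail of the Gaussian characteristic function.
  There \<open>a \<ge> 1\<close> lets \<open>\<bar>t\<bar>\<close> dominate the cosine.\<close>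

lemma sinc_kernel_bias:
  assumes "a \<ge> 1"
  shows "\<bar>(\<integral>x. a * sinc_kernel (a * (w - x)) \<partial>gauss m) - normal_density m 1 w\<bar> \<le> exp (- a\<^sup>2 / 2)"
proof -
  let ?g = "\<lambda>t. cos (t * (w - m)) * exp (- t\<^sup>2 / 2)"
  have inner: "(\<integral>x. cos (t * (w - x)) \<partial>gauss m) = ?g t" for t
    using integral_gauss_cos[of "t * (w - m)" "- t"]
    by (subst integral_gauss_shift) (auto simp: algebra_simps)
  have "(\<integral>x. a * sinc_kernel (a * (w - x)) \<partial>gauss m) =
      (\<integral>x. (\<integral>t. indicator {-a..a} t * cos (t * (w - x)) \<partial>lborel) \<partial>gauss m) / (2 * pi)"
    using assms by (simp add: sinc_kernel_window)
  also have "\<dots> = (\<integral>t. indicator {-a..a} t * ?g t \<partial>lborel) / (2 * pi)"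
    by (subst window_Fubini[where B=1]) (auto simp: inner)
  finally have 1: "(\<integral>x. a * sinc_kernel (a * (w - x)) \<partial>gauss m) = (\<integral>t. ?g t * indicator {-a..a} t \<partial>lborel) / (2 * pi)"
    by (simp add: mult.commute)
  have 2: "normal_density m 1 w = (\<integral>t. ?g t \<partial>lborel) / (2 * pi)"
    unfolding integral_cos_exp(2) normal_density_def by (simp add: field_simps flip: real_sqrt_mult)
  have i: "integrable lborel (\<lambda>t. ?g t * indicator A t)" if "A \<in> sets borel" for A
    by (rule integrable_real_mult_indicator) (use that integral_cos_exp in auto)
  have "(\<integral>t. ?g t \<partial>lborel) = (\<integral>t. ?g t * indicator {-a..a} t + ?g t * indicator (- {-a..a}) t \<partial>lborel)"
    by (intro Bochner_Integration.integral_cong) (auto split: split_indicator)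
  also have "\<dots> = (\<integral>t. ?g t * indicator {-a..a} t \<partial>lborel) + (\<integral>t. ?g t * indicator (- {-a..a}) t \<partial>lborel)"
    by (intro Bochner_Integration.integral_add i) auto
  finally have 3: "(\<integral>x. a * sinc_kernel (a * (w - x)) \<partial>gauss m) - normal_density m 1 w =
      - (\<integral>t. ?g t * indicator (- {-a..a}) t \<partial>lborel) / (2 * pi)"
    unfolding 1 2 by (simp add: field_simps)
  have "\<bar>\<integral>t. ?g t * indicator (- {-a..a}) t \<partial>lborel\<bar> \<le> 2 * exp (- a\<^sup>2 / 2)"
  proof (rule gauss_tail_integral_le)
    show "\<bar>?g t\<bar> \<le> \<bar>t\<bar> * exp (- t\<^sup>2 / 2)" if "a < \<bar>t\<bar>" for t
    proof -
      have "\<bar>cos (t * (w - m))\<bar> \<le> \<bar>t\<bar>"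
        using that assms abs_cos_le_one[of "t * (w - m)"] by linarith
      then show ?thesis by (simp add: abs_mult)
    qed
  qed (use assms i in auto)
then show ?thesis unfolding 3 by (intro abs_divide_2pi_le) (simp add: abs_minus)
qed

text \<open>The same cut-off, one derivative later: the factor \<open>t\<close> required by the tail
  bound now comes from the differentiation.\<close>

lemma sinc_kernel_deriv_bias:
  assumes "a \<ge> 1"
  shows "\<bar>(\<integral>x. a\<^sup>2 * sinc_kernel_deriv (a * (w - x)) \<partial>gauss m) - (m - w) * normal_density m 1 w\<bar> \<le> exp (- a\<^sup>2 / 2)"
proof -
  let ?g = "\<lambda>t. t * sin (t * (w - m)) * exp (- t\<^sup>2 / 2)"
  have inner: "(\<integral>x. t * sin (t * (w - x)) \<partial>gauss m) = ?g t" for t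
    using integral_gauss_sin[of "t * (w - m)" "- t"]
    by (subst integral_gauss_shift) (auto simp: algebra_simps)
  have bd: "\<bar>t * sin (t * (w - x))\<bar> \<le> a" if "\<bar>t\<bar> \<le> a" for t x
    using that abs_sin_le_one[of "t * (w - x)"] mult_mono[of "\<bar>t\<bar>" a "\<bar>sin (t * (w - x))\<bar>" 1]
    by (simp add: abs_mult)
  have "(\<integral>x. a\<^sup>2 * sinc_kernel_deriv (a * (w - x)) \<partial>gauss m) =
      - (\<integral>x. (\<integral>t. indicator {-a..a} t * (t * sin (t * (w - x))) \<partial>lborel) \<partial>gauss m) / (2 * pi)"
    using assms by (simp add: sinc_kernel_deriv_window)
  also have "\<dots> = - (\<integral>t. indicator {-a..a} t * ?g t \<partial>lborel) / (2 * pi)"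
    by (subst window_Fubini[where B=a]) (auto simp: inner bd simp del: Bochner_Integration.integral_mult_right_zero)
  finally have 1: "(\<integral>x. a\<^sup>2 * sinc_kernel_deriv (a * (w - x)) \<partial>gauss m) = - (\<integral>t. ?g t * indicator {-a..a} t \<partial>lborel) / (2 * pi)"
    by (simp add: mult.commute)
  have 2: "(m - w) * normal_density m 1 w = - (\<integral>t. ?g t \<partial>lborel) / (2 * pi)"
  proof -
    have "1 / sqrt (2 * pi) = sqrt (2 * pi) / (2 * pi)" by (simp add: real_div_sqrt divide_simps)
    then show ?thesis
      unfolding integral_sin_exp(2) normal_density_def by (simp add: left_diff_distrib diff_divide_distrib)
  qed
  have i: "integrable lborel (\<lambda>t. ?g t * indicator A t)" if "A \<in> sets borel" for A
    by (rule integrable_real_mult_indicator) (use that integral_sin_exp in auto)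
  have "(\<integral>t. ?g t \<partial>lborel) = (\<integral>t. ?g t * indicator {-a..a} t + ?g t * indicator (- {-a..a}) t \<partial>lborel)"
    by (intro Bochner_Integration.integral_cong) (auto split: split_indicator)
  also have "\<dots> = (\<integral>t. ?g t * indicator {-a..a} t \<partial>lborel) + (\<integral>t. ?g t * indicator (- {-a..a}) t \<partial>lborel)"
    by (intro Bochner_Integration.integral_add i) auto
  finally have 3: "(\<integral>x. a\<^sup>2 * sinc_kernel_deriv (a * (w - x)) \<partial>gauss m) - (m - w) * normal_density m 1 w =
      (\<integral>t. ?g t * indicator (- {-a..a}) t \<partial>lborel) / (2 * pi)"
    unfolding 1 2 by (simp add: field_simps)
  have "\<bar>\<integral>t. ?g t * indicator (- {-a..a}) t \<partial>lborel\<bar> \<le> 2 * exp (- a\<^sup>2 / 2)"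
  proof (rule gauss_tail_integral_le)
    show "\<bar>?g t\<bar> \<le> \<bar>t\<bar> * exp (- t\<^sup>2 / 2)" if "a < \<bar>t\<bar>" for t
      using abs_sin_le_one[of "t * (w - m)"] by (auto simp: abs_mult intro!: mult_right_mono mult_left_le)
  qed (use assms i in auto)
then show ?thesis unfolding 3 by (rule abs_divide_2pi_le)
qed

subsection \<open>Independent Gaussian observations\<close>

lemma indep_vars_PiM_coordinates:
  assumes M: "\<And>i. prob_space (M i)" and "I \<noteq> {}"
  shows "prob_space.indep_vars (PiM I M) M (\<lambda>i u. u i) I"
proof -
  interpret product_prob_space M I
    using M by (simp add: product_prob_space_def product_prob_space_axioms_def product_sigma_finite_def prob_space_imp_sigma_finite)
  have "distr (PiM I M) (PiM I M) (\<lambda>x. \<lambda>i\<in>I. x i) = distr (PiM I M) (PiM I M) (\<lambda>x. x)"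
    by (rule distr_cong) (auto simp: space_PiM PiE_def extensional_restrict)
  also have "\<dots> = PiM I (\<lambda>i. distr (PiM I M) (M i) (\<lambda>u. u i))"
    by (simp, rule PiM_cong) (auto simp: PiM_component)
  finally show ?thesis
    by (subst indep_vars_iff_distr_eq_PiM'[OF \<open>I \<noteq> {}\<close>]) auto
qed

definition obs_law :: "nat \<Rightarrow> (nat \<Rightarrow> real) \<Rightarrow> (nat \<Rightarrow> real) measure" where
  "obs_law n \<theta> = PiM {1..n} (\<lambda>k. gauss (\<theta> k))"

lemma prob_space_obs_law: "prob_space (obs_law n \<theta>)"
  unfolding obs_law_def by (intro prob_space_PiM prob_space_gauss)

lemma sets_obs_law [measurable_cong]: "sets (obs_law n \<theta>) = sets (PiM {1..n} (\<lambda>_. borel))"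
  unfolding obs_law_def by (intro sets_PiM_cong) auto

lemma obs_law_component: "k \<in> {1..n} \<Longrightarrow> (\<lambda>u. u k) \<in> borel_measurable (obs_law n \<theta>)"
  by (subst measurable_cong_sets[OF sets_obs_law refl]) simp

lemma distr_obs_law_component: "k \<in> {1..n} \<Longrightarrow> distr (obs_law n \<theta>) borel (\<lambda>u. u k) = gauss (\<theta> k)"
proof -
  interpret product_prob_space "\<lambda>k. gauss (\<theta> k)" "{1..n}"
    by (simp add: product_prob_space_def product_prob_space_axioms_def product_sigma_finite_def
        prob_space_imp_sigma_finite prob_space_gauss)
  assume "k \<in> {1..n}"
  then have "distr (obs_law n \<theta>) (gauss (\<theta> k)) (\<lambda>u. u k) = gauss (\<theta> k)"
    unfolding obs_law_def by (rule PiM_component)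
  moreover have "distr (obs_law n \<theta>) (gauss (\<theta> k)) (\<lambda>u. u k) = distr (obs_law n \<theta>) borel (\<lambda>u. u k)"
    by (rule distr_cong) auto
  ultimately show ?thesis by simp
qed

lemma nn_integral_obs_law_component:
  assumes "k \<in> {1..n}" and [measurable]: "f \<in> borel_measurable borel"
  shows "(\<integral>\<^sup>+u. f (u k) \<partial>obs_law n \<theta>) = (\<integral>\<^sup>+x. f x \<partial>gauss (\<theta> k))"
  using assms by (subst distr_obs_law_component[OF assms(1), symmetric], subst nn_integral_distr) auto

text \<open>The observations have different means, so Hoeffding's inequality is used for independent
  summands that are not identically distributed, each of range \<open>2 * B\<close>.\<close>

lemma obs_law_Hoeffding:
  fixes f :: "real \<Rightarrow> real"
  assumes n: "n \<ge> 1" and [measurable]: "f \<in> borel_measurable borel"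
    and B: "\<And>x. \<bar>f x\<bar> \<le> B" "B > 0" and d: "d \<ge> 0"
  shows "measure (obs_law n \<theta>) {u \<in> space (obs_law n \<theta>).
      d \<le> \<bar>(\<Sum>k=1..n. f (u k)) / n - (\<Sum>k=1..n. \<integral>x. f x \<partial>gauss (\<theta> k)) / n\<bar>}
    \<le> 2 * exp (- (n * d\<^sup>2 / (2 * B\<^sup>2)))"
proof -
  interpret P: prob_space "obs_law n \<theta>" by (rule prob_space_obs_law)
  have mean: "P.expectation (\<lambda>u. f (u k)) = (\<integral>x. f x \<partial>gauss (\<theta> k))" if "k \<in> {1..n}" for k
    using that by (subst distr_obs_law_component[OF that, symmetric], subst integral_distr) auto
  have "P.indep_vars (\<lambda>k. gauss (\<theta> k)) (\<lambda>k u. u k) {1..n}"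
    unfolding obs_law_def using n by (intro indep_vars_PiM_coordinates prob_space_gauss) auto
  then have indep: "P.indep_vars (\<lambda>_. borel) (\<lambda>k u. f (u k)) {1..n}"
    by (rule P.indep_vars_compose2) auto
  interpret H: Hoeffding_ineq "obs_law n \<theta>" "{1..n}" "\<lambda>k u. f (u k)" "\<lambda>_. - B" "\<lambda>_. B"
      "\<Sum>k=1..n. P.expectation (\<lambda>u. f (u k))"
    by unfold_locales (use indep B in \<open>auto simp: abs_le_iff minus_le_iff\<close>)
  have eq: "d \<le> \<bar>x / n - y / n\<bar> \<longleftrightarrow> n * d \<le> \<bar>x - y\<bar>" for x y
    using n by (simp add: diff_divide_distrib[symmetric] le_divide_eq mult.commute)
  have "measure (obs_law n \<theta>) {u \<in> space (obs_law n \<theta>).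
        n * d \<le> \<bar>(\<Sum>k=1..n. f (u k)) - (\<Sum>k=1..n. P.expectation (\<lambda>u. f (u k)))\<bar>}
      \<le> 2 * exp (- 2 * (n * d)\<^sup>2 / (\<Sum>k=1..n. (B - - B)\<^sup>2))"
    by (rule H.Hoeffding_ineq_abs_ge) (use n B d in auto)
  also have "- 2 * (n * d)\<^sup>2 / (\<Sum>k=1..n. (B - - B)\<^sup>2) = - (n * d\<^sup>2 / (2 * B\<^sup>2))"
    using n B(2) by (simp add: field_simps power2_eq_square)
  finally show ?thesis
    by (simp add: eq mean)
qed

text \<open>A function that ignores coordinate \<open>k\<close> is independent of
  \<open>u k\<close>, which may then be replaced by a fresh copy. The outer integral on the right
  keeps the full law, so the right-hand sides for different \<open>k\<close> involve the same
  measure.\<close>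

lemma obs_law_resample:
  assumes k: "k \<in> {1..n}"
    and f [measurable]: "case_prod f \<in> borel_measurable (PiM {1..n} (\<lambda>_. borel) \<Otimes>\<^sub>M borel)"
    and indep: "\<And>u x w. f (u(k := w)) x = f u x"
  shows "(\<integral>\<^sup>+u. f u (u k) \<partial>obs_law n \<theta>) = (\<integral>\<^sup>+u. (\<integral>\<^sup>+x. f u x \<partial>gauss (\<theta> k)) \<partial>obs_law n \<theta>)"
proof -
  interpret product_prob_space "\<lambda>k. gauss (\<theta> k)" "{1..n}"
    by (simp add: product_prob_space_def product_prob_space_axioms_def product_sigma_finite_def
        prob_space_imp_sigma_finite prob_space_gauss)
  have g1: "emeasure (gauss (\<theta> k)) UNIV = 1"
    using prob_space.emeasure_space_1[OF prob_space_gauss[of "\<theta> k"]] by simp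
  define J where "J = {1..n} - {k}"
  have J: "{1..n} = insert k J" "finite J" "k \<notin> J" using k by (auto simp: J_def)
  have [measurable_cong]: "sets (PiM (insert k J) (\<lambda>k. gauss (\<theta> k))) = sets (PiM {1..n} (\<lambda>_. borel))"
    unfolding J(1)[symmetric] by (intro sets_PiM_cong) auto
  have kc[measurable]: "(\<lambda>u. u k) \<in> borel_measurable (PiM {1..n} (\<lambda>_. borel))"
    using k by simp
  have m1: "(\<lambda>u. f u (u k)) \<in> borel_measurable (PiM (insert k J) (\<lambda>k. gauss (\<theta> k)))"
    by measurable
  have m2: "(\<lambda>u. \<integral>\<^sup>+x. f u x \<partial>gauss (\<theta> k)) \<in> borel_measurable (PiM (insert k J) (\<lambda>k. gauss (\<theta> k)))"
    by measurable
  have "(\<integral>\<^sup>+u. f u (u k) \<partial>obs_law n \<theta>) =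
      (\<integral>\<^sup>+v. (\<integral>\<^sup>+y. f (v(k := y)) ((v(k := y)) k) \<partial>gauss (\<theta> k)) \<partial>PiM J (\<lambda>k. gauss (\<theta> k)))"
    unfolding obs_law_def J(1) by (rule product_nn_integral_insert[OF J(2,3) m1])
  also have "\<dots> = (\<integral>\<^sup>+v. (\<integral>\<^sup>+y. (\<integral>\<^sup>+x. f (v(k := y)) x \<partial>gauss (\<theta> k)) \<partial>gauss (\<theta> k)) \<partial>PiM J (\<lambda>k. gauss (\<theta> k)))"
    by (simp add: indep g1)
  also have "\<dots> = (\<integral>\<^sup>+u. (\<integral>\<^sup>+x. f u x \<partial>gauss (\<theta> k)) \<partial>obs_law n \<theta>)"
    unfolding obs_law_def J(1) by (rule product_nn_integral_insert[OF J(2,3) m2, symmetric])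
  finally show ?thesis .
qed

subsection \<open>Leaving out one observation\<close>

definition kde :: "nat \<Rightarrow> nat set \<Rightarrow> (nat \<Rightarrow> real) \<Rightarrow> real \<Rightarrow> real" where
  "kde n I u x = (\<Sum>k\<in>I. sqrt (2 * ln n) * sinc_kernel (sqrt (2 * ln n) * (x - u k))) / n"

definition kde_deriv :: "nat \<Rightarrow> nat set \<Rightarrow> (nat \<Rightarrow> real) \<Rightarrow> real \<Rightarrow> real" where
  "kde_deriv n I u x = (\<Sum>k\<in>I. (sqrt (2 * ln n))\<^sup>2 * sinc_kernel_deriv (sqrt (2 * ln n) * (x - u k))) / n"

text \<open>The truncation at \<open>r\<close> is needed because the sinc kernel takes negative
  values, so the density estimate may be small or negative. The index set is a parameter so that an
  observation can be left out while the normalisation by \<open>n\<close> stays.\<close>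

definition score :: "real \<Rightarrow> nat \<Rightarrow> nat set \<Rightarrow> (nat \<Rightarrow> real) \<Rightarrow> real \<Rightarrow> real" where
  "score r n I u x = kde_deriv n I u x / max r (kde n I u x)"

lemma phi_hat_eq_kde: "phi_hat n u = kde n {1..n} u"
  by (simp add: phi_hat_def kde_def fun_eq_iff sum_distrib_left sum_divide_distrib)

lemma deriv_phi_hat: "deriv (phi_hat n u) x = kde_deriv n {1..n} u x"
proof (rule DERIV_imp_deriv)
  show "(phi_hat n u has_real_derivative kde_deriv n {1..n} u x) (at x)"
    unfolding phi_hat_def kde_deriv_def power2_eq_square
    by (rule derivative_eq_intros DERIV_chain2[OF DERIV_sinc_kernel] refl)+
       (simp add: sum_distrib_left mult_ac sum_divide_distrib del: real_sqrt_mult_self)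
qed

lemma kde_measurable [measurable]:
  assumes "I \<subseteq> {1..n}"
  shows "case_prod (kde n I) \<in> borel_measurable (PiM {1..n} (\<lambda>_. borel) \<Otimes>\<^sub>M borel)"
    and "case_prod (kde_deriv n I) \<in> borel_measurable (PiM {1..n} (\<lambda>_. borel) \<Otimes>\<^sub>M borel)"
proof -
  have [measurable]: "(\<lambda>p. fst p k) \<in> borel_measurable (PiM {1..n} (\<lambda>_. borel :: real measure) \<Otimes>\<^sub>M (borel :: real measure))"
    if "k \<in> I" for k
    using that assms by (intro measurable_compose[OF measurable_fst measurable_component_singleton]) auto
  show "case_prod (kde n I) \<in> borel_measurable (PiM {1..n} (\<lambda>_. borel) \<Otimes>\<^sub>M borel)"
    "case_prod (kde_deriv n I) \<in> borel_measurable (PiM {1..n} (\<lambda>_. borel) \<Otimes>\<^sub>M borel)"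
    unfolding kde_def kde_deriv_def case_prod_unfold
    by (intro borel_measurable_divide borel_measurable_const borel_measurable_sum; measurable)+
qed

lemma score_measurable [measurable]:
  assumes [simp]: "I \<subseteq> {1..n}"
  shows "case_prod (score r n I) \<in> borel_measurable (PiM {1..n} (\<lambda>_. borel) \<Otimes>\<^sub>M borel)"
proof -
  note kde_measurable[OF assms, measurable]
  show ?thesis unfolding score_def case_prod_unfold by measurable
qed

text \<open>With \<open>P\<close> and \<open>Q\<close> the truncated denominators, the difference is
  \<open>(p' - q') / P + (q' / Q) * ((Q - P) / P)\<close>. Keeping \<open>1 / P\<close> in place of
  \<open>1 / r\<close> preserves the gain where the density is large; the second claim exchanges
  \<open>P\<close> for \<open>Q\<close>.\<close>

lemma abs_ratio_max_diff_le:
  fixes p q p' q' A r :: real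
  assumes r: "r > 0" and A: "\<bar>p - q\<bar> \<le> A" "\<bar>p' - q'\<bar> \<le> A"
  shows "\<bar>p' / max r p - q' / max r q\<bar> \<le> A / max r p * (1 + \<bar>q' / max r q\<bar>)"
    and "1 / max r p \<le> (1 + A / r) / max r q"
proof -
  define P Q where "P = max r p" and "Q = max r q"
  have PQ: "P > 0" "Q > 0" "r \<le> P" "\<bar>Q - P\<bar> \<le> A"
    using r A by (auto simp: P_def Q_def)
  have A0: "A \<ge> 0" using A by linarith
  have "p' / P - q' / Q = (p' - q') / P + (q' / Q) * ((Q - P) / P)"
    using PQ by (simp add: field_simps)
  also have "\<bar>\<dots>\<bar> \<le> \<bar>p' - q'\<bar> / P + \<bar>q' / Q\<bar> * (\<bar>Q - P\<bar> / P)"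
    using PQ by (intro order_trans[OF abs_triangle_ineq]) (simp add: abs_mult)
  also have "\<dots> \<le> A / P + \<bar>q' / Q\<bar> * (A / P)"
    using PQ A by (intro add_mono mult_left_mono divide_right_mono) auto
  finally show "\<bar>p' / max r p - q' / max r q\<bar> \<le> A / max r p * (1 + \<bar>q' / max r q\<bar>)"
    unfolding P_def Q_def by (simp add: algebra_simps)
  have "Q \<le> P + A" using PQ by linarith
  also have "A \<le> A / r * P" using PQ r A0 mult_left_mono[OF PQ(3), of "A / r"] by simp
  finally have "Q \<le> (1 + A / r) * P" by (simp add: algebra_simps)
  then show "1 / max r p \<le> (1 + A / r) / max r q"
    using PQ unfolding P_def[symmetric] Q_def[symmetric] by (simp add: field_simps)
qed

text \<open>The usual bound by \<open>2 * x\<^sup>2 + 2 * y\<^sup>2\<close> would double the oracle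
  risk. The weighted inequality \<open>0 \<le> d * (P - Q)\<^sup>2\<close> keeps the leading factor
  close to 1 for small \<open>d\<close>.\<close>

lemma square_perturb:
  fixes z g h d :: real
  assumes d: "d > 0" and gh: "\<bar>g - h\<bar> \<le> d * (1 + \<bar>h\<bar>)"
  shows "(z + g)\<^sup>2 \<le> (1 + d) ^ 3 * (z + h)\<^sup>2 + d * (1 + d) * (1 + \<bar>z\<bar>)\<^sup>2"
proof -
  define P Q where "P = (1 + d) * \<bar>z + h\<bar>" and "Q = 1 + \<bar>z\<bar>"
  have "\<bar>h\<bar> \<le> \<bar>z + h\<bar> + \<bar>z\<bar>" by linarith
  then have "d * (1 + \<bar>h\<bar>) \<le> d * (1 + \<bar>z + h\<bar> + \<bar>z\<bar>)" using d by simp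
  with gh have "\<bar>z + g\<bar> \<le> P + d * Q"
    unfolding P_def Q_def by (simp add: algebra_simps)
  then have "\<bar>z + g\<bar>\<^sup>2 \<le> (P + d * Q)\<^sup>2" by (rule power_mono) simp
  also have "\<dots> \<le> (1 + d) * P\<^sup>2 + d * (1 + d) * Q\<^sup>2"
  proof -
    have "0 \<le> d * (P - Q)\<^sup>2" using d by simp
    then show ?thesis by (simp add: power2_eq_square algebra_simps)
  qed
  finally show ?thesis
    by (simp add: P_def Q_def power_mult_distrib power3_eq_cube power2_eq_square mult_ac)
qed

text \<open>The numerator dominates both \<open>sqrt (2 * ln n)\<close> and \<open>2 * ln n\<close>,
  which bound one summand of \<open>kde\<close> and of \<open>kde_deriv\<close>; \<open>r\<close> is
  the smallest possible denominator.\<close>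

definition loo_error :: "real \<Rightarrow> nat \<Rightarrow> real" where
  "loo_error r n = (1 + 2 * ln n) / (n * r)"

text \<open>Both directions are used: one removes the observation at which the score is evaluated,
  the other restores the full sample after that observation has been replaced by an independent
  copy.\<close>

lemma score_leave_one_out:
  assumes n: "n \<ge> 2" and r: "r > 0" and k: "k \<in> I" "finite I"
  shows "\<bar>score r n I u x - score r n (I - {k}) u x\<bar> \<le> loo_error r n * (1 + \<bar>score r n (I - {k}) u x\<bar>)"
    and "\<bar>score r n (I - {k}) u x - score r n I u x\<bar> \<le> loo_error r n * (1 + \<bar>score r n I u x\<bar>)"
proof -
  define a A where "a = sqrt (2 * ln n)" and "A = (1 + 2 * ln n) / n"
  have ln: "ln (real n) \<ge> 0" using n by simp
  have a: "a \<ge> 0" "a\<^sup>2 = 2 * ln n" using ln by (simp_all add: a_def)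
  have "0 \<le> (a - 1)\<^sup>2" by simp
  then have "2 * a \<le> a\<^sup>2 + 1" by (simp add: power2_eq_square algebra_simps)
  with a have a': "a \<le> 1 + 2 * ln n" by simp
  have "kde n I u x - kde n (I - {k}) u x = a * sinc_kernel (a * (x - u k)) / n"
    using k by (simp add: kde_def a_def sum.remove add_divide_distrib)
  then have 1: "\<bar>kde n I u x - kde n (I - {k}) u x\<bar> \<le> A"
    using abs_sinc_kernel_le[OF a(1), of "x - u k"] a' by (simp add: A_def divide_right_mono)
  have "kde_deriv n I u x - kde_deriv n (I - {k}) u x = a\<^sup>2 * sinc_kernel_deriv (a * (x - u k)) / n"
    using k by (simp add: kde_deriv_def a_def sum.remove add_divide_distrib)
  then have 2: "\<bar>kde_deriv n I u x - kde_deriv n (I - {k}) u x\<bar> \<le> A"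
    using abs_sinc_kernel_deriv_le[OF a(1), of "x - u k"] a by (simp add: A_def divide_right_mono)
  have A0: "A \<ge> 0" using 1 by linarith
  have AP: "A / max r p \<le> loo_error r n" for p
  proof -
    have "A / max r p \<le> A / r" using A0 r by (intro divide_left_mono) auto
    then show ?thesis by (simp add: A_def loo_error_def)
  qed
  show "\<bar>score r n I u x - score r n (I - {k}) u x\<bar> \<le> loo_error r n * (1 + \<bar>score r n (I - {k}) u x\<bar>)"
    unfolding score_def
    by (rule order_trans[OF abs_ratio_max_diff_le(1)[OF r 1 2] mult_right_mono[OF AP]]) simp
  show "\<bar>score r n (I - {k}) u x - score r n I u x\<bar> \<le> loo_error r n * (1 + \<bar>score r n I u x\<bar>)"
    unfolding score_def
    by (rule order_trans[OF abs_ratio_max_diff_le(1)[OF r] mult_right_mono[OF AP]])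
       (use 1 2 in \<open>auto simp: abs_minus_commute\<close>)
qed

text \<open>Each weighted sum of squares is one common constant plus the total weight times the
  squared distance to the weighted mean \<open>m\<close>; so no \<open>y'\<close> does better than
  \<open>m\<close>.\<close>

lemma weighted_square_le:
  fixes w \<theta> :: "'a \<Rightarrow> real"
  assumes "\<And>k. k \<in> I \<Longrightarrow> 0 \<le> w k" and W: "(\<Sum>k\<in>I. w k) > 0"
  defines "m \<equiv> (\<Sum>k\<in>I. w k * \<theta> k) / (\<Sum>k\<in>I. w k)"
  shows "(\<Sum>k\<in>I. w k * (y - \<theta> k)\<^sup>2) \<le> (\<Sum>k\<in>I. w k * (y' - \<theta> k)\<^sup>2) + (\<Sum>k\<in>I. w k) * (y - m)\<^sup>2"
proof -
  let ?W = "\<Sum>k\<in>I. w k"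
  have m: "(\<Sum>k\<in>I. w k * \<theta> k) = ?W * m" using W by (simp add: m_def)
  have exp: "(\<Sum>k\<in>I. w k * (y - \<theta> k)\<^sup>2) = (\<Sum>k\<in>I. w k * (\<theta> k)\<^sup>2) - ?W * m\<^sup>2 + ?W * (y - m)\<^sup>2" for y
  proof -
    have "(\<Sum>k\<in>I. w k * (y - \<theta> k)\<^sup>2) = (\<Sum>k\<in>I. w k * (\<theta> k)\<^sup>2 + y\<^sup>2 * w k - 2 * y * (w k * \<theta> k))"
      by (rule sum.cong) (simp_all add: power2_eq_square algebra_simps)
    also have "\<dots> = (\<Sum>k\<in>I. w k * (\<theta> k)\<^sup>2) + y\<^sup>2 * ?W - 2 * y * (?W * m)"
      by (simp add: sum.distrib sum_subtractf sum_distrib_left[symmetric] m)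
    finally show ?thesis by (simp add: power2_eq_square algebra_simps)
  qed
  have "0 \<le> ?W * (y' - m)\<^sup>2" using W by simp
  then show ?thesis unfolding exp[of y] exp[of y'] by linarith
qed

subsection \<open>Reduction to the Bayes score\<close>

definition mix :: "nat \<Rightarrow> (nat \<Rightarrow> real) \<Rightarrow> real \<Rightarrow> real" where
  "mix n \<theta> x = (\<Sum>k=1..n. normal_density (\<theta> k) 1 x) / n"

definition mix_deriv :: "nat \<Rightarrow> (nat \<Rightarrow> real) \<Rightarrow> real \<Rightarrow> real" where
  "mix_deriv n \<theta> x = (\<Sum>k=1..n. (\<theta> k - x) * normal_density (\<theta> k) 1 x) / n"

lemma mix_measurable [measurable]: "mix n \<theta> \<in> borel_measurable borel" "mix_deriv n \<theta> \<in> borel_measurable borel"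
  unfolding mix_def mix_deriv_def by measurable

lemma mix_pos: "n \<ge> 1 \<Longrightarrow> mix n \<theta> x > 0"
  unfolding mix_def by (intro divide_pos_pos sum_pos) (auto intro: normal_density_pos)

text \<open>Pointwise Bayes optimality: the posterior mean at \<open>x\<close> is \<open>x + mix_deriv / mix\<close>.\<close>

lemma posterior_square_le:
  assumes n: "n \<ge> 1"
  shows "(\<Sum>k=1..n. normal_density (\<theta> k) 1 x * (x + s - \<theta> k)\<^sup>2) \<le>
    (\<Sum>k=1..n. normal_density (\<theta> k) 1 x * (y - \<theta> k)\<^sup>2) +
      n * mix n \<theta> x * (s - mix_deriv n \<theta> x / mix n \<theta> x)\<^sup>2"
proof -
  let ?w = "\<lambda>k. normal_density (\<theta> k) 1 x"
  have W: "(\<Sum>k=1..n. ?w k) = n * mix n \<theta> x" "n * mix n \<theta> x > 0"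
    using n mix_pos[OF n, of \<theta> x] by (simp add: mix_def, intro mult_pos_pos) auto
  have D: "(\<Sum>k=1..n. ?w k * \<theta> k) = n * mix_deriv n \<theta> x + x * (n * mix n \<theta> x)"
  proof -
    have "n * mix_deriv n \<theta> x = (\<Sum>k=1..n. (\<theta> k - x) * ?w k)"
      using n by (simp add: mix_deriv_def)
    then show ?thesis
      unfolding W(1)[symmetric] by (simp add: sum_distrib_left sum.distrib[symmetric] algebra_simps)
  qed
  have "(\<Sum>k=1..n. ?w k * \<theta> k) / (\<Sum>k=1..n. ?w k) = mix_deriv n \<theta> x / mix n \<theta> x + x"
    unfolding D W(1) using mix_pos[OF n, of \<theta> x] n by (simp add: add_divide_distrib)
  then show ?thesis
    using weighted_square_le[of "{1..n}" ?w "x + s" \<theta> y] W by (simp add: algebra_simps)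
qed

lemma nn_integral_gauss_square: "(\<integral>\<^sup>+x. ennreal ((1 + \<bar>x - m\<bar>)\<^sup>2) \<partial>gauss m) \<le> 4"
proof -
  have "(\<integral>\<^sup>+x. ennreal ((1 + \<bar>x - m\<bar>)\<^sup>2) \<partial>gauss m) = (\<integral>\<^sup>+z. ennreal ((1 + \<bar>z\<bar>)\<^sup>2) \<partial>gauss 0)"
    by (subst nn_integral_gauss_shift) auto
  also have "\<dots> = (\<integral>\<^sup>+z. ennreal (std_normal_density z * (1 + \<bar>z\<bar>)\<^sup>2) \<partial>lborel)"
    by (subst nn_integral_gauss) (auto simp: ennreal_mult)
  also have "\<dots> \<le> (\<integral>\<^sup>+z. ennreal (2 * std_normal_density z + 2 * (std_normal_density z * z ^ (2 * 1))) \<partial>lborel)"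
  proof (intro nn_integral_mono ennreal_leI)
    fix z :: real
    have "0 \<le> (1 - \<bar>z\<bar>)\<^sup>2" by simp
    then have "(1 + \<bar>z\<bar>)\<^sup>2 \<le> 2 + 2 * z\<^sup>2" by (simp add: power2_eq_square algebra_simps)
    then have "std_normal_density z * (1 + \<bar>z\<bar>)\<^sup>2 \<le> std_normal_density z * (2 + 2 * z\<^sup>2)"
      by (intro mult_left_mono) auto
    then show "std_normal_density z * (1 + \<bar>z\<bar>)\<^sup>2 \<le> 2 * std_normal_density z + 2 * (std_normal_density z * z ^ (2 * 1))"
      by (simp add: algebra_simps power2_eq_square)
  qed
  also have "\<dots> = ennreal (\<integral>z. 2 * std_normal_density z + 2 * (std_normal_density z * z ^ (2 * 1)) \<partial>lborel)"
    by (intro nn_integral_eq_integral)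
       (auto intro!: integrable_std_normal_moment Bochner_Integration.integrable_add integrable_mult_right simp del: mult_1_right power2_eq_square)
  also have "(\<integral>z. 2 * std_normal_density z + 2 * (std_normal_density z * z ^ (2 * 1)) \<partial>lborel) = 2 + 2 * 1"
  proof (subst Bochner_Integration.integral_add)
    show "integrable lborel (\<lambda>z. 2 * (std_normal_density z * z ^ (2 * 1)))"
      by (intro integrable_mult_right integrable_std_normal_moment)
    show "(\<integral>z. 2 * std_normal_density z \<partial>lborel) + (\<integral>z. 2 * (std_normal_density z * z ^ (2 * 1)) \<partial>lborel) = 2 + 2 * 1"
      using integral_std_normal_moment_even[of 1] by simp
  qed auto
  finally show ?thesis by simp
qed

definition separable_risk :: "nat \<Rightarrow> (nat \<Rightarrow> real) \<Rightarrow> (real \<Rightarrow> real) \<Rightarrow> ennreal" where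
  "separable_risk n \<theta> h = (\<Sum>k=1..n. \<integral>\<^sup>+x. ennreal ((h x - \<theta> k)\<^sup>2) \<partial>gauss (\<theta> k))"

text \<open>This measures the loss from using the estimated score in place of that of the posterior
  mean. The weight \<open>n * mix n \<theta>\<close> is the sum of the \<open>n\<close> component
  densities.\<close>

definition score_defect :: "real \<Rightarrow> nat \<Rightarrow> (nat \<Rightarrow> real) \<Rightarrow> ennreal" where
  "score_defect r n \<theta> = (\<integral>\<^sup>+x. (\<integral>\<^sup>+u. ennreal (n * mix n \<theta> x *
     (score r n {1..n} u x - mix_deriv n \<theta> x / mix n \<theta> x)\<^sup>2) \<partial>obs_law n \<theta>) \<partial>lborel)"

text \<open>Here the evaluation point is independent of the sample. Bringing the sum over
  \<open>k\<close> inside both integrals makes all components meet at the same \<open>x\<close>,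
  where the pointwise Bayes inequality applies with \<open>y = h x\<close>.\<close>

lemma score_risk_integrated_le:
  assumes n: "n \<ge> 1" and [measurable]: "h \<in> borel_measurable borel"
  shows "(\<Sum>k=1..n. \<integral>\<^sup>+u. (\<integral>\<^sup>+x. ennreal ((x - \<theta> k + score r n {1..n} u x)\<^sup>2) \<partial>gauss (\<theta> k)) \<partial>obs_law n \<theta>)
    \<le> separable_risk n \<theta> h + score_defect r n \<theta>"
proof -
  interpret P: prob_space "obs_law n \<theta>" by (rule prob_space_obs_law)
  interpret pair_sigma_finite "obs_law n \<theta>" lborel ..
  have [measurable]: "(\<lambda>p. score r n {1..n} (fst p) (snd p)) \<in> borel_measurable (obs_law n \<theta> \<Otimes>\<^sub>M lborel)"
  proof -
    have "case_prod (score r n {1..n}) \<in> borel_measurable (obs_law n \<theta> \<Otimes>\<^sub>M lborel)"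
      using score_measurable[of "{1..n}" n r]
      by (subst measurable_cong_sets[OF sets_pair_measure_cong[OF sets_obs_law sets_lborel] refl]) auto
    then show ?thesis by (simp add: case_prod_unfold)
  qed
  have sx: "score r n {1..n} u \<in> borel_measurable borel" if "u \<in> space (obs_law n \<theta>)" for u
  proof -
    have "(\<lambda>x. (\<lambda>p. score r n {1..n} (fst p) (snd p)) (u, x)) \<in> borel_measurable lborel"
      by (rule measurable_Pair2[OF _ that]) measurable
    then show ?thesis by simp
  qed
  let ?A = "\<lambda>u x. \<Sum>k=1..n. normal_density (\<theta> k) 1 x * (x + score r n {1..n} u x - \<theta> k)\<^sup>2"
  let ?H = "\<lambda>x. \<Sum>k=1..n. normal_density (\<theta> k) 1 x * (h x - \<theta> k)\<^sup>2"
  let ?E = "\<lambda>u x. n * mix n \<theta> x * (score r n {1..n} u x - mix_deriv n \<theta> x / mix n \<theta> x)\<^sup>2"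
  have "(\<Sum>k=1..n. \<integral>\<^sup>+u. (\<integral>\<^sup>+x. ennreal ((x - \<theta> k + score r n {1..n} u x)\<^sup>2) \<partial>gauss (\<theta> k)) \<partial>obs_law n \<theta>)
    = (\<Sum>k=1..n. \<integral>\<^sup>+u. (\<integral>\<^sup>+x. ennreal (normal_density (\<theta> k) 1 x * (x + score r n {1..n} u x - \<theta> k)\<^sup>2) \<partial>lborel) \<partial>obs_law n \<theta>)"
  proof (intro sum.cong refl nn_integral_cong)
    fix k u assume "u \<in> space (obs_law n \<theta>)"
    from sx[OF this] have [measurable]: "score r n {1..n} u \<in> borel_measurable borel" .
    show "(\<integral>\<^sup>+x. ennreal ((x - \<theta> k + score r n {1..n} u x)\<^sup>2) \<partial>gauss (\<theta> k)) =
        (\<integral>\<^sup>+x. ennreal (normal_density (\<theta> k) 1 x * (x + score r n {1..n} u x - \<theta> k)\<^sup>2) \<partial>lborel)"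
      by (subst nn_integral_gauss, measurable) (auto simp: ennreal_mult algebra_simps)
  qed
  also have "\<dots> = (\<integral>\<^sup>+u. (\<integral>\<^sup>+x. ennreal (?A u x) \<partial>lborel) \<partial>obs_law n \<theta>)"
  proof -
    have "(\<integral>\<^sup>+u. (\<integral>\<^sup>+x. ennreal (?A u x) \<partial>lborel) \<partial>obs_law n \<theta>) =
      (\<integral>\<^sup>+u. (\<Sum>k=1..n. \<integral>\<^sup>+x. ennreal (normal_density (\<theta> k) 1 x * (x + score r n {1..n} u x - \<theta> k)\<^sup>2) \<partial>lborel) \<partial>obs_law n \<theta>)"
    proof (rule nn_integral_cong)
      fix u assume "u \<in> space (obs_law n \<theta>)"
      from sx[OF this] have [measurable]: "score r n {1..n} u \<in> borel_measurable borel" .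
      show "(\<integral>\<^sup>+x. ennreal (?A u x) \<partial>lborel) =
        (\<Sum>k=1..n. \<integral>\<^sup>+x. ennreal (normal_density (\<theta> k) 1 x * (x + score r n {1..n} u x - \<theta> k)\<^sup>2) \<partial>lborel)"
      proof (subst nn_integral_sum[symmetric])
        show "(\<lambda>x. ennreal (normal_density (\<theta> k) 1 x * (x + score r n {1..n} u x - \<theta> k)\<^sup>2)) \<in> borel_measurable lborel" for k
          by measurable
      qed (auto simp: sum_ennreal)
    qed
    also have "\<dots> = (\<Sum>k=1..n. \<integral>\<^sup>+u. (\<integral>\<^sup>+x. ennreal (normal_density (\<theta> k) 1 x * (x + score r n {1..n} u x - \<theta> k)\<^sup>2) \<partial>lborel) \<partial>obs_law n \<theta>)"
      by (rule nn_integral_sum) measurable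
    finally show ?thesis by simp
  qed
  also have "\<dots> \<le> (\<integral>\<^sup>+u. (\<integral>\<^sup>+x. ennreal (?H x) + ennreal (?E u x) \<partial>lborel) \<partial>obs_law n \<theta>)"
    using posterior_square_le[OF n] mix_pos[OF n]
    by (intro nn_integral_mono) (simp add: less_imp_le sum_nonneg flip: ennreal_plus)
  also have "\<dots> = (\<integral>\<^sup>+u. (\<integral>\<^sup>+x. ennreal (?H x) \<partial>lborel) + (\<integral>\<^sup>+x. ennreal (?E u x) \<partial>lborel) \<partial>obs_law n \<theta>)"
  proof (rule nn_integral_cong)
    fix u assume "u \<in> space (obs_law n \<theta>)"
    from sx[OF this] have [measurable]: "score r n {1..n} u \<in> borel_measurable borel" .
    show "(\<integral>\<^sup>+x. ennreal (?H x) + ennreal (?E u x) \<partial>lborel) = (\<integral>\<^sup>+x. ennreal (?H x) \<partial>lborel) + (\<integral>\<^sup>+x. ennreal (?E u x) \<partial>lborel)"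
      by (rule nn_integral_add) measurable
  qed
  also have "\<dots> = (\<integral>\<^sup>+u. (\<integral>\<^sup>+x. ennreal (?H x) \<partial>lborel) \<partial>obs_law n \<theta>) + (\<integral>\<^sup>+u. (\<integral>\<^sup>+x. ennreal (?E u x) \<partial>lborel) \<partial>obs_law n \<theta>)"
    by (rule nn_integral_add) measurable
  also have "(\<integral>\<^sup>+u. (\<integral>\<^sup>+x. ennreal (?H x) \<partial>lborel) \<partial>obs_law n \<theta>) = separable_risk n \<theta> h"
    unfolding separable_risk_def
    by (simp add: P.emeasure_space_1 nn_integral_gauss sum_ennreal[symmetric] nn_integral_sum ennreal_mult)
  also have "(\<integral>\<^sup>+u. (\<integral>\<^sup>+x. ennreal (?E u x) \<partial>lborel) \<partial>obs_law n \<theta>) = score_defect r n \<theta>"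
    unfolding score_defect_def by (rule Fubini'[symmetric]) measurable
  finally show ?thesis .
qed

lemma score_ignores_left_out: "k \<notin> I \<Longrightarrow> score r n I (u(k := w)) x = score r n I u x"
proof -
  assume k: "k \<notin> I"
  then have "kde n I (u(k := w)) x = kde n I u x" "kde_deriv n I (u(k := w)) x = kde_deriv n I u x"
    unfolding kde_def kde_deriv_def by (auto intro!: sum.cong arg_cong2[where f="(/)"])
  then show ?thesis by (simp add: score_def)
qed

text \<open>The obstacle is that \<open>u k\<close> influences the score evaluated at
  \<open>u k\<close>. It is dropped from the score (\<open>step1\<close>), replaced by an
  independent copy (\<open>step2\<close>), and the \<open>k\<close>-th observation is put back
  (\<open>step3\<close>), so that all \<open>k\<close> share one score. The two passages cost
  \<open>(1 + d) ^ 3\<close> each.\<close>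

lemma score_oracle_reduction:
  assumes n: "n \<ge> 2" and r: "r > 0" and h [measurable]: "h \<in> borel_measurable borel"
  defines "d \<equiv> loo_error r n"
  shows "(\<Sum>k=1..n. \<integral>\<^sup>+u. ennreal ((u k - \<theta> k + score r n {1..n} u (u k))\<^sup>2) \<partial>obs_law n \<theta>) \<le>
    ennreal ((1 + d) ^ 6) * (separable_risk n \<theta> h + score_defect r n \<theta>) + ennreal (8 * real n * d * (1 + d) ^ 4)"
proof -
  interpret P: prob_space "obs_law n \<theta>" by (rule prob_space_obs_law)
  have d: "d > 0" using n r by (auto simp: d_def loo_error_def intro!: divide_pos_pos add_pos_nonneg)
  let ?s = "\<lambda>u. score r n {1..n} u"
  let ?l = "\<lambda>k u. score r n ({1..n} - {k}) u"
  have [measurable]: "(\<lambda>p. score r n I (fst p) (snd p)) \<in> borel_measurable (PiM {1..n} (\<lambda>_. borel) \<Otimes>\<^sub>M borel)"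
    if "I \<subseteq> {1..n}" for I
    using score_measurable[OF that, of r] by (simp add: case_prod_unfold)
  have msq: "(\<lambda>(u, x). ennreal ((x - c + score r n I u x)\<^sup>2)) \<in> borel_measurable (PiM {1..n} (\<lambda>_. borel) \<Otimes>\<^sub>M borel)"
    if "I \<subseteq> {1..n}" for I c
    unfolding case_prod_unfold using that by measurable
  have step1: "(\<integral>\<^sup>+u. ennreal ((u k - \<theta> k + ?s u (u k))\<^sup>2) \<partial>obs_law n \<theta>) \<le>
      ennreal ((1 + d) ^ 3) * (\<integral>\<^sup>+u. ennreal ((u k - \<theta> k + ?l k u (u k))\<^sup>2) \<partial>obs_law n \<theta>) + ennreal (4 * d * (1 + d))"
    if k: "k \<in> {1..n}" for k
  proof -
    have mk[measurable]: "(\<lambda>u. u k) \<in> borel_measurable (PiM {1..n} (\<lambda>_. borel :: real measure))"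
      using k by simp
    have ml: "(\<lambda>u. ennreal ((u k - \<theta> k + ?l k u (u k))\<^sup>2)) \<in> borel_measurable (obs_law n \<theta>)"
      using measurable_compose[OF measurable_Pair[OF measurable_ident mk] msq[of "{1..n}-{k}" "\<theta> k"]]
      by (subst measurable_cong_sets[OF sets_obs_law refl]) (auto simp: case_prod_unfold)
    have "(\<integral>\<^sup>+u. ennreal ((u k - \<theta> k + ?s u (u k))\<^sup>2) \<partial>obs_law n \<theta>) \<le>
      (\<integral>\<^sup>+u. ennreal ((1 + d) ^ 3) * ennreal ((u k - \<theta> k + ?l k u (u k))\<^sup>2) +
         ennreal (d * (1 + d)) * ennreal ((1 + \<bar>u k - \<theta> k\<bar>)\<^sup>2) \<partial>obs_law n \<theta>)"
      using square_perturb[OF d score_leave_one_out(1)[OF n r k finite_atLeastAtMost, folded d_def]] d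
      by (intro nn_integral_mono) (simp flip: ennreal_mult ennreal_plus)
    also have "\<dots> = ennreal ((1 + d) ^ 3) * (\<integral>\<^sup>+u. ennreal ((u k - \<theta> k + ?l k u (u k))\<^sup>2) \<partial>obs_law n \<theta>) +
        ennreal (d * (1 + d)) * (\<integral>\<^sup>+u. ennreal ((1 + \<bar>u k - \<theta> k\<bar>)\<^sup>2) \<partial>obs_law n \<theta>)"
      using ml by (subst nn_integral_add) (auto simp: nn_integral_cmult)
    also have "(\<integral>\<^sup>+u. ennreal ((1 + \<bar>u k - \<theta> k\<bar>)\<^sup>2) \<partial>obs_law n \<theta>) = (\<integral>\<^sup>+x. ennreal ((1 + \<bar>x - \<theta> k\<bar>)\<^sup>2) \<partial>gauss (\<theta> k))"
      by (rule nn_integral_obs_law_component[OF k]) measurable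
    also have "ennreal (d * (1 + d)) * \<dots> \<le> ennreal (d * (1 + d)) * 4"
      by (intro mult_left_mono nn_integral_gauss_square) auto
    also have "ennreal (d * (1 + d)) * 4 = ennreal (4 * d * (1 + d))"
      by (subst ennreal_numeral[symmetric], subst ennreal_mult[symmetric]) (use d in \<open>auto simp: mult_ac\<close>)
    finally show ?thesis by simp
  qed
  have step2: "(\<integral>\<^sup>+u. ennreal ((u k - \<theta> k + ?l k u (u k))\<^sup>2) \<partial>obs_law n \<theta>) =
      (\<integral>\<^sup>+u. (\<integral>\<^sup>+x. ennreal ((x - \<theta> k + ?l k u x)\<^sup>2) \<partial>gauss (\<theta> k)) \<partial>obs_law n \<theta>)" if k: "k \<in> {1..n}" for k
    by (rule obs_law_resample[OF k, where f="\<lambda>u x. ennreal ((x - \<theta> k + ?l k u x)\<^sup>2)"])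
       (use msq[of "{1..n} - {k}" "\<theta> k"] in \<open>auto simp: score_ignores_left_out\<close>)
  have step3: "(\<integral>\<^sup>+u. (\<integral>\<^sup>+x. ennreal ((x - \<theta> k + ?l k u x)\<^sup>2) \<partial>gauss (\<theta> k)) \<partial>obs_law n \<theta>) \<le>
      ennreal ((1 + d) ^ 3) * (\<integral>\<^sup>+u. (\<integral>\<^sup>+x. ennreal ((x - \<theta> k + ?s u x)\<^sup>2) \<partial>gauss (\<theta> k)) \<partial>obs_law n \<theta>) + ennreal (4 * d * (1 + d))"
    if k: "k \<in> {1..n}" for k
  proof -
    interpret G: prob_space "gauss (\<theta> k)" by (rule prob_space_gauss)
    have m: "(\<lambda>(u, x). ennreal ((x - \<theta> k + ?s u x)\<^sup>2)) \<in> borel_measurable (obs_law n \<theta> \<Otimes>\<^sub>M gauss (\<theta> k))"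
      using msq[of "{1..n}" "\<theta> k"]
      by (subst measurable_cong_sets[OF sets_pair_measure_cong[OF sets_obs_law, of _ borel] refl]) auto
    have sx: "(\<lambda>x. ennreal ((x - \<theta> k + ?s u x)\<^sup>2)) \<in> borel_measurable (gauss (\<theta> k))" if "u \<in> space (obs_law n \<theta>)" for u
      using measurable_Pair2[OF m that] by simp
    have su: "(\<lambda>u. \<integral>\<^sup>+x. ennreal ((x - \<theta> k + ?s u x)\<^sup>2) \<partial>gauss (\<theta> k)) \<in> borel_measurable (obs_law n \<theta>)"
      using G.borel_measurable_nn_integral_fst[OF m] by simp
    have "(\<integral>\<^sup>+u. (\<integral>\<^sup>+x. ennreal ((x - \<theta> k + ?l k u x)\<^sup>2) \<partial>gauss (\<theta> k)) \<partial>obs_law n \<theta>) \<le>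
      (\<integral>\<^sup>+u. (\<integral>\<^sup>+x. ennreal ((1 + d) ^ 3) * ennreal ((x - \<theta> k + ?s u x)\<^sup>2) +
         ennreal (d * (1 + d)) * ennreal ((1 + \<bar>x - \<theta> k\<bar>)\<^sup>2) \<partial>gauss (\<theta> k)) \<partial>obs_law n \<theta>)"
      using square_perturb[OF d score_leave_one_out(2)[OF n r k finite_atLeastAtMost, folded d_def]] d
      by (intro nn_integral_mono) (simp flip: ennreal_mult ennreal_plus)
    also have "\<dots> \<le> (\<integral>\<^sup>+u. ennreal ((1 + d) ^ 3) * (\<integral>\<^sup>+x. ennreal ((x - \<theta> k + ?s u x)\<^sup>2) \<partial>gauss (\<theta> k)) +
        ennreal (d * (1 + d)) * 4 \<partial>obs_law n \<theta>)"
    proof (rule nn_integral_mono)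
      fix u assume u: "u \<in> space (obs_law n \<theta>)"
      show "(\<integral>\<^sup>+x. ennreal ((1 + d) ^ 3) * ennreal ((x - \<theta> k + ?s u x)\<^sup>2) +
         ennreal (d * (1 + d)) * ennreal ((1 + \<bar>x - \<theta> k\<bar>)\<^sup>2) \<partial>gauss (\<theta> k)) \<le>
         ennreal ((1 + d) ^ 3) * (\<integral>\<^sup>+x. ennreal ((x - \<theta> k + ?s u x)\<^sup>2) \<partial>gauss (\<theta> k)) + ennreal (d * (1 + d)) * 4"
        using sx[OF u] nn_integral_gauss_square[of "\<theta> k"]
        by (subst nn_integral_add) (auto simp: nn_integral_cmult intro!: add_left_mono mult_left_mono)
    qed
    also have "\<dots> = ennreal ((1 + d) ^ 3) * (\<integral>\<^sup>+u. (\<integral>\<^sup>+x. ennreal ((x - \<theta> k + ?s u x)\<^sup>2) \<partial>gauss (\<theta> k)) \<partial>obs_law n \<theta>) +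
        ennreal (d * (1 + d)) * 4"
      using su by (subst nn_integral_add) (auto simp: nn_integral_cmult P.emeasure_space_1)
    also have "ennreal (d * (1 + d)) * 4 = ennreal (4 * d * (1 + d))"
      by (subst ennreal_numeral[symmetric], subst ennreal_mult[symmetric]) (use d in \<open>auto simp: mult_ac\<close>)
    finally show ?thesis .
  qed
  let ?c = "4 * d * (1 + d)"
  let ?R = "\<lambda>k. \<integral>\<^sup>+u. (\<integral>\<^sup>+x. ennreal ((x - \<theta> k + ?s u x)\<^sup>2) \<partial>gauss (\<theta> k)) \<partial>obs_law n \<theta>"
  have "(\<Sum>k=1..n. \<integral>\<^sup>+u. ennreal ((u k - \<theta> k + ?s u (u k))\<^sup>2) \<partial>obs_law n \<theta>) \<le>
    (\<Sum>k=1..n. ennreal ((1 + d) ^ 6) * ?R k + ennreal (8 * d * (1 + d) ^ 4))"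
  proof (rule sum_mono)
    fix k assume k: "k \<in> {1..n}"
    have "(\<integral>\<^sup>+u. ennreal ((u k - \<theta> k + ?s u (u k))\<^sup>2) \<partial>obs_law n \<theta>) \<le>
        ennreal ((1 + d) ^ 3) * (ennreal ((1 + d) ^ 3) * ?R k + ennreal ?c) + ennreal ?c"
      using step3[OF k] unfolding step2[OF k, symmetric]
      by (intro order_trans[OF step1[OF k]] add_mono mult_left_mono) auto
    also have "\<dots> = ennreal ((1 + d) ^ 6) * ?R k + ennreal ((1 + d) ^ 3 * ?c + ?c)"
    proof -
      have "ennreal ((1 + d) ^ 3) * ennreal ((1 + d) ^ 3) = ennreal ((1 + d) ^ 6)"
        using d by (simp flip: ennreal_mult power_add)
      moreover have "ennreal ((1 + d) ^ 3) * ennreal ?c + ennreal ?c = ennreal ((1 + d) ^ 3 * ?c + ?c)"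
        using d by (simp flip: ennreal_mult ennreal_plus)
      ultimately show ?thesis by (simp add: distrib_left mult.assoc[symmetric] add.assoc)
    qed
    also have "(1 + d) ^ 3 * ?c + ?c \<le> 8 * d * (1 + d) ^ 4"
    proof -
      have "1 * ?c \<le> (1 + d) ^ 3 * ?c" using d by (intro mult_right_mono one_le_power) auto
      then have "(1 + d) ^ 3 * ?c + ?c \<le> 2 * ((1 + d) ^ 3 * ?c)" by linarith
      also have "\<dots> = 8 * d * (1 + d) ^ 4" by (simp add: eval_nat_numeral)
      finally show ?thesis .
    qed
    finally show "(\<integral>\<^sup>+u. ennreal ((u k - \<theta> k + ?s u (u k))\<^sup>2) \<partial>obs_law n \<theta>) \<le>
       ennreal ((1 + d) ^ 6) * ?R k + ennreal (8 * d * (1 + d) ^ 4)"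
      by (simp add: add_left_mono ennreal_leI)
  qed
  also have "\<dots> = ennreal ((1 + d) ^ 6) * (\<Sum>k=1..n. ?R k) + ennreal (8 * real n * d * (1 + d) ^ 4)"
    using d by (simp add: sum.distrib sum_distrib_left ennreal_of_nat_eq_real_of_nat mult_ac flip: ennreal_mult)
  also have "\<dots> \<le> ennreal ((1 + d) ^ 6) * (separable_risk n \<theta> h + score_defect r n \<theta>) + ennreal (8 * real n * d * (1 + d) ^ 4)"
    using n score_risk_integrated_le[OF _ h, of n \<theta> r] by (intro add_right_mono mult_left_mono) auto
  finally show ?thesis .
qed

subsection \<open>Error of the estimated score\<close>

text \<open>Write \<open>exp (- w\<^sup>2 / 2)\<close> as \<open>exp (- w\<^sup>2 / 4)\<close> times
  two factors \<open>exp (- w\<^sup>2 / 8)\<close>. The first absorbs \<open>w\<^sup>2\<close>, the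
  second gives \<open>K / n\<close>, and the third is a multiple of the density with standard
  deviation 2.\<close>

lemma gauss_tail_density_le:
  assumes L: "L \<ge> 1" "\<bar>w\<bar> > L" and K: "exp (- L\<^sup>2 / 8) \<le> K / n"
  shows "w\<^sup>2 * std_normal_density w \<le> 8 * K / n * normal_density 0 2 w"
proof -
  have "w\<^sup>2 / 4 * exp (- (w\<^sup>2 / 4)) \<le> 1"
    using exp_ge_add_one_self[of "w\<^sup>2 / 4"] by (simp add: exp_minus field_simps)
  then have a: "w\<^sup>2 * exp (- (w\<^sup>2 / 4)) \<le> 4" by simp
  have "L\<^sup>2 \<le> \<bar>w\<bar>\<^sup>2" using L by (intro power_mono) auto
  then have b: "exp (- w\<^sup>2 / 8) \<le> K / n" using K by (intro order_trans[OF _ K]) simp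
  have "w\<^sup>2 * exp (- w\<^sup>2 / 2) = (w\<^sup>2 * exp (- (w\<^sup>2 / 4))) * exp (- w\<^sup>2 / 8) * exp (- w\<^sup>2 / 8)"
    by (simp add: mult.assoc flip: exp_add)
  also have "\<dots> \<le> 4 * (K / n) * exp (- w\<^sup>2 / 8)"
    by (intro mult_right_mono mult_mono a b) auto
  finally have "w\<^sup>2 * exp (- w\<^sup>2 / 2) * (1 / sqrt (2 * pi)) \<le> 4 * (K / n) * exp (- w\<^sup>2 / 8) * (1 / sqrt (2 * pi))"
    by (intro mult_right_mono) auto
  moreover have "sqrt (8::real) = 2 * sqrt 2"
    using real_sqrt_mult[of 4 2] by simp
  then have "normal_density 0 2 w = exp (- w\<^sup>2 / 8) * (1 / sqrt (2 * pi)) / 2"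
    by (simp add: normal_density_def real_sqrt_mult)
  ultimately show ?thesis by (simp add: std_normal_density_def mult_ac)
qed

text \<open>Through Cauchy-Schwarz this average controls
  \<open>(mix_deriv n \<theta> x)\<^sup>2 / mix n \<theta> x\<close> without any lower bound on the
  mixture density.\<close>

definition mix_fisher :: "nat \<Rightarrow> (nat \<Rightarrow> real) \<Rightarrow> real \<Rightarrow> real" where
  "mix_fisher n \<theta> x = (\<Sum>k=1..n. (x - \<theta> k)\<^sup>2 * normal_density (\<theta> k) 1 x) / n"

text \<open>The doubled standard deviation absorbs the polynomial factors where \<open>x\<close> is far from \<open>\<theta> k\<close>.\<close>

definition mix_wide :: "nat \<Rightarrow> (nat \<Rightarrow> real) \<Rightarrow> real \<Rightarrow> real" where
  "mix_wide n \<theta> x = (\<Sum>k=1..n. normal_density (\<theta> k) 2 x) / n"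

lemma mix_wide_measurable [measurable]: "mix_wide n \<theta> \<in> borel_measurable borel"
  unfolding mix_wide_def by measurable

lemma normal_density_le_one: "s \<ge> 1 \<Longrightarrow> normal_density m s x \<le> 1"
proof -
  assume s: "s \<ge> 1"
  have "1 * 1 \<le> pi * s\<^sup>2" by (intro mult_mono) (use s pi_ge_two in \<open>auto simp: one_le_power\<close>)
  then have "1 \<le> sqrt (2 * pi * s\<^sup>2)" by (intro real_le_rsqrt) simp
  then have "normal_density m s x \<le> 1 / 1 * 1"
    unfolding normal_density_def by (intro mult_mono frac_le) auto
  then show ?thesis by simp
qed

lemma mix_wide_bounds: "n \<ge> 1 \<Longrightarrow> 0 \<le> mix_wide n \<theta> x" "n \<ge> 1 \<Longrightarrow> mix_wide n \<theta> x \<le> 1"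
proof -
  assume n: "n \<ge> 1"
  show "0 \<le> mix_wide n \<theta> x" by (auto simp: mix_wide_def intro!: divide_nonneg_nonneg sum_nonneg)
  have "(\<Sum>k=1..n. normal_density (\<theta> k) 2 x) \<le> (\<Sum>k=1..n. 1)"
    by (intro sum_mono normal_density_le_one) auto
  with n show "mix_wide n \<theta> x \<le> 1" by (simp add: mix_wide_def)
qed

lemma normal_density_centered: "normal_density m s x = normal_density 0 s (x - m)"
  by (simp add: normal_density_def)

lemma mix_fisher_le:
  assumes n: "n \<ge> 1" and L: "L \<ge> 1" and K: "exp (- L\<^sup>2 / 8) \<le> K / n"
  shows "mix_fisher n \<theta> x \<le> L\<^sup>2 * mix n \<theta> x + 8 * K / n * mix_wide n \<theta> x"
proof -
  have Kn: "K / n \<ge> 0" using K by (rule order_trans[rotated]) simp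
  have "(x - \<theta> k)\<^sup>2 * normal_density (\<theta> k) 1 x \<le>
      L\<^sup>2 * normal_density (\<theta> k) 1 x + 8 * K / n * normal_density (\<theta> k) 2 x" for k
  proof (cases "\<bar>x - \<theta> k\<bar> \<le> L")
    case True
    then have "(x - \<theta> k)\<^sup>2 \<le> L\<^sup>2" by (metis abs_ge_zero power2_abs power_mono)
    then have "(x - \<theta> k)\<^sup>2 * normal_density (\<theta> k) 1 x \<le> L\<^sup>2 * normal_density (\<theta> k) 1 x"
      by (intro mult_right_mono) auto
    moreover have "0 \<le> 8 * K / n * normal_density (\<theta> k) 2 x"
      using mult_nonneg_nonneg[OF Kn normal_density_nonneg[of "\<theta> k" 2 x]] by simp
    ultimately show ?thesis by simp
  next
    case False
    then have "(x - \<theta> k)\<^sup>2 * normal_density (\<theta> k) 1 x \<le> 8 * K / n * normal_density (\<theta> k) 2 x"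
      using gauss_tail_density_le[OF L _ K, of "x - \<theta> k"] normal_density_centered[of "\<theta> k"] by simp
    moreover have "0 \<le> L\<^sup>2 * normal_density (\<theta> k) 1 x" by simp
    ultimately show ?thesis by linarith
  qed
  then have "(\<Sum>k=1..n. (x - \<theta> k)\<^sup>2 * normal_density (\<theta> k) 1 x) \<le>
      (\<Sum>k=1..n. L\<^sup>2 * normal_density (\<theta> k) 1 x + 8 * K / n * normal_density (\<theta> k) 2 x)"
    by (intro sum_mono) auto
  also have "\<dots> = n * (L\<^sup>2 * mix n \<theta> x + 8 * K / n * mix_wide n \<theta> x)"
    using n by (simp add: sum.distrib mix_def mix_wide_def sum_distrib_left[symmetric] sum_divide_distrib[symmetric] distrib_left)
  finally show ?thesis using n by (simp add: mix_fisher_def divide_le_eq mult.commute)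
qed

lemma abs_mix_deriv_le:
  assumes n: "n \<ge> 1" and L: "L \<ge> 1" and K: "exp (- L\<^sup>2 / 8) \<le> K / n"
  shows "\<bar>mix_deriv n \<theta> x\<bar> \<le> L * mix n \<theta> x + 8 * K / n"
proof -
  have Kn: "K / n \<ge> 0" using K by (rule order_trans[rotated]) simp
  have "\<bar>(\<theta> k - x) * normal_density (\<theta> k) 1 x\<bar> \<le> L * normal_density (\<theta> k) 1 x + 8 * K / n" for k
  proof (cases "\<bar>x - \<theta> k\<bar> \<le> L")
    case True
    then have "\<bar>(\<theta> k - x) * normal_density (\<theta> k) 1 x\<bar> \<le> L * normal_density (\<theta> k) 1 x"
      by (simp add: abs_mult abs_minus_commute mult_right_mono)
    then show ?thesis using Kn by simp
  next
    case False
    then have "\<bar>x - \<theta> k\<bar> * 1 \<le> \<bar>x - \<theta> k\<bar> * \<bar>x - \<theta> k\<bar>" using L by (intro mult_left_mono) auto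
    then have "\<bar>x - \<theta> k\<bar> \<le> (x - \<theta> k)\<^sup>2" by (simp add: power2_eq_square)
    then have "\<bar>(\<theta> k - x) * normal_density (\<theta> k) 1 x\<bar> \<le> (x - \<theta> k)\<^sup>2 * normal_density (\<theta> k) 1 x"
      by (simp add: abs_mult abs_minus_commute mult_right_mono)
    also have "\<dots> \<le> 8 * K / n * normal_density (\<theta> k) 2 x"
      using False gauss_tail_density_le[OF L _ K, of "x - \<theta> k"] normal_density_centered[of "\<theta> k"] by simp
    also have "\<dots> \<le> 8 * (K / n) * 1"
      using Kn mult_left_mono[OF normal_density_le_one[of 2 "\<theta> k" x], of "8 * (K / n)"] by simp
    finally show ?thesis using L by (simp add: add_increasing)
  qed
  then have "\<bar>\<Sum>k=1..n. (\<theta> k - x) * normal_density (\<theta> k) 1 x\<bar> \<le> (\<Sum>k=1..n. L * normal_density (\<theta> k) 1 x + 8 * K / n)"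
    by (intro order_trans[OF sum_abs] sum_mono) auto
  also have "\<dots> = n * (L * mix n \<theta> x + 8 * K / n)"
    using n by (simp add: sum.distrib mix_def sum_distrib_left[symmetric] distrib_left)
  finally show ?thesis using n by (simp add: mix_deriv_def abs_divide divide_le_eq mult.commute)
qed

text \<open>Cauchy-Schwarz, with each density written as a product of two square roots.\<close>

lemma mix_deriv_square_le: "n \<ge> 1 \<Longrightarrow> (mix_deriv n \<theta> x)\<^sup>2 \<le> mix_fisher n \<theta> x * mix n \<theta> x"
proof -
  assume n: "n \<ge> 1"
  let ?w = "\<lambda>k. sqrt (normal_density (\<theta> k) 1 x)"
  have "(\<Sum>k=1..n. ((\<theta> k - x) * ?w k) * ?w k)\<^sup>2 \<le> (\<Sum>k=1..n. ((\<theta> k - x) * ?w k)\<^sup>2) * (\<Sum>k=1..n. (?w k)\<^sup>2)"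
    by (rule Cauchy_Schwarz_ineq_sum)
  then have "(\<Sum>k=1..n. (\<theta> k - x) * normal_density (\<theta> k) 1 x)\<^sup>2 \<le>
      (\<Sum>k=1..n. (x - \<theta> k)\<^sup>2 * normal_density (\<theta> k) 1 x) * (\<Sum>k=1..n. normal_density (\<theta> k) 1 x)"
    by (simp add: power_mult_distrib mult.assoc power2_commute)
  then show ?thesis using n
    by (simp add: mix_deriv_def mix_fisher_def mix_def power_divide power2_eq_square divide_right_mono)
qed

text \<open>\<open>Bad\<close> may depend on the fixed point \<open>x\<close>: the defect takes the
  expectation over \<open>u\<close> before integrating over \<open>x\<close>, so no control uniform
  in \<open>x\<close> is needed. Half of \<open>A\<close> covers the bias, the other half the
  fluctuation.\<close>

lemma score_concentration:
  assumes n: "n \<ge> 2" and L: "L \<ge> 1"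
    and K: "exp (- L\<^sup>2 / (2 * (1 + 2 * ln n)\<^sup>2)) \<le> K / (real n)\<^sup>2"
  defines "A \<equiv> 2 * L / sqrt n"
  obtains Bad where "Bad \<in> sets (obs_law n \<theta>)" "measure (obs_law n \<theta>) Bad \<le> 4 * K / (real n)\<^sup>2"
    "\<And>u. u \<in> space (obs_law n \<theta>) \<Longrightarrow> u \<notin> Bad \<Longrightarrow> \<bar>kde n {1..n} u x - mix n \<theta> x\<bar> \<le> A"
    "\<And>u. u \<in> space (obs_law n \<theta>) \<Longrightarrow> u \<notin> Bad \<Longrightarrow> \<bar>kde_deriv n {1..n} u x - mix_deriv n \<theta> x\<bar> \<le> A"
proof -
  interpret P: prob_space "obs_law n \<theta>" by (rule prob_space_obs_law)
  have uk: "(\<lambda>u. u k) \<in> borel_measurable (obs_law n \<theta>)" if "k \<in> {1..n}" for k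
    using that by (rule obs_law_component)
  define a B where "a = sqrt (2 * ln n)" and "B = 1 + 2 * ln n"
  have "ln 2 \<le> ln (real n)" using n by simp
  then have ln: "ln (real n) \<ge> 1 / 2" using ln2_ge_two_thirds by linarith
  have a: "a \<ge> 1" "a\<^sup>2 = 2 * ln n" using ln by (simp_all add: a_def)
  have "0 \<le> (a - 1)\<^sup>2" by simp
  then have "2 * a \<le> a\<^sup>2 + 1" by (simp add: power2_eq_square algebra_simps)
  with a have aB: "a \<le> B" "a\<^sup>2 \<le> B" "B > 0" by (simp_all add: B_def)
  \<comment> \<open>This is the reason for the bandwidth: the bias bound becomes exactly
    \<open>1 / n\<close>.\<close>
  have ea: "exp (- a\<^sup>2 / 2) = 1 / n" using n a by (simp add: exp_minus inverse_eq_divide)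
  define d where "d = L / sqrt n"
  have d: "d \<ge> 0" "1 / n \<le> d" "A = 2 * d"
  proof -
    have "sqrt n * 1 \<le> sqrt n * sqrt n" using n by (intro mult_left_mono) auto
    then have "sqrt n \<le> n" by simp
    then have "1 / n \<le> 1 / sqrt n" using n by (intro divide_left_mono) auto
    also have "\<dots> \<le> d" using L by (simp add: d_def divide_right_mono)
    finally show "1 / n \<le> d" .
  qed (use L in \<open>auto simp: d_def A_def\<close>)
  let ?f = "\<lambda>y. a * sinc_kernel (a * (x - y))"
  let ?g = "\<lambda>y. a\<^sup>2 * sinc_kernel_deriv (a * (x - y))"
  define dev where "dev f u = \<bar>(\<Sum>k=1..n. f (u k)) / n - (\<Sum>k=1..n. \<integral>x. f x \<partial>gauss (\<theta> k)) / n\<bar>"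
    for f :: "real \<Rightarrow> real" and u :: "nat \<Rightarrow> real"
  have exp: "2 * exp (- (n * d\<^sup>2 / (2 * B\<^sup>2))) \<le> 2 * (K / (real n)\<^sup>2)"
    using K n L by (simp add: d_def B_def power_divide)
  define Bad where "Bad = {u \<in> space (obs_law n \<theta>). d \<le> dev ?f u} \<union> {u \<in> space (obs_law n \<theta>). d \<le> dev ?g u}"
  have [measurable]: "dev f \<in> borel_measurable (obs_law n \<theta>)" if [measurable]: "f \<in> borel_measurable borel" for f
    unfolding dev_def using uk by measurable
  have s: "{u \<in> space (obs_law n \<theta>). d \<le> dev ?f u} \<in> sets (obs_law n \<theta>)"
      "{u \<in> space (obs_law n \<theta>). d \<le> dev ?g u} \<in> sets (obs_law n \<theta>)" by measurable
  have Bf: "measure (obs_law n \<theta>) {u \<in> space (obs_law n \<theta>). d \<le> dev ?f u} \<le> 2 * (K / (real n)\<^sup>2)"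
    unfolding dev_def
    by (intro order_trans[OF _ exp] obs_law_Hoeffding)
       (use n aB d a order_trans[OF abs_sinc_kernel_le aB(1)] in auto)
  have Bg: "measure (obs_law n \<theta>) {u \<in> space (obs_law n \<theta>). d \<le> dev ?g u} \<le> 2 * (K / (real n)\<^sup>2)"
    unfolding dev_def
    by (intro order_trans[OF _ exp] obs_law_Hoeffding)
       (use n aB d a order_trans[OF abs_sinc_kernel_deriv_le aB(2)] in auto)
  have avg: "\<bar>(\<Sum>k=1..n. p k) / n - (\<Sum>k=1..n. q k) / n\<bar> \<le> d" if "\<And>k. \<bar>p k - q k\<bar> \<le> 1 / n" for p q :: "nat \<Rightarrow> real"
  proof -
    have "\<bar>\<Sum>k=1..n. p k - q k\<bar> \<le> (\<Sum>k=1..n. 1 / n)"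
      using that by (intro order_trans[OF sum_abs] sum_mono) auto
    then have "\<bar>(\<Sum>k=1..n. p k - q k) / n\<bar> \<le> 1 / n" using n by (simp add: divide_right_mono)
    then show ?thesis using d by (simp add: sum_subtractf diff_divide_distrib)
  qed
  have mean_f: "\<bar>(\<Sum>k=1..n. \<integral>x. ?f x \<partial>gauss (\<theta> k)) / n - mix n \<theta> x\<bar> \<le> d"
    unfolding mix_def using sinc_kernel_bias[OF a(1), unfolded ea] by (intro avg) auto
  have mean_g: "\<bar>(\<Sum>k=1..n. \<integral>x. ?g x \<partial>gauss (\<theta> k)) / n - mix_deriv n \<theta> x\<bar> \<le> d"
    unfolding mix_deriv_def using sinc_kernel_deriv_bias[OF a(1), unfolded ea] by (intro avg) auto
  show thesis
  proof (rule that[of Bad])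
    show "Bad \<in> sets (obs_law n \<theta>)" using s by (simp add: Bad_def)
    have "measure (obs_law n \<theta>) Bad \<le> 2 * (K / (real n)\<^sup>2) + 2 * (K / (real n)\<^sup>2)"
      unfolding Bad_def using Bf Bg s by (intro order_trans[OF measure_Un_le]) auto
    then show "measure (obs_law n \<theta>) Bad \<le> 4 * K / (real n)\<^sup>2" by simp
  next
    fix u assume u: "u \<in> space (obs_law n \<theta>)" "u \<notin> Bad"
    then have "dev ?f u < d" "dev ?g u < d" by (auto simp: Bad_def not_le)
    then show "\<bar>kde n {1..n} u x - mix n \<theta> x\<bar> \<le> A" "\<bar>kde_deriv n {1..n} u x - mix_deriv n \<theta> x\<bar> \<le> A"
      using mean_f mean_g d(3) unfolding dev_def kde_def kde_deriv_def a_def by linarith+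
  qed
qed

lemma square_diff_le: "(a - c)\<^sup>2 \<le> 2 * (a - b)\<^sup>2 + 2 * (b - c)\<^sup>2" for a b c :: real
proof -
  have "0 \<le> ((a - b) - (b - c))\<^sup>2" by simp
  then show ?thesis by (simp add: power2_eq_square algebra_simps)
qed

lemma nn_integral_le_good_bad:
  assumes "prob_space M" and Bad: "Bad \<in> sets M"
    and good: "\<And>u. u \<in> space M \<Longrightarrow> u \<notin> Bad \<Longrightarrow> f u \<le> g"
    and bad: "\<And>u. u \<in> space M \<Longrightarrow> f u \<le> b" and p: "measure M Bad \<le> p"
    and nn: "0 \<le> g" "0 \<le> b" "0 \<le> p"
  shows "(\<integral>\<^sup>+u. ennreal (f u) \<partial>M) \<le> ennreal (g + b * p)"
proof -
  interpret prob_space M by fact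
  have "(\<integral>\<^sup>+u. ennreal (f u) \<partial>M) \<le> (\<integral>\<^sup>+u. ennreal g + ennreal b * indicator Bad u \<partial>M)"
    using good bad nn by (intro nn_integral_mono) (auto split: split_indicator simp flip: ennreal_plus intro!: ennreal_leI add_increasing)
  also have "\<dots> = ennreal g + ennreal b * ennreal (measure M Bad)"
    using Bad by (subst nn_integral_add) (auto simp: nn_integral_cmult emeasure_eq_measure prob_space)
  also have "\<dots> = ennreal (g + b * measure M Bad)" using nn by (simp flip: ennreal_mult ennreal_plus)
  also have "\<dots> \<le> ennreal (g + b * p)" using p nn by (intro ennreal_leI add_left_mono mult_left_mono)
  finally show ?thesis .
qed

text \<open>A deterministic bound, meant for events of small probability.\<close>

lemma abs_score_le:
  assumes n: "n \<ge> 2" and K: "K \<ge> 1" and L: "L \<ge> 1" and logn: "1 + 2 * ln n \<le> K * L"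
    and r: "1 / (K * sqrt n) \<le> r" and I: "I \<subseteq> {1..n}"
  shows "\<bar>score r n I u x\<bar> \<le> K\<^sup>2 * L * sqrt n"
proof -
  have r0: "r > 0" using r K n by (intro less_le_trans[OF _ r]) simp
  have KN: "1 / r \<le> K * sqrt n" using r r0 K n by (simp add: field_simps)
  have ln: "ln (real n) \<ge> 0" using n by simp
  have "\<bar>kde_deriv n I u x\<bar> \<le> (\<Sum>k\<in>I. (sqrt (2 * ln n))\<^sup>2) / n"
    unfolding kde_deriv_def abs_divide
    by (intro frac_le order_trans[OF sum_abs] sum_mono abs_sinc_kernel_deriv_le) (use n ln in \<open>auto intro!: sum_nonneg\<close>)
  also have "\<dots> \<le> (\<Sum>k=1..n. (sqrt (2 * ln n))\<^sup>2) / n"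
    using I by (intro divide_right_mono sum_mono2) auto
  also have "\<dots> \<le> K * L" using n ln logn by simp
  finally have "\<bar>score r n I u x\<bar> \<le> K * L * (1 / r)"
    unfolding score_def abs_divide using r0 K L by (simp, intro frac_le) auto
  also have "\<dots> \<le> K * L * (K * sqrt n)" using K L by (intro mult_left_mono[OF KN]) auto
  finally show ?thesis by (simp add: power2_eq_square mult_ac)
qed

text \<open>The intermediate quantity is the truncated score \<open>g = D / max r f\<close>. Passing
  from the estimate to \<open>g\<close> is concentration; passing from \<open>g\<close> to
  \<open>D / f\<close> costs something only where \<open>f < r\<close>. The resulting bound has two
  forms: \<open>sqrt n\<close>, useful on a bounded window, and \<open>n * mix n \<theta> x\<close>,
  which is integrable outside it.\<close>

lemma score_defect_pointwise:
  assumes n: "n \<ge> 2" and L: "L \<ge> 1" and K: "K \<ge> 1"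
    and logn: "1 + 2 * ln n \<le> K * L"
    and r: "1 / (K * sqrt n) \<le> r" "r \<le> K * L / sqrt n"
    and c1: "exp (- L\<^sup>2 / (2 * (1 + 2 * ln n)\<^sup>2)) \<le> K / (real n)\<^sup>2"
    and c2: "exp (- L\<^sup>2 / 8) \<le> K / n"
  shows "(\<integral>\<^sup>+u. ennreal (n * mix n \<theta> x * (score r n {1..n} u x - mix_deriv n \<theta> x / mix n \<theta> x)\<^sup>2) \<partial>obs_law n \<theta>)
    \<le> ennreal (8000 * K ^ 8 * L ^ 6 *
       (sqrt n * indicator {-R..R} x + n * mix n \<theta> x * indicator (- {-R..R}) x + mix n \<theta> x + mix_wide n \<theta> x))"
proof -
  define N where "N = sqrt (real n)"
  have N: "N \<ge> 1" "N * N = n" "N\<^sup>2 = n" using n by (simp_all add: N_def)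
  have r0: "r > 0" using r(1) K N by (intro less_le_trans[OF _ r(1)]) (simp add: N_def)
  define f D J W where "f = mix n \<theta> x" and "D = mix_deriv n \<theta> x" and "J = mix_fisher n \<theta> x"
    and "W = mix_wide n \<theta> x"
  have f0: "f > 0" using n mix_pos[of n \<theta> x] by (simp add: f_def)
  have W: "0 \<le> W" "W \<le> 1" using n mix_wide_bounds[of n \<theta> x] by (simp_all add: W_def)
  define Q where "Q = max r f"
  have Q: "Q > 0" "r \<le> Q" "f \<le> Q" using r0 by (auto simp: Q_def)
  define g where "g = D / Q"
  have KN: "1 / r \<le> K * N"
    using r(1) r0 K N by (simp add: N_def[symmetric] field_simps)
  have gL: "\<bar>g\<bar> \<le> 9 * K\<^sup>2 * L"
  proof -
    have "\<bar>D\<bar> \<le> L * f + 8 * K / n"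
      using n abs_mix_deriv_le[OF _ L c2] by (simp add: D_def f_def)
    then have "\<bar>g\<bar> \<le> (L * f + 8 * K / n) / Q" using Q by (simp add: g_def divide_right_mono)
    also have "\<dots> = L * (f / Q) + 8 * K / n * (1 / Q)" by (simp add: add_divide_distrib)
    also have "\<dots> \<le> L * 1 + 8 * K / n * (K * N)"
    proof (intro add_mono mult_left_mono)
      have "1 / Q \<le> 1 / r" using Q r0 by (intro divide_left_mono) auto
      then show "1 / Q \<le> K * N" using KN by linarith
    qed (use Q L K in auto)
    also have "8 * K / n * (K * N) = 8 * K\<^sup>2 / N"
      using N by (simp add: N(2)[symmetric] power2_eq_square)
    also have "8 * K\<^sup>2 / N \<le> 8 * K\<^sup>2 / 1" using N by (intro divide_left_mono) auto
    also have "L * 1 + 8 * K\<^sup>2 / 1 \<le> K\<^sup>2 * L + 8 * (K\<^sup>2 * L)"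
    proof -
      have "1 * L \<le> K\<^sup>2 * L" "K\<^sup>2 * 1 \<le> K\<^sup>2 * L" using K L by (auto intro!: mult_mono simp: one_le_power)
      then show ?thesis by linarith
    qed
    finally show ?thesis by (simp add: mult_ac)
  qed
  define A where "A = 2 * L / N"
  have A0: "A \<ge> 0" using L N by (simp add: A_def)
  have Ar: "1 + A / r \<le> 3 * K * L"
  proof -
    have "A * (1 / r) \<le> A * (K * N)" by (rule mult_left_mono[OF KN A0])
    also have "\<dots> = 2 * (K * L)" using N by (simp add: A_def)
    finally show ?thesis using mult_mono[OF K L] K L by simp
  qed
  obtain Bad where Bad: "Bad \<in> sets (obs_law n \<theta>)" "measure (obs_law n \<theta>) Bad \<le> 4 * K / (real n)\<^sup>2"
    and good: "\<And>u. u \<in> space (obs_law n \<theta>) \<Longrightarrow> u \<notin> Bad \<Longrightarrow> \<bar>kde n {1..n} u x - f\<bar> \<le> A"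
    "\<And>u. u \<in> space (obs_law n \<theta>) \<Longrightarrow> u \<notin> Bad \<Longrightarrow> \<bar>kde_deriv n {1..n} u x - D\<bar> \<le> A"
    using score_concentration[OF n L c1, of \<theta> x] unfolding A_def N_def f_def D_def by blast
  let ?s = "\<lambda>u. score r n {1..n} u x"
  have good': "(?s u - g)\<^sup>2 \<le> 3600 * K ^ 6 * L ^ 6 / (n * Q\<^sup>2)" if u: "u \<in> space (obs_law n \<theta>)" "u \<notin> Bad" for u
  proof -
    let ?p = "max r (kde n {1..n} u x)"
    have p0: "?p > 0" using r0 by auto
    have "\<bar>?s u - g\<bar> \<le> A / ?p * (1 + \<bar>g\<bar>)"
      unfolding score_def g_def Q_def by (rule abs_ratio_max_diff_le(1)[OF r0 good[OF u]])
    also have "\<dots> = A * (1 / ?p) * (1 + \<bar>g\<bar>)" by simp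
    also have "\<dots> \<le> A * ((3 * K * L) / Q) * (10 * K\<^sup>2 * L)"
    proof (intro mult_mono)
      show "1 / ?p \<le> 3 * K * L / Q"
        using abs_ratio_max_diff_le(2)[OF r0 good[OF u]] Ar Q
        by (fold Q_def) (rule order_trans, assumption, rule divide_right_mono, auto)
      have "1 * 1 \<le> K\<^sup>2 * L" using K L by (intro mult_mono) (auto simp: one_le_power)
      then show "1 + \<bar>g\<bar> \<le> 10 * K\<^sup>2 * L" using gL by linarith
    qed (use A0 p0 K L Q in auto)
    also have "\<dots> = 60 * K ^ 3 * L ^ 3 / (N * Q)" by (simp add: A_def eval_nat_numeral)
    finally have "\<bar>?s u - g\<bar>\<^sup>2 \<le> (60 * K ^ 3 * L ^ 3 / (N * Q))\<^sup>2" by (rule power_mono) simp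
    also have "\<dots> = 3600 * K ^ 6 * L ^ 6 / (n * Q\<^sup>2)"
      using N by (simp add: power_divide power_mult_distrib flip: power_mult)
    finally show ?thesis by simp
  qed
  have bad: "(?s u - g)\<^sup>2 \<le> 100 * K ^ 4 * L\<^sup>2 * n" for u
  proof -
    have "\<bar>?s u\<bar> \<le> K\<^sup>2 * L * N"
      unfolding N_def by (rule abs_score_le[OF n K L logn r(1) order_refl])
    with gL have "\<bar>?s u - g\<bar> \<le> K\<^sup>2 * L * N + 9 * K\<^sup>2 * L" by linarith
    also have "\<dots> \<le> 10 * K\<^sup>2 * L * N" using mult_left_mono[OF N(1), of "9 * K\<^sup>2 * L"] K L by simp
    finally have "\<bar>?s u - g\<bar>\<^sup>2 \<le> (10 * K\<^sup>2 * L * N)\<^sup>2" by (rule power_mono) simp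
    also have "\<dots> = 100 * K ^ 4 * L\<^sup>2 * n"
      using N by (simp add: power_mult_distrib flip: power_mult)
    finally show ?thesis by simp
  qed
  \<comment> \<open>The price of the truncation.\<close>
  define G where "G = n * f * (g - D / f)\<^sup>2"
  define ind where "ind = (indicator {-R..R} x :: real)"
  have ind: "ind = 0 \<or> ind = 1" "indicator (- {-R..R}) x = 1 - ind"
    by (auto simp: ind_def indicator_def)
  have G: "G \<le> ind * (9 * K * L ^ 3 * N) + (1 - ind) * (L\<^sup>2 * (n * f)) + 8 * K * W"
  proof (cases "f < r")
    case False
    then have "G = 0" by (simp add: G_def g_def Q_def)
    then show ?thesis using ind(1) K L N W f0 by auto
  next
    case True
    then have Qr: "Q = r" by (simp add: Q_def)
    \<comment> \<open>Truncation multiplies the true score by \<open>f / r\<close>, so the relative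
      error \<open>1 - f / r\<close> lies between 0 and 1.\<close>
    have "(g - D / f)\<^sup>2 = D\<^sup>2 / f\<^sup>2 * (1 - f / r)\<^sup>2"
      using f0 r0 by (simp add: g_def Qr power_divide[symmetric] power_mult_distrib[symmetric])
         (simp add: field_simps power2_commute)
    also have "\<dots> \<le> D\<^sup>2 / f\<^sup>2 * 1"
      using True f0 r0 by (intro mult_left_mono power_le_one) auto
    also have "\<dots> \<le> J * f / f\<^sup>2"
      using mix_deriv_square_le[of n \<theta> x] n by (simp add: D_def J_def f_def divide_right_mono)
    finally have "n * f * (g - D / f)\<^sup>2 \<le> n * f * (J * f / f\<^sup>2)"
      using f0 by (intro mult_left_mono) auto
    then have GJ: "G \<le> n * J" using f0 by (simp add: G_def power2_eq_square)
    have "J \<le> L\<^sup>2 * f + 8 * K / n * W"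
      using n mix_fisher_le[OF _ L c2] by (simp add: J_def f_def W_def)
    then have "n * J \<le> n * (L\<^sup>2 * f + 8 * K / n * W)" by (intro mult_left_mono) auto
    also have "\<dots> = L\<^sup>2 * (n * f) + 8 * K * W" using n by (simp add: distrib_left)
    finally have G1: "G \<le> L\<^sup>2 * (n * f) + 8 * K * W" using GJ by linarith
    have "n * f \<le> n * (K * L / N)" using True r(2) N_def by (intro mult_left_mono) auto
    also have "\<dots> = K * L * N" using N by (simp add: N(2)[symmetric])
    finally have "L\<^sup>2 * (n * f) \<le> L\<^sup>2 * (K * L * N)" by (intro mult_left_mono) auto
    also have "\<dots> \<le> 9 * K * L ^ 3 * N" using K L N by (simp add: eval_nat_numeral mult_ac)
    finally show ?thesis using G1 ind(1) by auto
  qed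
  have "n * f * (3600 * K ^ 6 * L ^ 6 / (n * Q\<^sup>2)) = 3600 * K ^ 6 * L ^ 6 * (f / Q\<^sup>2)"
    using n by simp
  \<comment> \<open>Using \<open>f \<le> Q\<close> for one factor and
    \<open>1 / Q \<le> K * N\<close> for the other gives order \<open>sqrt n\<close>. Using the
    latter twice keeps the factor \<open>f\<close> and gives order \<open>n * f\<close>.\<close>
  also have "f / Q\<^sup>2 \<le> ind * (K * N) + (1 - ind) * (K\<^sup>2 * (n * f))"
  proof -
    have Q': "1 / Q \<le> K * N" using Q r0 KN by (intro order_trans[OF _ KN] divide_left_mono) auto
    have "f / Q\<^sup>2 = (f / Q) * (1 / Q)" by (simp add: power2_eq_square)
    also have "\<dots> \<le> 1 * (K * N)" using Q f0 Q' by (intro mult_mono) auto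
    finally have a: "f / Q\<^sup>2 \<le> K * N" by simp
    have "(1 / Q) * (1 / Q) \<le> (K * N) * (K * N)" using Q' Q K N by (intro mult_mono) auto
    then have "f * ((1 / Q) * (1 / Q)) \<le> f * (K\<^sup>2 * n)"
      using f0 N by (intro mult_left_mono) (auto simp: power2_eq_square mult_ac)
    then have b: "f / Q\<^sup>2 \<le> K\<^sup>2 * (n * f)" by (simp add: power2_eq_square mult_ac)
    show ?thesis using a b ind(1) by auto
  qed
  finally have F: "n * f * (3600 * K ^ 6 * L ^ 6 / (n * Q\<^sup>2)) \<le>
      3600 * K ^ 6 * L ^ 6 * (ind * (K * N) + (1 - ind) * (K\<^sup>2 * (n * f)))"
    using K L by (simp add: mult_left_mono)
  have sq: "n * f * (s - D / f)\<^sup>2 \<le> 2 * (n * f) * (s - g)\<^sup>2 + 2 * G" for s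
  proof -
    have "(s - D / f)\<^sup>2 \<le> 2 * (s - g)\<^sup>2 + 2 * (g - D / f)\<^sup>2"
      by (rule square_diff_le)
    then have "n * f * (s - D / f)\<^sup>2 \<le> n * f * (2 * (s - g)\<^sup>2 + 2 * (g - D / f)\<^sup>2)"
      using f0 by (intro mult_left_mono) auto
    then show ?thesis by (simp add: G_def algebra_simps)
  qed
  have G0: "G \<ge> 0" using f0 by (simp add: G_def)
  \<comment> \<open>On \<open>Bad\<close> the squared error is at most of order \<open>n\<close>, so
    the integrand is of order \<open>n\<^sup>2 * f\<close>, apart from \<open>G\<close>; the
    probability of order \<open>1 / n\<^sup>2\<close> reduces this to a multiple of
    \<open>f\<close>.\<close>
  have "(\<integral>\<^sup>+u. ennreal (n * f * (?s u - D / f)\<^sup>2) \<partial>obs_law n \<theta>) \<le>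
     ennreal ((2 * (n * f) * (3600 * K ^ 6 * L ^ 6 / (n * Q\<^sup>2)) + 2 * G) +
       (2 * (n * f) * (100 * K ^ 4 * L\<^sup>2 * n) + 2 * G) * (4 * K / (real n)\<^sup>2))"
  proof (rule nn_integral_le_good_bad[OF prob_space_obs_law Bad(1) _ _ Bad(2)])
    show "n * f * (?s u - D / f)\<^sup>2 \<le> 2 * (n * f) * (3600 * K ^ 6 * L ^ 6 / (n * Q\<^sup>2)) + 2 * G"
      if "u \<in> space (obs_law n \<theta>)" "u \<notin> Bad" for u
      using f0 good'[OF that] by (intro order_trans[OF sq] add_right_mono mult_left_mono) auto
    show "n * f * (?s u - D / f)\<^sup>2 \<le> 2 * (n * f) * (100 * K ^ 4 * L\<^sup>2 * n) + 2 * G" for u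
      using f0 bad by (intro order_trans[OF sq] add_right_mono mult_left_mono) auto
  qed (use f0 G0 K L in auto)
  also have "\<dots> \<le> ennreal (8000 * K ^ 8 * L ^ 6 * (N * ind + n * f * (1 - ind) + f + W))"
  proof (rule ennreal_leI)
    have K8: "K ^ i \<le> K ^ 8" if "i \<le> 8" for i using K that by (intro power_increasing) auto
    have L6: "L ^ i \<le> L ^ 6" if "i \<le> 6" for i using L that by (intro power_increasing) auto
    define Z where "Z = K ^ 8 * L ^ 6"
    have KL: "K ^ i * L ^ j \<le> Z" if "i \<le> 8" "j \<le> 6" for i j
      unfolding Z_def using K8[OF that(1)] L6[OF that(2)] K L by (intro mult_mono) auto
    have Z: "Z \<ge> 0" using K L by (simp add: Z_def)
    have n4: "4 * K / (real n)\<^sup>2 \<le> K"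
      using n K mult_mono[of 2 "real n" 2 "real n"] mult_right_mono[of 4 "(real n)\<^sup>2" K]
      by (simp add: divide_le_eq power2_eq_square mult_ac)
    have "(2 * (n * f) * (100 * K ^ 4 * L\<^sup>2 * n) + 2 * G) * (4 * K / (real n)\<^sup>2) =
       800 * (K ^ 5 * L\<^sup>2) * f + 2 * G * (4 * K / (real n)\<^sup>2)"
    proof -
      have "2 * (n * f) * (100 * K ^ 4 * L\<^sup>2 * n) * (4 * K / (real n)\<^sup>2) = 800 * (K ^ 5 * L\<^sup>2) * f"
        using n by (simp add: field_simps power2_eq_square eval_nat_numeral)
      then show ?thesis by (simp only: distrib_right)
    qed
    also have "\<dots> \<le> 800 * Z * f + 2 * G * K"
      using f0 G0 KL[of 5 2] n4 by (intro add_mono mult_right_mono mult_left_mono) auto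
    finally have t2: "(2 * (n * f) * (100 * K ^ 4 * L\<^sup>2 * n) + 2 * G) * (4 * K / (real n)\<^sup>2) \<le> 800 * Z * f + 2 * (G * K)"
      by simp
    have t1: "2 * (n * f) * (3600 * K ^ 6 * L ^ 6 / (n * Q\<^sup>2)) \<le> 7200 * Z * (ind * N + (1 - ind) * (n * f))"
    proof -
      have "2 * (n * f) * (3600 * K ^ 6 * L ^ 6 / (n * Q\<^sup>2)) \<le> 7200 * (K ^ 6 * L ^ 6) * (ind * (K * N) + (1 - ind) * (K\<^sup>2 * (n * f)))"
      proof -
        have "2 * (n * f) * X = 2 * (n * f * X)" for X :: real by simp
        moreover have "7200 * (K ^ 6 * L ^ 6) * Y = 2 * (3600 * K ^ 6 * L ^ 6 * Y)" for Y :: real by simp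
        ultimately show ?thesis using F by (simp only:)
      qed
      also have "\<dots> = 7200 * ((K ^ 7 * L ^ 6) * (ind * N) + (K ^ 8 * L ^ 6) * ((1 - ind) * (n * f)))"
      proof -
        have "K ^ 7 = K ^ 6 * K" "K ^ 8 = K ^ 6 * K\<^sup>2" by (simp_all add: eval_nat_numeral)
        then show ?thesis by (simp add: algebra_simps)
      qed
      also have "\<dots> \<le> 7200 * (Z * (ind * N) + Z * ((1 - ind) * (n * f)))"
        using KL[of 7 6] KL[of 8 6] ind(1) N f0 by (intro mult_left_mono add_mono mult_right_mono) auto
      finally show ?thesis by (simp add: distrib_left)
    qed
    have "G * (1 + K) \<le> G * (2 * K)" using G0 K by (intro mult_left_mono) auto
    also have "\<dots> \<le> (ind * (9 * K * L ^ 3 * N) + (1 - ind) * (L\<^sup>2 * (n * f)) + 8 * K * W) * (2 * K)"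
      using G K by (intro mult_right_mono) auto
    also have "\<dots> = 18 * (K ^ 2 * L ^ 3) * (ind * N) + 2 * (K ^ 1 * L ^ 2) * ((1 - ind) * (n * f)) + 16 * (K ^ 2 * L ^ 0) * W"
      by (simp add: eval_nat_numeral algebra_simps)
    also have "\<dots> \<le> 18 * Z * (ind * N) + 2 * Z * ((1 - ind) * (n * f)) + 16 * Z * W"
      using KL[of 2 3] KL[of 1 2] KL[of 2 0] ind(1) N f0 W
      by (intro mult_left_mono add_mono mult_right_mono) auto
    finally have t3: "2 * G + 2 * (G * K) \<le> 36 * Z * (ind * N) + 4 * Z * ((1 - ind) * (n * f)) + 32 * Z * W"
      by (simp add: algebra_simps)
    have nn: "0 \<le> Z * (ind * N)" "0 \<le> Z * ((1 - ind) * (n * f))" "0 \<le> Z * f" "0 \<le> Z * W"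
      using Z ind(1) N f0 W by auto
    have "2 * (n * f) * (3600 * K ^ 6 * L ^ 6 / (n * Q\<^sup>2)) + 2 * G +
       (2 * (n * f) * (100 * K ^ 4 * L\<^sup>2 * n) + 2 * G) * (4 * K / (real n)\<^sup>2)
       \<le> 7200 * (Z * (ind * N)) + 7200 * (Z * ((1 - ind) * (n * f))) + 36 * (Z * (ind * N)) +
         4 * (Z * ((1 - ind) * (n * f))) + 32 * (Z * W) + 800 * (Z * f)"
    proof -
      define X1 X2 where "X1 = 2 * (n * f) * (3600 * K ^ 6 * L ^ 6 / (n * Q\<^sup>2))"
        and "X2 = (2 * (n * f) * (100 * K ^ 4 * L\<^sup>2 * n) + 2 * G) * (4 * K / (real n)\<^sup>2)"
      have "X1 \<le> 7200 * (Z * (ind * N)) + 7200 * (Z * ((1 - ind) * (n * f)))"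
        using t1 unfolding X1_def[symmetric] by (simp only: distrib_left mult.assoc)
      moreover have "X2 \<le> 800 * (Z * f) + 2 * (G * K)"
        using t2 unfolding X2_def[symmetric] by (simp only: mult.assoc)
      moreover have "2 * G + 2 * (G * K) \<le> 36 * (Z * (ind * N)) + 4 * (Z * ((1 - ind) * (n * f))) + 32 * (Z * W)"
        using t3 by (simp only: mult.assoc)
      ultimately show ?thesis unfolding X1_def[symmetric] X2_def[symmetric] by linarith
    qed
    also have "\<dots> \<le> 8000 * (Z * (ind * N) + Z * ((1 - ind) * (n * f)) + Z * f + Z * W)"
    proof -
      have "7200 * a + 7200 * b + 36 * a + 4 * b + 32 * d + 800 * c \<le> 8000 * (a + b + c + d)"
        if "0 \<le> a" "0 \<le> b" "0 \<le> c" "0 \<le> d" for a b c d :: real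
        using that by simp
      from this[OF nn] show ?thesis .
    qed
    also have "\<dots> = 8000 * K ^ 8 * L ^ 6 * (N * ind + n * f * (1 - ind) + f + W)"
      by (simp add: Z_def algebra_simps)
    finally show "2 * (n * f) * (3600 * K ^ 6 * L ^ 6 / (n * Q\<^sup>2)) + 2 * G +
       (2 * (n * f) * (100 * K ^ 4 * L\<^sup>2 * n) + 2 * G) * (4 * K / (real n)\<^sup>2)
       \<le> 8000 * K ^ 8 * L ^ 6 * (N * ind + n * f * (1 - ind) + f + W)" .
  qed
  finally show ?thesis
    unfolding ind(2) by (simp only: f_def D_def W_def ind_def N_def)
qed


lemma gauss_abs_tail_le:
  assumes "M \<ge> 1"
  shows "(\<integral>\<^sup>+z. indicator (- {-M..M}) z \<partial>gauss 0) \<le> ennreal (2 * exp (- M\<^sup>2 / 2))"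
proof -
  define S where "S = - {-M..M}"
  have S [measurable]: "S \<in> sets borel" by (simp add: S_def)
  have i: "integrable lborel (\<lambda>t. std_normal_density t * indicator S t)"
    by (rule integrable_real_mult_indicator) (simp_all add: S)
  have "\<bar>\<integral>t. std_normal_density t * indicator (- {-M..M}) t \<partial>lborel\<bar> \<le> 2 * exp (- M\<^sup>2 / 2)"
  proof (rule gauss_tail_integral_le)
    show "0 \<le> M" using assms by linarith
    show "integrable lborel (\<lambda>t. std_normal_density t * indicator (- {-M..M}) t)"
      using i by (simp only: S_def)
    fix t :: real assume t: "M < \<bar>t\<bar>"
    have "1 \<le> 2 * pi" using pi_ge_two by linarith
    then have "1 \<le> sqrt (2 * pi)" by (rule real_sqrt_ge_one)
    then have "1 / sqrt (2 * pi) \<le> 1" by (simp add: divide_le_eq_1)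
    then have "1 / sqrt (2 * pi) * exp (- t\<^sup>2 / 2) \<le> \<bar>t\<bar> * exp (- t\<^sup>2 / 2)"
      using t assms by (intro mult_right_mono) (linarith | simp)+
    then show "\<bar>std_normal_density t\<bar> \<le> \<bar>t\<bar> * exp (- t\<^sup>2 / 2)"
      by (simp only: std_normal_density_def abs_of_nonneg normal_density_nonneg[of 0 1 t, unfolded std_normal_density_def])
  qed
  then have le: "(\<integral>t. std_normal_density t * indicator S t \<partial>lborel) \<le> 2 * exp (- M\<^sup>2 / 2)"
    unfolding S_def by linarith
  have "(\<integral>\<^sup>+z. indicator S z \<partial>gauss 0) = (\<integral>\<^sup>+z. ennreal (std_normal_density z) * indicator S z \<partial>lborel)"
    by (rule nn_integral_gauss) measurable
  also have "\<dots> = (\<integral>\<^sup>+z. ennreal (std_normal_density z * indicator S z) \<partial>lborel)"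
    by (rule nn_integral_cong) (simp add: indicator_def)
  also have "\<dots> = ennreal (\<integral>z. std_normal_density z * indicator S z \<partial>lborel)"
    by (rule nn_integral_eq_integral[OF i]) (intro AE_I2 mult_nonneg_nonneg normal_density_nonneg indicator_pos_le)
  also have "\<dots> \<le> ennreal (2 * exp (- M\<^sup>2 / 2))"
    by (rule ennreal_leI[OF le])
  finally show ?thesis unfolding S_def .
qed

lemma nn_integral_mix: "n \<ge> 1 \<Longrightarrow> g \<in> borel_measurable borel \<Longrightarrow>
  (\<integral>\<^sup>+x. ennreal (n * mix n \<theta> x) * g x \<partial>lborel) = (\<Sum>k=1..n. \<integral>\<^sup>+x. g x \<partial>gauss (\<theta> k))"
proof -
  assume n: "n \<ge> 1" and [measurable]: "g \<in> borel_measurable borel"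
  have "(\<integral>\<^sup>+x. ennreal (n * mix n \<theta> x) * g x \<partial>lborel) = (\<integral>\<^sup>+x. (\<Sum>k=1..n. ennreal (normal_density (\<theta> k) 1 x) * g x) \<partial>lborel)"
  proof (rule nn_integral_cong)
    fix x
    have "ennreal (n * mix n \<theta> x) = (\<Sum>k=1..n. ennreal (normal_density (\<theta> k) 1 x))"
      using n by (simp add: mix_def)
    then show "ennreal (n * mix n \<theta> x) * g x = (\<Sum>k=1..n. ennreal (normal_density (\<theta> k) 1 x) * g x)"
      by (simp only: sum_distrib_right)
  qed
  also have "\<dots> = (\<Sum>k=1..n. \<integral>\<^sup>+x. g x \<partial>gauss (\<theta> k))"
    by (simp add: nn_integral_sum nn_integral_gauss)
  finally show ?thesis .
qed

text \<open>A mean of size at most \<open>M\<close> reaches beyond radius \<open>2 * M\<close> only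
  if its noise exceeds \<open>M\<close>. Every other mean contributes at most its full mass 1, which
  produces the count.\<close>

lemma mix_tail_le:
  fixes K :: real
  assumes n: "n \<ge> 1" and M: "M \<ge> 1" and K: "exp (- M\<^sup>2 / 2) \<le> K / n"
  shows "(\<integral>\<^sup>+x. ennreal (n * mix n \<theta> x * indicator (- {-(2*M)..2*M}) x) \<partial>lborel) \<le>
    ennreal (card {k\<in>{1..n}. \<bar>\<theta> k\<bar> > M} + 2 * K)"
proof -
  let ?S = "- {-(2*M)..2*M} :: real set"
  have "(\<integral>\<^sup>+x. ennreal (n * mix n \<theta> x * indicator ?S x) \<partial>lborel) = (\<integral>\<^sup>+x. ennreal (n * mix n \<theta> x) * indicator ?S x \<partial>lborel)"
    by (intro nn_integral_cong) (auto split: split_indicator)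
  also have "\<dots> = (\<Sum>k=1..n. \<integral>\<^sup>+x. indicator ?S x \<partial>gauss (\<theta> k))"
    using n by (intro nn_integral_mix) auto
  also have "\<dots> \<le> (\<Sum>k=1..n. ennreal ((if \<bar>\<theta> k\<bar> > M then 1 else 0) + 2 * exp (- M\<^sup>2 / 2)))"
  proof (rule sum_mono)
    fix k
    have e1: "emeasure (gauss (\<theta> k)) UNIV = 1"
      using prob_space.emeasure_space_1[OF prob_space_gauss[of "\<theta> k"]] by simp
    show "(\<integral>\<^sup>+x. indicator ?S x \<partial>gauss (\<theta> k)) \<le> ennreal ((if \<bar>\<theta> k\<bar> > M then 1 else 0) + 2 * exp (- M\<^sup>2 / 2))"
    proof (cases "\<bar>\<theta> k\<bar> > M")
      case True
      have "(\<integral>\<^sup>+x. indicator ?S x \<partial>gauss (\<theta> k)) \<le> (\<integral>\<^sup>+x. 1 \<partial>gauss (\<theta> k))"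
        by (intro nn_integral_mono) (auto split: split_indicator)
      also have "\<dots> = ennreal 1" using e1 by simp
      also have "\<dots> \<le> ennreal (1 + 2 * exp (- M\<^sup>2 / 2))" by (intro ennreal_leI) simp
      finally show ?thesis using True by simp
    next
      case False
      have "(\<integral>\<^sup>+x. indicator ?S x \<partial>gauss (\<theta> k)) = (\<integral>\<^sup>+z. indicator ?S (\<theta> k + z) \<partial>gauss 0)"
        by (rule nn_integral_gauss_shift) auto
      also have "\<dots> \<le> (\<integral>\<^sup>+z. indicator (- {-M..M}) z \<partial>gauss 0)"
        using False by (intro nn_integral_mono) (auto split: split_indicator)
      also have "\<dots> \<le> ennreal (2 * exp (- M\<^sup>2 / 2))" by (rule gauss_abs_tail_le[OF M])
      finally show ?thesis using False by simp
    qed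
  qed
  also have "\<dots> = ennreal (\<Sum>k=1..n. (if \<bar>\<theta> k\<bar> > M then 1 else 0) + 2 * exp (- M\<^sup>2 / 2))"
    by (rule sum_ennreal) auto
  also have "\<dots> \<le> ennreal (card {k\<in>{1..n}. \<bar>\<theta> k\<bar> > M} + 2 * K)"
  proof (rule ennreal_leI)
    have "(\<Sum>k=1..n. (if \<bar>\<theta> k\<bar> > M then 1 else 0) + 2 * exp (- M\<^sup>2 / 2)) =
        real (card {k\<in>{1..n}. \<bar>\<theta> k\<bar> > M}) + n * (2 * exp (- M\<^sup>2 / 2))"
    proof -
      have "real (card {k\<in>{1..n}. \<bar>\<theta> k\<bar> > M}) = (\<Sum>k=1..n. if \<bar>\<theta> k\<bar> > M then 1 else 0)"
        by (subst sum.inter_filter[symmetric]) (rule finite_atLeastAtMost, simp)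
      then show ?thesis by (simp add: sum.distrib)
    qed
    also have "n * (2 * exp (- M\<^sup>2 / 2)) \<le> 2 * K"
      using K n by (simp add: field_simps)
    finally show "(\<Sum>k=1..n. (if \<bar>\<theta> k\<bar> > M then 1 else 0) + 2 * exp (- M\<^sup>2 / 2)) \<le>
        card {k\<in>{1..n}. \<bar>\<theta> k\<bar> > M} + 2 * K" by simp
  qed
  finally show ?thesis .
qed

lemma nn_integral_cmult_sum4:
  assumes "f \<in> borel_measurable M" "g \<in> borel_measurable M" "h \<in> borel_measurable M" "k \<in> borel_measurable M"
  shows "(\<integral>\<^sup>+x. c * (f x + g x + h x + k x) \<partial>M) =
    c * ((\<integral>\<^sup>+x. f x \<partial>M) + (\<integral>\<^sup>+x. g x \<partial>M) + (\<integral>\<^sup>+x. h x \<partial>M) + (\<integral>\<^sup>+x. k x \<partial>M))"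
  using assms by (simp add: nn_integral_cmult nn_integral_add)

text \<open>The pointwise bound is integrated with \<open>R = 2 * M\<close>: the window has length
  \<open>4 * M\<close>, and the last two densities have mass 1, which gives the final 2.\<close>

lemma score_defect_le:
  assumes n: "n \<ge> 2" and L: "L \<ge> 1" and K: "K \<ge> 1" and M: "M \<ge> 1"
    and logn: "1 + 2 * ln n \<le> K * L"
    and r: "1 / (K * sqrt n) \<le> r" "r \<le> K * L / sqrt n"
    and c1: "exp (- L\<^sup>2 / (2 * (1 + 2 * ln n)\<^sup>2)) \<le> K / (real n)\<^sup>2"
    and c2: "exp (- L\<^sup>2 / 8) \<le> K / n" and c3: "exp (- M\<^sup>2 / 2) \<le> K / n"
  shows "score_defect r n \<theta> \<le>
    ennreal (8000 * K ^ 8 * L ^ 6 * (4 * M * sqrt n + card {k\<in>{1..n}. \<bar>\<theta> k\<bar> > M} + 2 * K + 2))"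
proof -
  let ?C = "8000 * K ^ 8 * L ^ 6"
  let ?S = "{-(2*M)..2*M} :: real set"
  have C: "?C \<ge> 0" using K L by simp
  have mp: "mix n \<theta> x \<ge> 0" "mix_wide n \<theta> x \<ge> 0" for x
    using n mix_pos[of n \<theta> x] mix_wide_bounds[of n \<theta> x] by (auto simp: less_imp_le)
  have "score_defect r n \<theta> \<le> (\<integral>\<^sup>+x. ennreal (?C *
       (sqrt n * indicator ?S x + n * mix n \<theta> x * indicator (- ?S) x + mix n \<theta> x + mix_wide n \<theta> x)) \<partial>lborel)"
    unfolding score_defect_def
    by (intro nn_integral_mono score_defect_pointwise[OF n L K logn r c1 c2])
  also have "\<dots> = (\<integral>\<^sup>+x. ennreal ?C * (ennreal (sqrt n) * indicator ?S x + ennreal (n * mix n \<theta> x * indicator (- ?S) x)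
       + ennreal (mix n \<theta> x) + ennreal (mix_wide n \<theta> x)) \<partial>lborel)"
  proof (rule nn_integral_cong)
    fix x :: real
    have "ennreal (sqrt n * indicator ?S x) = ennreal (sqrt n) * indicator ?S x"
      by (auto split: split_indicator)
    then show "ennreal (?C * (sqrt n * indicator ?S x + n * mix n \<theta> x * indicator (- ?S) x + mix n \<theta> x + mix_wide n \<theta> x)) =
      ennreal ?C * (ennreal (sqrt n) * indicator ?S x + ennreal (n * mix n \<theta> x * indicator (- ?S) x)
       + ennreal (mix n \<theta> x) + ennreal (mix_wide n \<theta> x))"
      using C mp[of x] by (subst ennreal_mult) (auto simp: ennreal_plus intro!: add_nonneg_nonneg)
  qed
  also have "\<dots> = ennreal ?C * (ennreal (sqrt n) * emeasure lborel ?S +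
      (\<integral>\<^sup>+x. ennreal (n * mix n \<theta> x * indicator (- ?S) x) \<partial>lborel) +
      (\<integral>\<^sup>+x. ennreal (mix n \<theta> x) \<partial>lborel) + (\<integral>\<^sup>+x. ennreal (mix_wide n \<theta> x) \<partial>lborel))"
    by (subst nn_integral_cmult_sum4) (measurable, simp add: nn_integral_cmult_indicator)
  also have "(\<integral>\<^sup>+x. ennreal (mix n \<theta> x) \<partial>lborel) = ennreal 1"
  proof -
    have "(\<integral>x. mix n \<theta> x \<partial>lborel) = 1" using n by (simp add: mix_def)
    moreover have "integrable lborel (mix n \<theta>)" unfolding mix_def by auto
    ultimately show ?thesis using mp by (subst nn_integral_eq_integral) auto
  qed
  also have "(\<integral>\<^sup>+x. ennreal (mix_wide n \<theta> x) \<partial>lborel) = ennreal 1"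
  proof -
    have "(\<integral>x. mix_wide n \<theta> x \<partial>lborel) = 1" using n by (simp add: mix_wide_def)
    moreover have "integrable lborel (mix_wide n \<theta>)" unfolding mix_wide_def by auto
    ultimately show ?thesis using mp by (subst nn_integral_eq_integral) auto
  qed
  also have "emeasure lborel ?S = ennreal (4 * M)" using M by simp
  also have "ennreal ?C * (ennreal (sqrt n) * ennreal (4 * M) +
      (\<integral>\<^sup>+x. ennreal (n * mix n \<theta> x * indicator (- ?S) x) \<partial>lborel) + ennreal 1 + ennreal 1) \<le>
      ennreal ?C * (ennreal (sqrt n) * ennreal (4 * M) + ennreal (card {k\<in>{1..n}. \<bar>\<theta> k\<bar> > M} + 2 * K) + ennreal 1 + ennreal 1)"
    by (intro mult_left_mono add_mono mix_tail_le[OF _ M c3] order_refl zero_le) (use n in simp)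
  also have "\<dots> = ennreal (?C * (4 * M * sqrt n + card {k\<in>{1..n}. \<bar>\<theta> k\<bar> > M} + 2 * K + 2))"
  proof -
    have *: "ennreal c * (ennreal a + ennreal b + ennreal 1 + ennreal 1) = ennreal (c * (a + b + 2))"
      if nn: "0 \<le> a" "0 \<le> b" "0 \<le> c" for a b c
    proof -
      have "ennreal a + ennreal b + ennreal 1 + ennreal 1 = ennreal (a + b + 1 + 1)"
        using nn by (simp only: ennreal_plus add_nonneg_nonneg zero_le_one)
      then show ?thesis
        using nn by (simp only: ennreal_mult add_nonneg_nonneg zero_le_one add.assoc one_add_one)
    qed
    have "ennreal (sqrt n) * ennreal (4 * M) = ennreal (4 * M * sqrt n)"
      by (subst ennreal_mult[symmetric]) (use M in \<open>auto simp: mult_ac\<close>)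
    moreover have nn: "0 \<le> 4 * M * sqrt n" "0 \<le> card {k\<in>{1..n}. \<bar>\<theta> k\<bar> > M} + 2 * K"
      using M K by auto
    ultimately show ?thesis
      using *[OF nn(1,2) C]
      by (simp only: add.assoc)
  qed
  finally show ?thesis .
qed

lemma nn_integral_gauss_moments:
  "(\<integral>\<^sup>+z. ennreal (z\<^sup>2) \<partial>gauss 0) = 1" "(\<integral>\<^sup>+z. ennreal (z ^ 4) \<partial>gauss 0) = 3"
proof -
  have *: "(\<integral>\<^sup>+z. ennreal (z ^ (2 * k)) \<partial>gauss 0) = ennreal (fact (2 * k) / (2 ^ k * fact k))" for k
  proof -
    have "(\<integral>\<^sup>+z. ennreal (z ^ (2 * k)) \<partial>gauss 0) = (\<integral>\<^sup>+z. ennreal (std_normal_density z) * ennreal (z ^ (2 * k)) \<partial>lborel)"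
      by (rule nn_integral_gauss) measurable
    also have "\<dots> = (\<integral>\<^sup>+z. ennreal (std_normal_density z * z ^ (2 * k)) \<partial>lborel)"
      by (rule nn_integral_cong) (simp add: ennreal_mult)
    also have "\<dots> = ennreal (\<integral>z. std_normal_density z * z ^ (2 * k) \<partial>lborel)"
      by (rule nn_integral_eq_integral[OF integrable_std_normal_moment]) simp
    finally show ?thesis by (simp only: integral_std_normal_moment_even)
  qed
  show "(\<integral>\<^sup>+z. ennreal (z\<^sup>2) \<partial>gauss 0) = 1" using *[of 1] by simp
  show "(\<integral>\<^sup>+z. ennreal (z ^ 4) \<partial>gauss 0) = 3" using *[of 2] by (simp add: fact_numeral)
qed

lemma emeasure_gauss_UNIV: "emeasure (gauss m) UNIV = 1"
  using prob_space.emeasure_space_1[OF prob_space_gauss[of m]] by simp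

subsection \<open>Soft thresholding\<close>

definition soft :: "real \<Rightarrow> real \<Rightarrow> real" where
  "soft t x = sgn x * max 0 (\<bar>x\<bar> - t)"

lemma soft_measurable [measurable]: "soft t \<in> borel_measurable borel"
  unfolding soft_def by measurable

lemma abs_soft_diff_le: "t \<ge> 0 \<Longrightarrow> \<bar>soft t (m + z) - m\<bar> \<le> \<bar>soft t z\<bar> + \<bar>m\<bar>"
  by (cases "m + z" "0::real" rule: linorder_cases; cases z "0::real" rule: linorder_cases)
     (auto simp: soft_def max_def)

lemma abs_soft_diff_le': "t \<ge> 0 \<Longrightarrow> \<bar>soft t (m + z) - m\<bar> \<le> \<bar>z\<bar> + t"
  by (cases "m + z" "0::real" rule: linorder_cases) (auto simp: soft_def max_def)

text \<open>Beyond \<open>t\<close>, convexity gives \<open>exp (- z\<^sup>2 / 2) \<le> exp (-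
  t\<^sup>2 / 2) * exp (- (t * (z - t)))\<close>, and the second moment of the exponential
  contributes \<open>2 / t ^ 3\<close> on each side. The power of \<open>t\<close> matters: for
  \<open>t\<^sup>2 = 2 * ln n\<close> the total over \<open>n\<close> coefficients has order
  \<open>(ln n) powr (- 3 / 2)\<close>, which is summable over dyadic \<open>n\<close>.\<close>

lemma soft_risk_zero:
  assumes t: "t > 0"
  shows "(\<integral>\<^sup>+z. ennreal ((soft t z)\<^sup>2) \<partial>gauss 0) \<le> ennreal (4 * exp (- t\<^sup>2 / 2) / t ^ 3)"
proof -
  let ?e = "\<lambda>z. (z - t)\<^sup>2 * (exp (- t\<^sup>2 / 2) * exp (- (t * (z - t))))"
  let ?F = "\<lambda>z. - exp (- t\<^sup>2 / 2) * (((z - t)\<^sup>2 / t + 2 * (z - t) / t\<^sup>2 + 2 / t ^ 3) * exp (- (t * (z - t))))"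
  have half: "(\<integral>\<^sup>+z. ennreal (?e z) * indicator {t..} z \<partial>lborel) = ennreal (2 * exp (- t\<^sup>2 / 2) / t ^ 3)"
  proof (subst nn_integral_FTC_atLeast[where F="?F" and T=0])
    have "((\<lambda>x::real. (x\<^sup>2 / t + 2 * x / t\<^sup>2 + 2 / t ^ 3) * exp (- (t * x))) \<longlongrightarrow> 0) at_top"
      using t by real_asymp
    then have "((\<lambda>z. ((z - t)\<^sup>2 / t + 2 * (z - t) / t\<^sup>2 + 2 / t ^ 3) * exp (- (t * (z - t)))) \<longlongrightarrow> 0) at_top"
      by (rule filterlim_compose) (real_asymp)
    from tendsto_mult_left[OF this, of "- exp (- t\<^sup>2 / 2)"] show "(?F \<longlongrightarrow> 0) at_top" by simp
    show "(?F has_real_derivative ?e z) (at z)" for z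
      using t by (auto intro!: derivative_eq_intros simp: field_simps power2_eq_square power3_eq_cube)
  qed (use t in \<open>auto simp: power2_eq_square power3_eq_cube\<close>)
  have half': "(\<integral>\<^sup>+z. ennreal (?e (- z)) * indicator {t..} (- z) \<partial>lborel) = ennreal (2 * exp (- t\<^sup>2 / 2) / t ^ 3)"
    using half nn_integral_real_affine[of "\<lambda>z. ennreal (?e z) * indicator {t..} z" "-1" 0] by simp
  have bound: "std_normal_density z * (z - t)\<^sup>2 \<le> ?e z" if "z \<ge> t" for z
  proof -
    have "1 \<le> 2 * pi" using pi_ge_two by linarith
    then have "1 \<le> sqrt (2 * pi)" by (rule real_sqrt_ge_one)
    then have "1 / sqrt (2 * pi) \<le> 1" by (simp add: divide_le_eq_1)
    then have "std_normal_density z \<le> 1 * exp (- z\<^sup>2 / 2)"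
      unfolding std_normal_density_def by (intro mult_right_mono) auto
    also have "- z\<^sup>2 / 2 \<le> - t\<^sup>2 / 2 + - (t * (z - t))"
    proof -
      have "0 \<le> (z - t)\<^sup>2" by simp
      then show ?thesis by (simp add: power2_eq_square algebra_simps)
    qed
    then have "1 * exp (- z\<^sup>2 / 2) \<le> exp (- t\<^sup>2 / 2) * exp (- (t * (z - t)))"
      by (simp flip: exp_add)
    finally have "(z - t)\<^sup>2 * std_normal_density z \<le> (z - t)\<^sup>2 * (exp (- t\<^sup>2 / 2) * exp (- (t * (z - t))))"
      by (intro mult_left_mono) auto
    then show ?thesis by (simp only: mult.commute)
  qed
  have "(\<integral>\<^sup>+z. ennreal ((soft t z)\<^sup>2) \<partial>gauss 0) = (\<integral>\<^sup>+z. ennreal (std_normal_density z) * ennreal ((soft t z)\<^sup>2) \<partial>lborel)"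
    by (rule nn_integral_gauss) measurable
  also have "\<dots> \<le> (\<integral>\<^sup>+z. ennreal (?e z) * indicator {t..} z + ennreal (?e (- z)) * indicator {t..} (- z) \<partial>lborel)"
  proof (rule nn_integral_mono)
    fix z :: real
    have sym: "std_normal_density (- z) = std_normal_density z" by (simp add: std_normal_density_def)
    consider "\<bar>z\<bar> < t" | "z \<ge> t" | "- z \<ge> t" by linarith
    then show "ennreal (std_normal_density z) * ennreal ((soft t z)\<^sup>2) \<le>
        ennreal (?e z) * indicator {t..} z + ennreal (?e (- z)) * indicator {t..} (- z)"
    proof cases
      case 1 then show ?thesis by (simp add: soft_def max_def)
    next
      case 2
      then have "(soft t z)\<^sup>2 = (z - t)\<^sup>2" using t by (simp add: soft_def max_def)
      then have "ennreal (std_normal_density z) * ennreal ((soft t z)\<^sup>2) = ennreal (std_normal_density z * (z - t)\<^sup>2)"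
        by (simp add: ennreal_mult)
      also have "\<dots> \<le> ennreal (?e z)" by (rule ennreal_leI[OF bound[OF 2]])
      finally show ?thesis using 2 t by (simp add: indicator_def)
    next
      case 3
      then have "(soft t z)\<^sup>2 = (- z - t)\<^sup>2" using t by (simp add: soft_def max_def power2_commute)
      then have "ennreal (std_normal_density z) * ennreal ((soft t z)\<^sup>2) = ennreal (std_normal_density (- z) * (- z - t)\<^sup>2)"
        unfolding sym by (simp add: ennreal_mult)
      also have "\<dots> \<le> ennreal (?e (- z))" by (rule ennreal_leI[OF bound[OF 3]])
      finally show ?thesis using 3 t by (simp add: indicator_def)
    qed
  qed
  also have "\<dots> = ennreal (2 * exp (- t\<^sup>2 / 2) / t ^ 3) + ennreal (2 * exp (- t\<^sup>2 / 2) / t ^ 3)"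
    by (subst nn_integral_add) (simp_all only: half half', measurable)
  also have "\<dots> = ennreal (4 * exp (- t\<^sup>2 / 2) / t ^ 3)"
    using t by (simp flip: ennreal_plus)
  finally show ?thesis .
qed

text \<open>A small mean is compared with the pure-noise case, a large one with noise plus
  threshold. The clipping of \<open>m\<^sup>2\<close> at 1 matches what \<open>kappa_hat\<close> can
  detect.\<close>

lemma soft_risk_le:
  assumes t: "t > 0"
  shows "(\<integral>\<^sup>+x. ennreal ((soft t x - m)\<^sup>2) \<partial>gauss m) \<le>
    ennreal (8 * exp (- t\<^sup>2 / 2) / t ^ 3 + (2 + 2 * t\<^sup>2) * min (m\<^sup>2) 1)"
proof -
  let ?z = "\<integral>\<^sup>+z. ennreal ((soft t z)\<^sup>2) \<partial>gauss 0"
  have sq: "x\<^sup>2 \<le> 2 * y\<^sup>2 + 2 * w\<^sup>2" if "\<bar>x\<bar> \<le> \<bar>y\<bar> + \<bar>w\<bar>" for x y w :: real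
  proof -
    have "\<bar>x\<bar>\<^sup>2 \<le> (\<bar>y\<bar> + \<bar>w\<bar>)\<^sup>2" using that by (intro power_mono) auto
    also have "\<dots> \<le> 2 * y\<^sup>2 + 2 * w\<^sup>2"
      using square_diff_le[of "\<bar>y\<bar>" "-\<bar>w\<bar>" 0] by simp
    finally show ?thesis by simp
  qed
  have eq: "(\<integral>\<^sup>+x. ennreal ((soft t x - m)\<^sup>2) \<partial>gauss m) = (\<integral>\<^sup>+z. ennreal ((soft t (m + z) - m)\<^sup>2) \<partial>gauss 0)"
    by (rule nn_integral_gauss_shift) measurable
  have c: "0 \<le> 8 * exp (- t\<^sup>2 / 2) / t ^ 3" using t by simp
  show ?thesis
  proof (cases "m\<^sup>2 \<le> 1")
    case True
    have "(\<integral>\<^sup>+z. ennreal ((soft t (m + z) - m)\<^sup>2) \<partial>gauss 0) \<le> (\<integral>\<^sup>+z. 2 * ennreal ((soft t z)\<^sup>2) + ennreal (2 * m\<^sup>2) \<partial>gauss 0)"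
    proof (rule nn_integral_mono)
      fix z
      have "(soft t (m + z) - m)\<^sup>2 \<le> 2 * (soft t z)\<^sup>2 + 2 * m\<^sup>2"
        using t abs_soft_diff_le[of t m z] by (intro sq) auto
      then have "ennreal ((soft t (m + z) - m)\<^sup>2) \<le> ennreal (2 * (soft t z)\<^sup>2 + 2 * m\<^sup>2)" by (rule ennreal_leI)
      also have "\<dots> = 2 * ennreal ((soft t z)\<^sup>2) + ennreal (2 * m\<^sup>2)"
        by (simp add: ennreal_mult)
      finally show "ennreal ((soft t (m + z) - m)\<^sup>2) \<le> 2 * ennreal ((soft t z)\<^sup>2) + ennreal (2 * m\<^sup>2)" .
    qed
    also have "\<dots> = 2 * ?z + ennreal (2 * m\<^sup>2)"
      by (subst nn_integral_add) (simp_all add: nn_integral_cmult emeasure_gauss_UNIV)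
    also have "\<dots> \<le> 2 * ennreal (4 * exp (- t\<^sup>2 / 2) / t ^ 3) + ennreal ((2 + 2 * t\<^sup>2) * min (m\<^sup>2) 1)"
    proof (intro add_mono mult_left_mono soft_risk_zero[OF t] ennreal_leI)
      show "2 * m\<^sup>2 \<le> (2 + 2 * t\<^sup>2) * min (m\<^sup>2) 1" using True by (simp add: min_def distrib_right)
    qed simp
    also have "2 * ennreal (4 * exp (- t\<^sup>2 / 2) / t ^ 3) = ennreal (8 * exp (- t\<^sup>2 / 2) / t ^ 3)"
      using t ennreal_mult[of 2 "4 * exp (- t\<^sup>2 / 2) / t ^ 3"] by simp
    also have "\<dots> + ennreal ((2 + 2 * t\<^sup>2) * min (m\<^sup>2) 1) = ennreal (8 * exp (- t\<^sup>2 / 2) / t ^ 3 + (2 + 2 * t\<^sup>2) * min (m\<^sup>2) 1)"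
      using c by (intro ennreal_plus[symmetric]) auto
    finally show ?thesis unfolding eq .
  next
    case False
    have "(\<integral>\<^sup>+z. ennreal ((soft t (m + z) - m)\<^sup>2) \<partial>gauss 0) \<le> (\<integral>\<^sup>+z. 2 * ennreal (z\<^sup>2) + ennreal (2 * t\<^sup>2) \<partial>gauss 0)"
    proof (rule nn_integral_mono)
      fix z
      have "(soft t (m + z) - m)\<^sup>2 \<le> 2 * z\<^sup>2 + 2 * t\<^sup>2"
        using t abs_soft_diff_le'[of t m z] by (intro sq) auto
      then have "ennreal ((soft t (m + z) - m)\<^sup>2) \<le> ennreal (2 * z\<^sup>2 + 2 * t\<^sup>2)" by (rule ennreal_leI)
      also have "\<dots> = 2 * ennreal (z\<^sup>2) + ennreal (2 * t\<^sup>2)"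
        by (simp add: ennreal_mult)
      finally show "ennreal ((soft t (m + z) - m)\<^sup>2) \<le> 2 * ennreal (z\<^sup>2) + ennreal (2 * t\<^sup>2)" .
    qed
    also have "\<dots> = 2 * 1 + ennreal (2 * t\<^sup>2)"
      unfolding nn_integral_gauss_moments(1)[symmetric]
      by (subst nn_integral_add) (simp_all add: nn_integral_cmult emeasure_gauss_UNIV)
    also have "\<dots> = ennreal (2 + 2 * t\<^sup>2)" by simp
    also have "\<dots> \<le> ennreal (8 * exp (- t\<^sup>2 / 2) / t ^ 3 + (2 + 2 * t\<^sup>2) * min (m\<^sup>2) 1)"
      using c False by (intro ennreal_leI) (simp add: min_def)
    finally show ?thesis unfolding eq .
  qed
qed

subsection \<open>The estimated proportion of nonzero means\<close>

text \<open>This is the mean of \<open>kappa_hat\<close>, because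
  \<open>sqrt 2 * exp (- x\<^sup>2 / 2)\<close> has mean \<open>exp (- m\<^sup>2 / 4)\<close> under
  \<open>gauss m\<close>.\<close>

definition kappa :: "nat \<Rightarrow> (nat \<Rightarrow> real) \<Rightarrow> real" where
  "kappa n \<theta> = 1 - (\<Sum>k=1..n. exp (- (\<theta> k)\<^sup>2 / 4)) / n"

definition clipped_energy :: "nat \<Rightarrow> (nat \<Rightarrow> real) \<Rightarrow> real" where
  "clipped_energy n \<theta> = (\<Sum>k=1..n. min ((\<theta> k)\<^sup>2) 1)"

text \<open>Completing the square leaves a multiple of the normal density with mean
  \<open>m / 2\<close> and standard deviation \<open>1 / sqrt 2\<close>.\<close>

lemma integral_gauss_exp: "(\<integral>x. sqrt 2 * exp (- x\<^sup>2 / 2) \<partial>gauss m) = exp (- m\<^sup>2 / 4)"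
proof -
  have "(\<integral>x. sqrt 2 * exp (- x\<^sup>2 / 2) \<partial>gauss m) = (\<integral>x. normal_density m 1 x * (sqrt 2 * exp (- x\<^sup>2 / 2)) \<partial>lborel)"
    by (rule integral_gauss) measurable
  also have "(\<lambda>x. normal_density m 1 x * (sqrt 2 * exp (- x\<^sup>2 / 2))) = (\<lambda>x. exp (- m\<^sup>2 / 4) * normal_density (m / 2) (1 / sqrt 2) x)"
  proof
    fix x
    have "- (x - m)\<^sup>2 / 2 + - x\<^sup>2 / 2 = - m\<^sup>2 / 4 + - (x - m / 2)\<^sup>2"
      by (simp add: power2_eq_square field_simps)
    then have e: "exp (- (x - m)\<^sup>2 / 2) * exp (- x\<^sup>2 / 2) = exp (- m\<^sup>2 / 4) * exp (- (x - m / 2)\<^sup>2)"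
      by (simp only: exp_add[symmetric])
    have "normal_density m 1 x * (sqrt 2 * exp (- x\<^sup>2 / 2)) = (sqrt 2 / sqrt (2 * pi)) * (exp (- (x - m)\<^sup>2 / 2) * exp (- x\<^sup>2 / 2))"
      by (simp add: normal_density_def)
    also have "sqrt 2 / sqrt (2 * pi) = 1 / sqrt pi" by (simp add: real_sqrt_mult)
    also have "1 / sqrt pi * (exp (- (x - m)\<^sup>2 / 2) * exp (- x\<^sup>2 / 2)) = exp (- m\<^sup>2 / 4) * (1 / sqrt pi * exp (- (x - m / 2)\<^sup>2))"
      unfolding e by simp
    also have "1 / sqrt pi * exp (- (x - m / 2)\<^sup>2) = normal_density (m / 2) (1 / sqrt 2) x"
      by (simp add: normal_density_def power_divide)
    finally show "normal_density m 1 x * (sqrt 2 * exp (- x\<^sup>2 / 2)) = exp (- m\<^sup>2 / 4) * normal_density (m / 2) (1 / sqrt 2) x" .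
  qed
  finally show ?thesis by simp
qed

lemma kappa_hat_measurable: "(\<lambda>u. kappa_hat n u) \<in> borel_measurable (obs_law n \<theta>)"
proof -
  have [measurable]: "(\<lambda>u. u k) \<in> borel_measurable (obs_law n \<theta>)" if "k \<in> {1..n}" for k
    using that by (rule obs_law_component)
  show ?thesis unfolding kappa_hat_def by measurable
qed

lemma kappa_concentration:
  assumes n: "n \<ge> 1" and d: "d \<ge> 0"
  shows "measure (obs_law n \<theta>) {u \<in> space (obs_law n \<theta>). d \<le> \<bar>kappa_hat n u - kappa n \<theta>\<bar>} \<le> 2 * exp (- (n * d\<^sup>2 / 4))"
proof -
  let ?f = "\<lambda>x::real. sqrt 2 * exp (- x\<^sup>2 / 2)"
  have "measure (obs_law n \<theta>) {u \<in> space (obs_law n \<theta>).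
      d \<le> \<bar>(\<Sum>k=1..n. ?f (u k)) / n - (\<Sum>k=1..n. \<integral>x. ?f x \<partial>gauss (\<theta> k)) / n\<bar>} \<le> 2 * exp (- (n * d\<^sup>2 / (2 * (sqrt 2)\<^sup>2)))"
  proof (rule obs_law_Hoeffding[OF n _ _ _ d])
    fix x :: real
    have "sqrt 2 * exp (- x\<^sup>2 / 2) \<le> sqrt 2 * 1" by (intro mult_left_mono) simp_all
    then show "\<bar>sqrt 2 * exp (- x\<^sup>2 / 2)\<bar> \<le> sqrt 2" by (simp only: abs_of_nonneg mult_nonneg_nonneg real_sqrt_ge_zero exp_ge_zero zero_le_numeral mult_1_right)
  qed simp_all
  moreover have "\<bar>kappa_hat n u - kappa n \<theta>\<bar> = \<bar>(\<Sum>k=1..n. ?f (u k)) / n - (\<Sum>k=1..n. \<integral>x. ?f x \<partial>gauss (\<theta> k)) / n\<bar>" for u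
  proof -
    have "(\<Sum>k=1..n. ?f (u k)) / n = sqrt 2 / n * (\<Sum>k=1..n. exp (- (u k)\<^sup>2 / 2))"
      by (simp only: sum_distrib_left[symmetric] times_divide_eq_left)
    then show ?thesis unfolding integral_gauss_exp kappa_hat_def kappa_def by linarith
  qed
  ultimately show ?thesis by simp
qed

text \<open>Since \<open>1 - exp (- x / 4)\<close> and \<open>min x 1\<close> are comparable, a test
  on \<open>kappa_hat\<close> is a test on the clipped energy.\<close>

lemma kappa_bounds:
  assumes n: "n \<ge> 1"
  shows "clipped_energy n \<theta> / 5 \<le> n * kappa n \<theta>" "n * kappa n \<theta> \<le> clipped_energy n \<theta>"
proof -
  have eq: "n * kappa n \<theta> = (\<Sum>k=1..n. 1 - exp (- (\<theta> k)\<^sup>2 / 4))"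
    using n by (simp add: kappa_def sum_subtractf right_diff_distrib)
  have le: "min x 1 / 5 \<le> 1 - exp (- x / 4)" "1 - exp (- x / 4) \<le> min x 1" if x: "x \<ge> 0" for x :: real
  proof -
    have "exp (- x / 4) \<ge> 1 - x / 4" using exp_ge_add_one_self[of "- x / 4"] by simp
    then show "1 - exp (- x / 4) \<le> min x 1" using x by (auto simp: min_def)
    define y where "y = min x 1"
    have y: "0 \<le> y" "y \<le> 1" "y \<le> x" using x by (auto simp: y_def)
    have "1 + y / 4 \<le> exp (y / 4)" by (rule exp_ge_add_one_self)
    then have "1 / exp (y / 4) \<le> 1 / (1 + y / 4)" using y by (intro divide_left_mono mult_pos_pos) auto
    then have "exp (- y / 4) \<le> 1 / (1 + y / 4)" by (simp add: exp_minus inverse_eq_divide)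
    \<comment> \<open>The constant 5 comes from
      \<open>(1 - y / 5) * (1 + y / 4) = 1 + (y - y\<^sup>2) / 20\<close>, which is at least 1 on
      the unit interval.\<close>
    also have "\<dots> \<le> 1 - y / 5"
    proof -
      have "y * y \<le> y" using y mult_left_mono[of y 1 y] by simp
      then have "1 \<le> (1 - y / 5) * (1 + y / 4)" by (simp add: algebra_simps)
      then show ?thesis using y by (simp add: divide_le_eq)
    qed
    finally have "y / 5 \<le> 1 - exp (- y / 4)" by simp
    also have "\<dots> \<le> 1 - exp (- x / 4)" using y by simp
    finally show "min x 1 / 5 \<le> 1 - exp (- x / 4)" by (simp add: y_def)
  qed
  show "clipped_energy n \<theta> / 5 \<le> n * kappa n \<theta>" "n * kappa n \<theta> \<le> clipped_energy n \<theta>"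
    unfolding eq clipped_energy_def sum_divide_distrib by (rule sum_mono, rule le, rule zero_le_power2)+
qed

subsection \<open>Risk of one level\<close>

definition level_risk :: "(nat \<Rightarrow> real) \<Rightarrow> (nat \<Rightarrow> real) \<Rightarrow> nat \<Rightarrow> (nat \<Rightarrow> real) \<Rightarrow> ennreal" where
  "level_risk \<rho> b n \<theta> = (\<Sum>k=1..n. \<integral>\<^sup>+u. ennreal ((t_hat \<rho> b n u (u k) - \<theta> k)\<^sup>2) \<partial>obs_law n \<theta>)"

lemma t_hat_eq: "t_hat \<rho> b n u x =
    (if kappa_hat n u > b n then x + score (\<rho> n) n {1..n} u x else soft (sqrt (2 * ln n)) x)"
  unfolding t_hat_def score_def soft_def deriv_phi_hat by (simp only: phi_hat_eq_kde)

lemma score_square_measurable: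
  assumes k: "k \<in> {1..n}"
  shows "(\<lambda>u. ennreal ((u k - c + score r n {1..n} u (u k))\<^sup>2)) \<in> borel_measurable (obs_law n \<theta>)"
proof -
  have [measurable]: "(\<lambda>u. u k) \<in> borel_measurable (obs_law n \<theta>)"
    using k by (rule obs_law_component)
  have "case_prod (score r n {1..n}) \<in> borel_measurable (obs_law n \<theta> \<Otimes>\<^sub>M borel)"
    using score_measurable[of "{1..n}" n r]
    by (subst measurable_cong_sets[OF sets_pair_measure_cong[OF sets_obs_law refl] refl]) auto
  then have "(\<lambda>u. case_prod (score r n {1..n}) (u, u k)) \<in> borel_measurable (obs_law n \<theta>)"
    by (rule measurable_compose[rotated]) measurable
  then have [measurable]: "(\<lambda>u. score r n {1..n} u (u k)) \<in> borel_measurable (obs_law n \<theta>)" by simp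
  show ?thesis by measurable
qed

text \<open>The error and the event depend on each other. Young's inequality separates them: a
  fourth moment that ignores \<open>A\<close>, and a constant charged to the probability of
  \<open>A\<close>. The weight \<open>w\<close> is free to balance the two; \<open>6 * w\<close>
  contains the fourth moment 3.\<close>

lemma rare_event_le:
  assumes k: "k \<in> {1..n}" and A: "A \<in> sets (obs_law n \<theta>)" and p: "measure (obs_law n \<theta>) A \<le> p"
    and w: "w > 0"
  shows "(\<integral>\<^sup>+u. ennreal ((\<bar>u k - \<theta> k\<bar> + c)\<^sup>2) * indicator A u \<partial>obs_law n \<theta>) \<le> ennreal (6 * w + (2 / w + 2 * c\<^sup>2) * p)"
proof -
  interpret P: prob_space "obs_law n \<theta>" by (rule prob_space_obs_law)
  have [measurable]: "(\<lambda>u. u k) \<in> borel_measurable (obs_law n \<theta>)"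
    using k by (rule obs_law_component)
  note A[measurable]
  have C: "0 \<le> 2 / w + 2 * c\<^sup>2" using w by simp
  have pw: "(\<bar>z\<bar> + c)\<^sup>2 \<le> 2 * w * z ^ 4 + (2 / w + 2 * c\<^sup>2)" for z :: real
  proof -
    have "0 \<le> (w * z\<^sup>2 - 1)\<^sup>2" by simp
    then have "2 * (w * z\<^sup>2) \<le> w\<^sup>2 * z ^ 4 + 1" by (simp add: power2_eq_square eval_nat_numeral algebra_simps)
    then have "2 * (w * z\<^sup>2) / w \<le> (w\<^sup>2 * z ^ 4 + 1) / w" using w by (intro divide_right_mono) auto
    then have "2 * z\<^sup>2 \<le> w * z ^ 4 + 1 / w" using w by (simp add: power2_eq_square add_divide_distrib)
    moreover have "0 \<le> w * z ^ 4" "0 \<le> 1 / w" using w by auto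
    moreover have "(\<bar>z\<bar> + c)\<^sup>2 \<le> 2 * z\<^sup>2 + 2 * c\<^sup>2" using square_diff_le[of "\<bar>z\<bar>" "-c" 0] by simp
    moreover have "2 / w = 2 * (1 / w)" by simp
    ultimately show ?thesis unfolding mult.assoc by linarith
  qed
  have "(\<integral>\<^sup>+u. ennreal ((\<bar>u k - \<theta> k\<bar> + c)\<^sup>2) * indicator A u \<partial>obs_law n \<theta>) \<le>
      (\<integral>\<^sup>+u. ennreal (2 * w) * ennreal ((u k - \<theta> k) ^ 4) + ennreal (2 / w + 2 * c\<^sup>2) * indicator A u \<partial>obs_law n \<theta>)"
  proof (rule nn_integral_mono)
    fix u
    have "ennreal ((\<bar>u k - \<theta> k\<bar> + c)\<^sup>2) \<le> ennreal (2 * w * (u k - \<theta> k) ^ 4 + (2 / w + 2 * c\<^sup>2))"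
      by (rule ennreal_leI[OF pw])
    also have "\<dots> = ennreal (2 * w) * ennreal ((u k - \<theta> k) ^ 4) + ennreal (2 / w + 2 * c\<^sup>2)"
      using w C by (subst ennreal_plus) (auto simp: ennreal_mult)
    finally have le: "ennreal ((\<bar>u k - \<theta> k\<bar> + c)\<^sup>2) \<le> ennreal (2 * w) * ennreal ((u k - \<theta> k) ^ 4) + ennreal (2 / w + 2 * c\<^sup>2)" .
    show "ennreal ((\<bar>u k - \<theta> k\<bar> + c)\<^sup>2) * indicator A u \<le>
        ennreal (2 * w) * ennreal ((u k - \<theta> k) ^ 4) + ennreal (2 / w + 2 * c\<^sup>2) * indicator A u"
      using le by (cases "u \<in> A") simp_all
  qed
  also have "\<dots> = ennreal (2 * w) * (\<integral>\<^sup>+u. ennreal ((u k - \<theta> k) ^ 4) \<partial>obs_law n \<theta>) + ennreal (2 / w + 2 * c\<^sup>2) * emeasure (obs_law n \<theta>) A"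
    by (subst nn_integral_add) (simp_all add: nn_integral_cmult nn_integral_cmult_indicator A)
  also have "(\<integral>\<^sup>+u. ennreal ((u k - \<theta> k) ^ 4) \<partial>obs_law n \<theta>) = (\<integral>\<^sup>+x. ennreal ((x - \<theta> k) ^ 4) \<partial>gauss (\<theta> k))"
    by (rule nn_integral_obs_law_component[OF k]) measurable
  also have "\<dots> = 3" by (subst nn_integral_gauss_shift) (simp_all add: nn_integral_gauss_moments)
  also have "ennreal (2 * w) * 3 = ennreal (6 * w)"
    using w ennreal_mult[of "2 * w" 3] by (simp add: mult_ac)
  also have "ennreal (2 / w + 2 * c\<^sup>2) * emeasure (obs_law n \<theta>) A \<le> ennreal ((2 / w + 2 * c\<^sup>2) * p)"
    unfolding P.emeasure_eq_measure using C p
    by (subst ennreal_mult[symmetric]) (auto intro!: ennreal_leI mult_left_mono)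
  also have "ennreal (6 * w) + ennreal ((2 / w + 2 * c\<^sup>2) * p) = ennreal (6 * w + (2 / w + 2 * c\<^sup>2) * p)"
    using w C p order_trans[OF measure_nonneg p] by (intro ennreal_plus[symmetric] mult_nonneg_nonneg) auto
  finally show ?thesis by (simp add: add_left_mono)
qed

lemma soft_level_risk_le:
  assumes n: "n \<ge> 2"
  shows "(\<Sum>k=1..n. \<integral>\<^sup>+u. ennreal ((soft (sqrt (2 * ln n)) (u k) - \<theta> k)\<^sup>2) \<partial>obs_law n \<theta>) \<le>
    ennreal (8 / (sqrt (2 * ln n)) ^ 3 + (2 + 4 * ln n) * clipped_energy n \<theta>)"
proof -
  define t where "t = sqrt (2 * ln n)"
  have ln: "ln (real n) > 0" using n by simp
  have t: "t > 0" "t\<^sup>2 = 2 * ln n" using ln by (simp_all add: t_def)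
  have e: "exp (- t\<^sup>2 / 2) = 1 / n" using n t by (simp add: exp_minus inverse_eq_divide)
  let ?c = "\<lambda>k. 8 * (1 / n) / t ^ 3 + (2 + 2 * (2 * ln n)) * min ((\<theta> k)\<^sup>2) 1"
  have nn: "0 \<le> ?c k" for k using t ln by (intro add_nonneg_nonneg mult_nonneg_nonneg) auto
  have "(\<Sum>k=1..n. \<integral>\<^sup>+u. ennreal ((soft t (u k) - \<theta> k)\<^sup>2) \<partial>obs_law n \<theta>) \<le> (\<Sum>k=1..n. ennreal (?c k))"
  proof (rule sum_mono)
    fix k assume k: "k \<in> {1..n}"
    have "(\<integral>\<^sup>+u. ennreal ((soft t (u k) - \<theta> k)\<^sup>2) \<partial>obs_law n \<theta>) = (\<integral>\<^sup>+x. ennreal ((soft t x - \<theta> k)\<^sup>2) \<partial>gauss (\<theta> k))"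
      by (rule nn_integral_obs_law_component[OF k]) measurable
    also have "\<dots> \<le> ennreal (?c k)"
      using soft_risk_le[OF t(1), of "\<theta> k"] unfolding e unfolding t(2) .
    finally show "(\<integral>\<^sup>+u. ennreal ((soft t (u k) - \<theta> k)\<^sup>2) \<partial>obs_law n \<theta>) \<le> ennreal (?c k)" .
  qed
  also have "\<dots> = ennreal (\<Sum>k=1..n. ?c k)" using nn by (intro sum_ennreal) auto
  also have "(\<Sum>k=1..n. ?c k) = 8 / t ^ 3 + (2 + 4 * ln n) * clipped_energy n \<theta>"
    using n by (simp add: sum.distrib clipped_energy_def sum_distrib_left)
  finally show ?thesis by (simp add: t_def)
qed

lemma kappa_hat_event_sets:
  "{u \<in> space (obs_law n \<theta>). kappa_hat n u \<le> c} \<in> sets (obs_law n \<theta>)"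
  "{u \<in> space (obs_law n \<theta>). c < kappa_hat n u} \<in> sets (obs_law n \<theta>)"
  using kappa_hat_measurable[of n \<theta>] by measurable

lemma kappa_hat_event_prob:
  assumes n: "n \<ge> 1" and d: "d \<ge> 0"
  shows "kappa n \<theta> \<ge> c + d \<Longrightarrow> measure (obs_law n \<theta>) {u \<in> space (obs_law n \<theta>). kappa_hat n u \<le> c} \<le> 2 * exp (- (n * d\<^sup>2 / 4))"
    and "kappa n \<theta> \<le> c - d \<Longrightarrow> measure (obs_law n \<theta>) {u \<in> space (obs_law n \<theta>). c < kappa_hat n u} \<le> 2 * exp (- (n * d\<^sup>2 / 4))"
proof -
  interpret P: prob_space "obs_law n \<theta>" by (rule prob_space_obs_law)
  have [measurable]: "kappa_hat n \<in> borel_measurable (obs_law n \<theta>)" using kappa_hat_measurable[of n \<theta>] .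
  have s: "{u \<in> space (obs_law n \<theta>). d \<le> \<bar>kappa_hat n u - kappa n \<theta>\<bar>} \<in> sets (obs_law n \<theta>)" by measurable
  show "measure (obs_law n \<theta>) {u \<in> space (obs_law n \<theta>). kappa_hat n u \<le> c} \<le> 2 * exp (- (n * d\<^sup>2 / 4))"
    if "kappa n \<theta> \<ge> c + d"
    using that by (intro order_trans[OF P.finite_measure_mono[OF _ s] kappa_concentration[OF n d]]) auto
  show "measure (obs_law n \<theta>) {u \<in> space (obs_law n \<theta>). c < kappa_hat n u} \<le> 2 * exp (- (n * d\<^sup>2 / 4))"
    if "kappa n \<theta> \<le> c - d"
    using that by (intro order_trans[OF P.finite_measure_mono[OF _ s] kappa_concentration[OF n d]]) auto
qed

lemma separable_risk_id: "separable_risk n \<theta> (\<lambda>x. x) = ennreal n"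
proof -
  have "(\<integral>\<^sup>+x. ennreal ((x - m)\<^sup>2) \<partial>gauss m) = 1" for m
    by (subst nn_integral_gauss_shift) (simp_all add: nn_integral_gauss_moments)
  then show ?thesis by (simp add: separable_risk_def ennreal_of_nat_eq_real_of_nat)
qed

lemma power_sub_one_le: "(1 + d) ^ 6 - 1 \<le> 6 * d * (1 + d) ^ 5" if "d \<ge> 0" for d :: real
proof -
  have "(1 + d) ^ 6 - 1 = d * ((1 + d) ^ 5 + (1 + d) ^ 4 + (1 + d) ^ 3 + (1 + d) ^ 2 + (1 + d) ^ 1 + (1 + d) ^ 0)"
    by (simp add: eval_nat_numeral algebra_simps)
  also have "\<dots> \<le> d * (6 * (1 + d) ^ 5)"
  proof (rule mult_left_mono[OF _ that])
    have "(1 + d) ^ i \<le> (1 + d) ^ 5" if "i \<le> 5" for i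
      using \<open>d \<ge> 0\<close> that by (intro power_increasing) auto
    from this[of 4] this[of 3] this[of 2] this[of 1] this[of 0]
    show "(1 + d) ^ 5 + (1 + d) ^ 4 + (1 + d) ^ 3 + (1 + d) ^ 2 + (1 + d) ^ 1 + (1 + d) ^ 0 \<le> 6 * (1 + d) ^ 5"
      by linarith
  qed
  finally show ?thesis by (simp add: mult_ac)
qed

text \<open>The factor \<open>(1 + d) ^ 6\<close> is turned into an additive error: the separable
  risk may be assumed at most \<open>n\<close>, and \<open>n * d\<close> has order
  \<open>sqrt n\<close> up to powers of \<open>K\<close> and \<open>L\<close>.\<close>

lemma score_total_le:
  assumes n: "n \<ge> 2" and L: "L \<ge> 1" and K: "K \<ge> 1" and M: "M \<ge> 1"
    and logn: "1 + 2 * ln n \<le> K * L"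
    and r: "1 / (K * sqrt n) \<le> r" "r \<le> K * L / sqrt n"
    and c1: "exp (- L\<^sup>2 / (2 * (1 + 2 * ln n)\<^sup>2)) \<le> K / (real n)\<^sup>2"
    and c2: "exp (- L\<^sup>2 / 8) \<le> K / n" and c3: "exp (- M\<^sup>2 / 2) \<le> K / n"
    and h: "h \<in> borel_measurable borel"
  shows "(\<Sum>k=1..n. \<integral>\<^sup>+u. ennreal ((u k - \<theta> k + score r n {1..n} u (u k))\<^sup>2) \<partial>obs_law n \<theta>) \<le>
    separable_risk n \<theta> h + ennreal (4100000 * K ^ 21 * L ^ 12 * (M * sqrt n + card {k\<in>{1..n}. \<bar>\<theta> k\<bar> > M}))"
proof -
  define N where "N = sqrt (real n)"
  define c where "c = real (card {k\<in>{1..n}. \<bar>\<theta> k\<bar> > M})"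
  have N: "N \<ge> 1" "N * N = n" using n by (simp_all add: N_def)
  have c: "c \<ge> 0" by (simp add: c_def)
  define d where "d = loo_error r n"
  define U where "U = K\<^sup>2 * L"
  have "1 * 1 \<le> K\<^sup>2 * L" using K L by (intro mult_mono) (auto simp: one_le_power)
  then have U: "U \<ge> 1" by (simp add: U_def)
  have r0: "r > 0" using r(1) K N by (intro less_le_trans[OF _ r(1)]) (simp add: N_def)
  have KN: "1 / r \<le> K * N" using r(1) r0 K N by (simp add: N_def[symmetric] field_simps)
  have ln: "ln (real n) \<ge> 0" using n by simp
  have d0: "d \<ge> 0" using n r0 ln by (simp add: d_def loo_error_def)
  have nd: "n * d \<le> U * N"
  proof -
    have "n * d = (1 + 2 * ln n) * (1 / r)" using n by (simp add: d_def loo_error_def)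
    also have "\<dots> \<le> (K * L) * (K * N)" using logn KN K L r0 by (intro mult_mono) auto
    finally show ?thesis by (simp add: U_def power2_eq_square mult_ac)
  qed
  have dU: "d \<le> U"
  proof -
    have "N * (N * d) = n * d" unfolding N(2)[symmetric] by simp
    with nd have "N * (N * d) \<le> N * U" by (simp only: mult.commute)
    then have "N * d \<le> U" by (rule mult_left_le_imp_le) (use N in simp)
    moreover have "1 * d \<le> N * d" using N d0 by (intro mult_right_mono) auto
    ultimately show ?thesis by simp
  qed
  have d1: "(1 + d) ^ i \<le> 2 ^ i * U ^ i" for i
  proof -
    have "(1 + d) ^ i \<le> (2 * U) ^ i" using dU U d0 by (intro power_mono) auto
    then show ?thesis by (simp add: power_mult_distrib)
  qed
  \<comment> \<open>A rule worse than the identity is replaced by the identity, whose risk is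
    \<open>n\<close>.\<close>
  obtain h' where h': "h' \<in> borel_measurable borel" "separable_risk n \<theta> h' \<le> separable_risk n \<theta> h"
    "separable_risk n \<theta> h' \<le> ennreal n"
  proof (cases "separable_risk n \<theta> h \<le> ennreal n")
    case True then show thesis using h by (intro that[of h]) auto
  next
    case False then show thesis by (intro that[of "\<lambda>x. x"]) (auto simp: separable_risk_id)
  qed
  have Kp: "K ^ i \<le> K ^ 21" if "i \<le> 21" for i using K that by (intro power_increasing) auto
  have Lp: "L ^ i \<le> L ^ 12" if "i \<le> 12" for i using L that by (intro power_increasing) auto
  define Z where "Z = K ^ 21 * L ^ 12"
  have KL: "K ^ i * L ^ j \<le> Z" if "i \<le> 21" "j \<le> 12" for i j
    unfolding Z_def using Kp[OF that(1)] Lp[OF that(2)] K L by (intro mult_mono) auto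
  have UZ: "U ^ i \<le> Z" if "i \<le> 6" for i
    using KL[of "2 * i" i] that by (simp add: U_def power_mult_distrib power_mult)
  have Z0: "Z \<ge> 0" using K L by (simp add: Z_def)
  let ?s = "separable_risk n \<theta> h'"
  let ?D = "8000 * K ^ 8 * L ^ 6 * (4 * M * sqrt n + card {k\<in>{1..n}. \<bar>\<theta> k\<bar> > M} + 2 * K + 2)"
  have D0: "?D \<ge> 0" using K L M by simp
  have D: "?D \<le> 64000 * (K ^ 9 * L ^ 6) * (M * N + c)"
  proof -
    have MN: "1 \<le> M * N" using mult_mono[OF M N(1)] M by simp
    have "1 * (M * N) \<le> K * (M * N)" "1 * c \<le> K * c" "K * 1 \<le> K * (M * N)" using K MN c
      by (intro mult_right_mono mult_left_mono; simp)+
    then have "4 * M * N + c + 2 * K + 2 \<le> 8 * (K * (M * N)) + 8 * (K * c)"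
      using K c MN by linarith
    then have "8000 * K ^ 8 * L ^ 6 * (4 * M * N + c + 2 * K + 2) \<le> 8000 * K ^ 8 * L ^ 6 * (8 * (K * (M * N)) + 8 * (K * c))"
      using K L by (intro mult_left_mono) auto
    also have "\<dots> = 64000 * ((K ^ 8 * K) * L ^ 6) * (M * N + c)" by (simp add: algebra_simps)
    also have "K ^ 8 * K = K ^ 9" by (simp add: eval_nat_numeral)
    finally show ?thesis by (simp add: N_def c_def)
  qed
  have MNc: "N \<le> M * N + c" "0 \<le> M * N + c"   proof -
    have "1 * N \<le> M * N" using M N by (intro mult_right_mono) auto
    then show "N \<le> M * N + c" "0 \<le> M * N + c" using c N by linarith+
  qed
  have "(\<Sum>k=1..n. \<integral>\<^sup>+u. ennreal ((u k - \<theta> k + score r n {1..n} u (u k))\<^sup>2) \<partial>obs_law n \<theta>) \<le>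
      ennreal ((1 + d) ^ 6) * (?s + score_defect r n \<theta>) + ennreal (8 * real n * d * (1 + d) ^ 4)"
    unfolding d_def by (rule score_oracle_reduction[OF n r0 h'(1)])
  also have "\<dots> \<le> ennreal ((1 + d) ^ 6) * (?s + ennreal ?D) + ennreal (8 * real n * d * (1 + d) ^ 4)"
    by (intro add_right_mono mult_left_mono add_left_mono score_defect_le[OF n L K M logn r c1 c2 c3]) auto
  also have "\<dots> = ennreal ((1 + d) ^ 6) * ?s + ennreal ((1 + d) ^ 6 * ?D + 8 * real n * d * (1 + d) ^ 4)"
  proof -
    have "ennreal a * (x + ennreal D) + ennreal e = ennreal a * x + ennreal (a * D + e)"
      if "0 \<le> a" "0 \<le> D" "0 \<le> e" for a D e :: real and x
      using that by (simp add: distrib_left ennreal_mult add.assoc)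
    from this[OF _ D0] show ?thesis using d0 by simp
  qed
  also have "ennreal ((1 + d) ^ 6) * ?s = ?s + ennreal ((1 + d) ^ 6 - 1) * ?s"
  proof -
    have "ennreal ((1 + d) ^ 6) = ennreal (1 + ((1 + d) ^ 6 - 1))" by simp
    also have "\<dots> = ennreal 1 + ennreal ((1 + d) ^ 6 - 1)" using d0 by (intro ennreal_plus) (auto simp: one_le_power)
    finally show ?thesis by (simp add: distrib_right)
  qed
  also have "ennreal ((1 + d) ^ 6 - 1) * ?s \<le> ennreal ((1 + d) ^ 6 - 1) * ennreal n"
    by (intro mult_left_mono h') auto
  also have "\<dots> \<le> ennreal (192 * Z * N)"
  proof -
    have "((1 + d) ^ 6 - 1) * n \<le> (6 * d * (1 + d) ^ 5) * n"
      by (intro mult_right_mono power_sub_one_le d0) auto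
    also have "\<dots> = 6 * (n * d) * (1 + d) ^ 5" by simp
    also have "\<dots> \<le> 6 * (U * N) * (2 ^ 5 * U ^ 5)"
      using nd by (intro mult_mono[OF _ d1[of 5]]) (use d0 U N in auto)
    also have "\<dots> = 192 * U ^ 6 * N" by (simp add: eval_nat_numeral)
    also have "\<dots> \<le> 192 * Z * N" using UZ[of 6] N by (intro mult_right_mono mult_left_mono) auto
    finally show ?thesis using d0 by (simp add: ennreal_leI one_le_power flip: ennreal_mult)
  qed
  also have "?s + ennreal (192 * Z * N) + ennreal ((1 + d) ^ 6 * ?D + 8 * real n * d * (1 + d) ^ 4) \<le>
      separable_risk n \<theta> h + (ennreal (192 * Z * N) + ennreal (4096000 * Z * (M * N + c) + 128 * Z * N))"
  proof -
    have "(1 + d) ^ 6 * ?D \<le> (2 ^ 6 * U ^ 6) * (64000 * (K ^ 9 * L ^ 6) * (M * N + c))"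
      by (rule mult_mono[OF d1[of 6] D _ D0]) (use U in simp)
    also have "\<dots> = 4096000 * (K ^ 21 * L ^ 12) * (M * N + c)"
    proof -
      \<comment> \<open>The exponents 21 and 12 arise here: this factor meets
        \<open>K ^ 9 * L ^ 6\<close> from the defect.\<close>
      have a: "U ^ 6 = K ^ 12 * L ^ 6" by (simp add: U_def power_mult_distrib flip: power_mult)
      have "K ^ 12 * (L ^ 6 * (K ^ 9 * L ^ 6)) = (K ^ 12 * K ^ 9) * (L ^ 6 * L ^ 6)" by (simp only: mult_ac)
      also have "\<dots> = K ^ 21 * L ^ 12" by (simp flip: power_add)
      finally show ?thesis unfolding a by simp
    qed
    finally have 1: "(1 + d) ^ 6 * ?D \<le> 4096000 * Z * (M * N + c)" by (simp only: Z_def)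
    have "8 * real n * d * (1 + d) ^ 4 = 8 * (n * d) * (1 + d) ^ 4" by simp
    also have "\<dots> \<le> 8 * (U * N) * (2 ^ 4 * U ^ 4)"
      using nd by (intro mult_mono[OF _ d1[of 4]]) (use d0 U N in auto)
    also have "\<dots> = 128 * U ^ 5 * N" by (simp add: eval_nat_numeral)
    also have "\<dots> \<le> 128 * Z * N" using UZ[of 5] N by (intro mult_right_mono mult_left_mono) auto
    finally have 2: "8 * real n * d * (1 + d) ^ 4 \<le> 128 * Z * N" .
    show ?thesis
      unfolding add.assoc[of ?s] by (intro add_mono[OF h'(2)] add_left_mono ennreal_leI add_mono[OF 1 2])
  qed
  also have "\<dots> \<le> separable_risk n \<theta> h + ennreal (4100000 * Z * (M * N + c))"
  proof (intro add_left_mono)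
    have "Z * N \<le> Z * (M * N + c)" using MNc Z0 by (intro mult_left_mono) auto
    moreover have "0 \<le> Z * (M * N + c)" using MNc Z0 by simp
    moreover have "ennreal (192 * Z * N) + ennreal (4096000 * Z * (M * N + c) + 128 * Z * N) =
        ennreal (192 * Z * N + (4096000 * Z * (M * N + c) + 128 * Z * N))"
      using Z0 MNc N by (intro ennreal_plus[symmetric]) auto
    ultimately show "ennreal (192 * Z * N) + ennreal (4096000 * Z * (M * N + c) + 128 * Z * N) \<le> ennreal (4100000 * Z * (M * N + c))"
      by (simp only: mult.assoc) (intro ennreal_leI, linarith)
  qed
  finally show ?thesis by (simp add: Z_def N_def c_def add_right_mono add_left_mono mult.assoc)
qed

lemma level_risk_le_split:
  assumes s: "\<And>k u. k \<in> {1..n} \<Longrightarrow> u \<in> space (obs_law n \<theta>) \<Longrightarrow>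
      ennreal ((t_hat \<rho> b n u (u k) - \<theta> k)\<^sup>2) \<le> f k u + g k u"
    and f: "\<And>k. k \<in> {1..n} \<Longrightarrow> f k \<in> borel_measurable (obs_law n \<theta>)"
    and g: "\<And>k. k \<in> {1..n} \<Longrightarrow> g k \<in> borel_measurable (obs_law n \<theta>)"
  shows "level_risk \<rho> b n \<theta> \<le> (\<Sum>k=1..n. \<integral>\<^sup>+u. f k u \<partial>obs_law n \<theta>) + (\<Sum>k=1..n. \<integral>\<^sup>+u. g k u \<partial>obs_law n \<theta>)"
proof -
  have "level_risk \<rho> b n \<theta> \<le> (\<Sum>k=1..n. \<integral>\<^sup>+u. f k u + g k u \<partial>obs_law n \<theta>)"
    unfolding level_risk_def by (intro sum_mono nn_integral_mono s)
  also have "\<dots> = (\<Sum>k=1..n. (\<integral>\<^sup>+u. f k u \<partial>obs_law n \<theta>) + (\<integral>\<^sup>+u. g k u \<partial>obs_law n \<theta>))"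
    by (intro sum.cong refl nn_integral_add f g)
  finally show ?thesis by (simp only: sum.distrib)
qed

lemma soft_square_measurable:
  assumes k: "k \<in> {1..n}"
  shows "(\<lambda>u. ennreal ((soft t (u k) - c)\<^sup>2)) \<in> borel_measurable (obs_law n \<theta>)"
    and "A \<in> sets (obs_law n \<theta>) \<Longrightarrow> (\<lambda>u. ennreal ((\<bar>u k - c\<bar> + t)\<^sup>2) * indicator A u) \<in> borel_measurable (obs_law n \<theta>)"
proof -
  have [measurable]: "(\<lambda>u. u k) \<in> borel_measurable (obs_law n \<theta>)"
    using k by (rule obs_law_component)
  show "(\<lambda>u. ennreal ((soft t (u k) - c)\<^sup>2)) \<in> borel_measurable (obs_law n \<theta>)" by measurable
  show "(\<lambda>u. ennreal ((\<bar>u k - c\<bar> + t)\<^sup>2) * indicator A u) \<in> borel_measurable (obs_law n \<theta>)"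
    if [measurable]: "A \<in> sets (obs_law n \<theta>)" by measurable
qed

lemma rare_total_le:
  assumes A: "A \<in> sets (obs_law n \<theta>)" and p: "measure (obs_law n \<theta>) A \<le> p" and w: "w > 0"
  shows "(\<Sum>k=1..n. \<integral>\<^sup>+u. ennreal ((\<bar>u k - \<theta> k\<bar> + c)\<^sup>2) * indicator A u \<partial>obs_law n \<theta>) \<le>
    ennreal (n * (6 * w + (2 / w + 2 * c\<^sup>2) * p))"
proof -
  have "0 \<le> p" using p measure_nonneg order_trans by blast
  then have nn: "0 \<le> 6 * w + (2 / w + 2 * c\<^sup>2) * p" using w by simp
  have "(\<Sum>k=1..n. \<integral>\<^sup>+u. ennreal ((\<bar>u k - \<theta> k\<bar> + c)\<^sup>2) * indicator A u \<partial>obs_law n \<theta>) \<le>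
      (\<Sum>k=1..n. ennreal (6 * w + (2 / w + 2 * c\<^sup>2) * p))"
    by (intro sum_mono rare_event_le A p w)
  also have "\<dots> = ennreal (n * (6 * w + (2 / w + 2 * c\<^sup>2) * p))"
    using nn by (simp add: ennreal_mult ennreal_of_nat_eq_real_of_nat)
  finally show ?thesis .
qed

text \<open>Energy at most half the boundary puts \<open>kappa\<close> at least
  \<open>b n / 2\<close> below the test level, so the score branch is taken with probability of
  order \<open>1 / n ^ 6\<close>. That outweighs the polynomial size of the score.\<close>

lemma level_risk_le_sparse:
  fixes L :: real
  assumes n: "n \<ge> 2" and K: "K \<ge> 1" and L: "L \<ge> 1" "L \<le> n" and logn: "1 + 2 * ln n \<le> K * L"
    and r: "1 / (K * sqrt n) \<le> \<rho> n" and b: "0 \<le> b n"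
    and c4: "exp (- (n * (b n / 2)\<^sup>2 / 4)) \<le> K / real n ^ 6"
    and sparse: "clipped_energy n \<theta> \<le> n * (b n / 2)"
  shows "level_risk \<rho> b n \<theta> \<le>
    ennreal (8 / (sqrt (2 * ln n)) ^ 3 + (2 + 4 * ln n) * clipped_energy n \<theta> + 14 * K ^ 5 / n)"
proof -
  let ?P = "obs_law n \<theta>"
  define t B where "t = sqrt (2 * ln n)" and "B = K\<^sup>2 * L * sqrt n"
  define A where "A = {u \<in> space ?P. b n < kappa_hat n u}"
  have A: "A \<in> sets ?P" unfolding A_def by (rule kappa_hat_event_sets)
  have ln: "ln (real n) > 0" using n by simp
  have "n * kappa n \<theta> \<le> n * (b n / 2)" using kappa_bounds(2)[of n \<theta>] n sparse by linarith
  then have "kappa n \<theta> \<le> b n - b n / 2" using n by simp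
  then have "measure ?P A \<le> 2 * exp (- (n * (b n / 2)\<^sup>2 / 4))"
    unfolding A_def using n b by (intro kappa_hat_event_prob) auto
  with c4 have p: "measure ?P A \<le> 2 * K / real n ^ 6" by simp
  have "level_risk \<rho> b n \<theta> \<le> (\<Sum>k=1..n. \<integral>\<^sup>+u. ennreal ((soft t (u k) - \<theta> k)\<^sup>2) \<partial>?P) +
      (\<Sum>k=1..n. \<integral>\<^sup>+u. ennreal ((\<bar>u k - \<theta> k\<bar> + B)\<^sup>2) * indicator A u \<partial>?P)"
  proof (rule level_risk_le_split)
    fix k u assume u: "u \<in> space ?P" and k: "k \<in> {1..n}"
    show "ennreal ((t_hat \<rho> b n u (u k) - \<theta> k)\<^sup>2) \<le>
        ennreal ((soft t (u k) - \<theta> k)\<^sup>2) + ennreal ((\<bar>u k - \<theta> k\<bar> + B)\<^sup>2) * indicator A u"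
    proof (cases "u \<in> A")
      case True
      then have "t_hat \<rho> b n u (u k) - \<theta> k = (u k - \<theta> k) + score (\<rho> n) n {1..n} u (u k)"
        by (simp add: t_hat_eq A_def)
      moreover have "\<bar>score (\<rho> n) n {1..n} u (u k)\<bar> \<le> B"
        unfolding B_def by (rule abs_score_le[OF n K L(1) logn r]) simp
      ultimately have "\<bar>t_hat \<rho> b n u (u k) - \<theta> k\<bar> \<le> \<bar>u k - \<theta> k\<bar> + B" by linarith
      then have "\<bar>t_hat \<rho> b n u (u k) - \<theta> k\<bar>\<^sup>2 \<le> (\<bar>u k - \<theta> k\<bar> + B)\<^sup>2" by (rule power_mono) simp
      then have "ennreal ((t_hat \<rho> b n u (u k) - \<theta> k)\<^sup>2) \<le> ennreal ((\<bar>u k - \<theta> k\<bar> + B)\<^sup>2)"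
        by (intro ennreal_leI) simp
      then show ?thesis using True by (simp add: add_increasing)
    next
      case False
      then show ?thesis using u by (simp add: t_hat_eq A_def t_def)
    qed
  qed (use A soft_square_measurable in auto)
  also have "\<dots> \<le> ennreal (8 / t ^ 3 + (2 + 4 * ln n) * clipped_energy n \<theta>) + ennreal (14 * K ^ 5 / n)"
  proof (intro add_mono)
    show "(\<Sum>k=1..n. \<integral>\<^sup>+u. ennreal ((soft t (u k) - \<theta> k)\<^sup>2) \<partial>?P) \<le> ennreal (8 / t ^ 3 + (2 + 4 * ln n) * clipped_energy n \<theta>)"
      unfolding t_def by (rule soft_level_risk_le[OF n])
    \<comment> \<open>With this weight the fourth-moment part sums to \<open>6 / n\<close>, while
      \<open>2 / w\<close> is still negligible against \<open>1 / n ^ 6\<close>.\<close>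
    have w: "1 / (real n)\<^sup>2 > 0" using n by simp
    have B2: "B\<^sup>2 \<le> K ^ 4 * real n ^ 3"
    proof -
      have "B\<^sup>2 = K ^ 4 * (L\<^sup>2 * n)" by (simp add: B_def power_mult_distrib flip: power_mult)
      also have "\<dots> \<le> K ^ 4 * ((real n)\<^sup>2 * n)" using L K by (intro mult_left_mono mult_right_mono power_mono) auto
      finally show ?thesis by (simp add: power2_eq_square power3_eq_cube mult.assoc)
    qed
    have n1: "1 \<le> real n" using n by simp
    have K1: "K ^ i \<le> K ^ 5" if "i \<le> 5" for i using K that by (intro power_increasing) auto
    have "n * (6 * (1 / (real n)\<^sup>2) + (2 / (1 / (real n)\<^sup>2) + 2 * B\<^sup>2) * (2 * K / real n ^ 6)) \<le>
        n * (6 * (1 / (real n)\<^sup>2) + (2 * (real n)\<^sup>2 + 2 * (K ^ 4 * real n ^ 3)) * (2 * K / real n ^ 6))"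
      using B2 K by (intro mult_left_mono add_left_mono mult_right_mono) auto
    also have "\<dots> = 6 / n + 4 * K / real n ^ 3 + 4 * K ^ 5 / real n ^ 2"
      using n by (simp add: field_simps eval_nat_numeral)
    also have "\<dots> \<le> 6 / n + 4 * K / n + 4 * K ^ 5 / n"
    proof -
      have "real n \<le> real n ^ 3" "real n \<le> real n ^ 2" using n1 by (auto intro!: self_le_power)
      then show ?thesis using n1 K by (intro add_mono divide_left_mono order_refl mult_pos_pos zero_less_power) auto
    qed
    also have "\<dots> \<le> 6 * K ^ 5 / n + 4 * K ^ 5 / n + 4 * K ^ 5 / n"
      using K1[of 0] K1[of 1] by (intro add_mono divide_right_mono) auto
    also have "\<dots> = 14 * K ^ 5 / n" by (simp add: add_divide_distrib[symmetric])
    finally show "(\<Sum>k=1..n. \<integral>\<^sup>+u. ennreal ((\<bar>u k - \<theta> k\<bar> + B)\<^sup>2) * indicator A u \<partial>?P) \<le> ennreal (14 * K ^ 5 / n)"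
      by (intro order_trans[OF rare_total_le[OF A p w]] ennreal_leI)
  qed
  also have "\<dots> = ennreal (8 / t ^ 3 + (2 + 4 * ln n) * clipped_energy n \<theta> + 14 * K ^ 5 / n)"
    using K ln by (intro ennreal_plus[symmetric] add_nonneg_nonneg mult_nonneg_nonneg)
      (auto simp: t_def clipped_energy_def intro!: sum_nonneg)
  finally show ?thesis by (simp only: t_def)
qed

text \<open>If \<open>kappa\<close> clearly exceeds \<open>b n\<close>, thresholding is a rare
  event. Otherwise the clipped energy is at most of order \<open>K * L * sqrt n\<close>, soft
  thresholding itself fits into the error term, and the risks of both branches may simply be
  added.\<close>

lemma level_risk_le_oracle:
  fixes L :: real
  assumes n: "n \<ge> 2" and L: "L \<ge> 1" "L \<le> n" and K: "K \<ge> 1" and M: "M \<ge> 1"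
    and logn: "1 + 2 * ln n \<le> K * L"
    and r: "1 / (K * sqrt n) \<le> \<rho> n" "\<rho> n \<le> K * L / sqrt n"
    and b: "0 \<le> b n" "b n \<le> K * L / sqrt n"
    and c1: "exp (- L\<^sup>2 / (2 * (1 + 2 * ln n)\<^sup>2)) \<le> K / (real n)\<^sup>2"
    and c2: "exp (- L\<^sup>2 / 8) \<le> K / n" and c3: "exp (- M\<^sup>2 / 2) \<le> K / n"
    and c4: "exp (- (n * (b n / 2)\<^sup>2 / 4)) \<le> K / real n ^ 6"
    and h: "h \<in> borel_measurable borel"
  shows "level_risk \<rho> b n \<theta> \<le> separable_risk n \<theta> h +
    ennreal (4200000 * K ^ 21 * L ^ 12 * (M * sqrt n + card {k\<in>{1..n}. \<bar>\<theta> k\<bar> > M}))"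
proof -
  let ?P = "obs_law n \<theta>"
  define N where "N = sqrt (real n)"
  define c where "c = real (card {k\<in>{1..n}. \<bar>\<theta> k\<bar> > M})"
  define t where "t = sqrt (2 * ln n)"
  have N: "N \<ge> 1" "N * N = n" using n by (simp_all add: N_def)
  have c: "c \<ge> 0" by (simp add: c_def)
  have "ln 2 \<le> ln (real n)" using n by simp
  then have ln: "ln (real n) \<ge> 1 / 2" using ln2_ge_two_thirds by linarith
  then have t: "t \<ge> 1" "t\<^sup>2 = 2 * ln n" by (simp_all add: t_def)
  have MN: "1 \<le> M * N" "N \<le> M * N"
    using mult_mono[OF M N(1)] mult_right_mono[OF M, of N] M N by auto
  have Kp: "K ^ i \<le> K ^ 21" if "i \<le> 21" for i using K that by (intro power_increasing) auto
  have Lp: "L ^ i \<le> L ^ 12" if "i \<le> 12" for i using L that by (intro power_increasing) auto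
  define Z where "Z = K ^ 21 * L ^ 12"
  have KL: "K ^ i * L ^ j \<le> Z" if "i \<le> 21" "j \<le> 12" for i j
    unfolding Z_def using Kp[OF that(1)] Lp[OF that(2)] K L by (intro mult_mono) auto
  have Z0: "Z \<ge> 0" using K L by (simp add: Z_def)
  let ?S = "(\<Sum>k=1..n. \<integral>\<^sup>+u. ennreal ((u k - \<theta> k + score (\<rho> n) n {1..n} u (u k))\<^sup>2) \<partial>?P)"
  have "level_risk \<rho> b n \<theta> \<le> ?S + ennreal (24 * Z * (M * N))"
  proof (cases "kappa n \<theta> \<ge> b n + b n / 2")
    case True
    define A where "A = {u \<in> space ?P. kappa_hat n u \<le> b n}"
    have A: "A \<in> sets ?P" unfolding A_def by (rule kappa_hat_event_sets)
    have "measure ?P A \<le> 2 * exp (- (n * (b n / 2)\<^sup>2 / 4))"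
      unfolding A_def using n b True by (intro kappa_hat_event_prob) auto
    with c4 have p: "measure ?P A \<le> 2 * K / real n ^ 6" by simp
    have "level_risk \<rho> b n \<theta> \<le> ?S + (\<Sum>k=1..n. \<integral>\<^sup>+u. ennreal ((\<bar>u k - \<theta> k\<bar> + t)\<^sup>2) * indicator A u \<partial>?P)"
    proof (rule level_risk_le_split)
      fix k u assume u: "u \<in> space ?P" and k: "k \<in> {1..n}"
      show "ennreal ((t_hat \<rho> b n u (u k) - \<theta> k)\<^sup>2) \<le>
          ennreal ((u k - \<theta> k + score (\<rho> n) n {1..n} u (u k))\<^sup>2) + ennreal ((\<bar>u k - \<theta> k\<bar> + t)\<^sup>2) * indicator A u"
      proof (cases "u \<in> A")
        case True
        then have "t_hat \<rho> b n u (u k) = soft t (\<theta> k + (u k - \<theta> k))"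
          by (simp add: t_hat_eq A_def t_def)
        then have "\<bar>t_hat \<rho> b n u (u k) - \<theta> k\<bar> \<le> \<bar>u k - \<theta> k\<bar> + t"
          using abs_soft_diff_le'[of t "\<theta> k" "u k - \<theta> k"] t by simp
        then have "\<bar>t_hat \<rho> b n u (u k) - \<theta> k\<bar>\<^sup>2 \<le> (\<bar>u k - \<theta> k\<bar> + t)\<^sup>2" by (rule power_mono) simp
        then have "ennreal ((t_hat \<rho> b n u (u k) - \<theta> k)\<^sup>2) \<le> ennreal ((\<bar>u k - \<theta> k\<bar> + t)\<^sup>2)"
          by (intro ennreal_leI) simp
        then show ?thesis using True by (simp add: add_increasing)
      next
        case False
        then have eq: "t_hat \<rho> b n u (u k) - \<theta> k = u k - \<theta> k + score (\<rho> n) n {1..n} u (u k)"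
          using u by (simp add: t_hat_eq A_def)
        show ?thesis unfolding eq by (rule add_increasing2) simp_all
      qed
    qed (use A soft_square_measurable score_square_measurable in auto)
    also have "\<dots> \<le> ?S + ennreal (24 * Z * (M * N))"
    proof (intro add_left_mono order_trans[OF rare_total_le[OF A p, where w="1 / n"]] ennreal_leI)
      have tn: "t\<^sup>2 \<le> 2 * n" unfolding t(2) using n ln_bound[of n] by simp
      have "n * (6 * (1 / n) + (2 / (1 / n) + 2 * t\<^sup>2) * (2 * K / real n ^ 6)) \<le>
          n * (6 * (1 / n) + (2 * n + 2 * (2 * n)) * (2 * K / real n ^ 6))"
        using tn K by (intro mult_left_mono add_left_mono mult_right_mono) auto
      also have "\<dots> = 6 + 12 * K / real n ^ 4" using n by (simp add: field_simps eval_nat_numeral)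
      also have "\<dots> \<le> 6 + 12 * K / 1" using n K by (intro add_left_mono divide_left_mono) (auto simp: one_le_power)
      also have "\<dots> \<le> 24 * Z * 1" using KL[of 1 0] KL[of 0 0] by simp
      also have "\<dots> \<le> 24 * Z * (M * N)" using MN Z0 by (intro mult_left_mono) auto
      finally show "n * (6 * (1 / n) + (2 / (1 / n) + 2 * t\<^sup>2) * (2 * K / real n ^ 6)) \<le> 24 * Z * (M * N)" .
    qed (use n in auto)
    finally show ?thesis .
  next
    case False
    have "level_risk \<rho> b n \<theta> \<le> ?S + (\<Sum>k=1..n. \<integral>\<^sup>+u. ennreal ((soft t (u k) - \<theta> k)\<^sup>2) \<partial>?P)"
    proof (rule level_risk_le_split)
      fix k u
      show "ennreal ((t_hat \<rho> b n u (u k) - \<theta> k)\<^sup>2) \<le>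
          ennreal ((u k - \<theta> k + score (\<rho> n) n {1..n} u (u k))\<^sup>2) + ennreal ((soft t (u k) - \<theta> k)\<^sup>2)"
        by (simp add: t_hat_eq t_def add_increasing add_increasing2 algebra_simps)
    qed (use soft_square_measurable score_square_measurable in auto)
    also have "\<dots> \<le> ?S + ennreal (24 * Z * (M * N))"
    proof (intro add_left_mono order_trans[OF soft_level_risk_le[OF n, folded t_def]] ennreal_leI)
      have "clipped_energy n \<theta> \<le> 5 * (n * kappa n \<theta>)" using kappa_bounds(1)[of n \<theta>] n by simp
      also have "\<dots> \<le> 5 * (n * (3 / 2 * b n))" using False by (intro mult_left_mono) auto
      also have "\<dots> \<le> 5 * (n * (3 / 2 * (K * L / N)))" using b by (intro mult_left_mono) (auto simp: N_def)
      also have "\<dots> = 15 / 2 * (K * L * N)" using N by (simp add: N(2)[symmetric])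
      finally have S: "clipped_energy n \<theta> \<le> 15 / 2 * (K * L * N)" .
      have "8 / t ^ 3 \<le> 8 / 1" using t by (intro divide_left_mono) (auto simp: one_le_power)
      moreover have "(2 + 4 * ln n) * clipped_energy n \<theta> \<le> 15 * (K\<^sup>2 * L\<^sup>2 * N)"
      proof -
        have "(2 + 4 * ln n) * clipped_energy n \<theta> \<le> (2 * (K * L)) * (15 / 2 * (K * L * N))"
          using logn S ln K L N by (intro mult_mono) (auto simp: clipped_energy_def intro!: sum_nonneg)
        also have "\<dots> = 15 * (K\<^sup>2 * L\<^sup>2 * N)" by (simp add: power2_eq_square)
        finally show ?thesis .
      qed
      moreover have "K\<^sup>2 * L\<^sup>2 * N \<le> Z * (M * N)" using KL[of 2 2] MN Z0 N K L by (intro mult_mono) auto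
      moreover have "1 * 1 \<le> Z * (M * N)" using KL[of 0 0] MN by (intro mult_mono) auto
      ultimately show "8 / t ^ 3 + (2 + 4 * ln n) * clipped_energy n \<theta> \<le> 24 * Z * (M * N)"
        unfolding mult.assoc[of 24] by linarith
    qed
    finally show ?thesis .
  qed
  also have "\<dots> \<le> (separable_risk n \<theta> h + ennreal (4100000 * Z * (M * N + c))) + ennreal (24 * Z * (M * N))"
    using score_total_le[OF n L(1) K M logn r c1 c2 c3 h, of \<theta>]
    by (intro add_right_mono) (simp only: Z_def N_def c_def mult.assoc)
  also have "\<dots> = separable_risk n \<theta> h + ennreal (4100000 * Z * (M * N + c) + 24 * Z * (M * N))"
    using Z0 MN c by (subst add.assoc, subst ennreal_plus[symmetric]) auto
  also have "\<dots> \<le> separable_risk n \<theta> h + ennreal (4200000 * Z * (M * N + c))"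
  proof (intro add_left_mono ennreal_leI)
    have "0 \<le> Z * (M * N)" "0 \<le> Z * c" using Z0 MN c by auto
    then show "4100000 * Z * (M * N + c) + 24 * Z * (M * N) \<le> 4200000 * Z * (M * N + c)"
      unfolding distrib_left mult.assoc by linarith
  qed
  finally show ?thesis by (simp only: Z_def N_def c_def mult.assoc)
qed

section \<open>Constants uniform in the level size\<close>

lemma tendsto_bounded_above:
  fixes f :: "nat \<Rightarrow> real"
  assumes "f \<longlonglongrightarrow> l"
  shows "\<exists>K. \<forall>n. f n \<le> K"
proof -
  from assms have "Bseq f" by (intro convergent_imp_Bseq convergentI)
  then obtain B where B: "\<And>n. norm (f n) \<le> B" by (auto simp: Bseq_def)
  have "f n \<le> B" for n using B[of n] by (simp add: abs_le_iff)
  then show ?thesis by blast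
qed

text \<open>Here \<open>real n powr s\<close> stands for a factor that dominates every power of \<open>ln n\<close>, and
  \<open>real n powr \<tau>\<close> for the range of the unknown means.\<close>

definition rate_const :: "real \<Rightarrow> real \<Rightarrow> real \<Rightarrow> (nat \<Rightarrow> real) \<Rightarrow> (nat \<Rightarrow> real) \<Rightarrow> bool" where
  "rate_const K s \<tau> \<rho> b \<longleftrightarrow> K \<ge> 1 \<and> (\<forall>n\<ge>2.
     1 + 2 * ln n \<le> K * real n powr s \<and>
     1 / (K * sqrt n) \<le> \<rho> n \<and>
     \<rho> n \<le> K * real n powr s / sqrt n \<and>
     b n \<le> K * real n powr s / sqrt n \<and>
     exp (- (real n powr s)\<^sup>2 / (2 * (1 + 2 * ln n)\<^sup>2)) \<le> K / (real n)\<^sup>2 \<and>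
     exp (- (real n powr s)\<^sup>2 / 8) \<le> K / n \<and>
     exp (- (real n powr \<tau>)\<^sup>2 / 2) \<le> K / n \<and>
     exp (- (n * (b n / 2)\<^sup>2 / 4)) \<le> K / real n ^ 6)"

lemma rate_constD:
  assumes "rate_const K s \<tau> \<rho> b"
  shows "K \<ge> 1"
    "n \<ge> 2 \<Longrightarrow> 1 + 2 * ln n \<le> K * real n powr s"
    "n \<ge> 2 \<Longrightarrow> 1 / (K * sqrt n) \<le> \<rho> n"
    "n \<ge> 2 \<Longrightarrow> \<rho> n \<le> K * real n powr s / sqrt n"
    "n \<ge> 2 \<Longrightarrow> b n \<le> K * real n powr s / sqrt n"
    "n \<ge> 2 \<Longrightarrow> exp (- (real n powr s)\<^sup>2 / (2 * (1 + 2 * ln n)\<^sup>2)) \<le> K / (real n)\<^sup>2"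
    "n \<ge> 2 \<Longrightarrow> exp (- (real n powr s)\<^sup>2 / 8) \<le> K / n"
    "n \<ge> 2 \<Longrightarrow> exp (- (real n powr \<tau>)\<^sup>2 / 2) \<le> K / n"
    "n \<ge> 2 \<Longrightarrow> exp (- (n * (b n / 2)\<^sup>2 / 4)) \<le> K / real n ^ 6"
  using assms unfolding rate_const_def by blast+

text \<open>Each condition says that some sequence is bounded above. All these sequences converge,
  so one \<open>K\<close> serves for all of them.\<close>

lemma rate_const_exists:
  fixes \<rho>\<^sub>0 b\<^sub>0 s \<tau> :: real
  assumes rb: "\<rho>\<^sub>0 > 0" "b\<^sub>0 > 0" and eta: "\<eta> \<longlonglongrightarrow> 0" and rho: "\<forall>n\<ge>2. geb_rho \<rho>\<^sub>0 \<eta> n > 0"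
    and s: "s > 0" "\<tau> > 0"
  shows "\<exists>K. rate_const K s \<tau> (geb_rho \<rho>\<^sub>0 \<eta>) (geb_b b\<^sub>0)"
proof -
  have e1: "(\<lambda>n. 1 + \<eta> n) \<longlonglongrightarrow> 1" using tendsto_add[OF tendsto_const eta, of 1] by simp
  have e2: "(\<lambda>n. inverse (1 + \<eta> n)) \<longlonglongrightarrow> 1" using tendsto_inverse[OF e1] by simp
  have "(\<lambda>n::nat. (1 + 2 * ln (real n)) / real n powr s) \<longlonglongrightarrow> 0" using s(1) by real_asymp
  from tendsto_bounded_above[OF this] obtain K1 where K1: "\<And>n::nat. (1 + 2 * ln (real n)) / real n powr s \<le> K1" by blast
  have "(\<lambda>n::nat. inverse (sqrt (2 * ln n))) \<longlonglongrightarrow> 0" by real_asymp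
  from tendsto_bounded_above[OF tendsto_mult[OF tendsto_mult[OF e2 tendsto_const[of "inverse \<rho>\<^sub>0"]] this]] obtain K2 where K2: "\<And>n::nat. inverse (1 + \<eta> n) * inverse \<rho>\<^sub>0 * inverse (sqrt (2 * ln n)) \<le> K2" by blast
  have "(\<lambda>n::nat. sqrt (2 * ln n) / real n powr s) \<longlonglongrightarrow> 0" using s(1) by real_asymp
  from tendsto_bounded_above[OF tendsto_mult[OF tendsto_mult[OF e1 tendsto_const[of "\<rho>\<^sub>0"]] this]] obtain K3 where K3: "\<And>n::nat. (1 + \<eta> n) * \<rho>\<^sub>0 * (sqrt (2 * ln n) / real n powr s) \<le> K3" by blast
  have "(\<lambda>n::nat. b\<^sub>0 * ln n / real n powr s) \<longlonglongrightarrow> 0" using s(1) rb(2) by real_asymp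
  from tendsto_bounded_above[OF this] obtain K4 where K4: "\<And>n::nat. b\<^sub>0 * ln n / real n powr s \<le> K4" by blast
  have "(\<lambda>n::nat. (real n)\<^sup>2 * exp (- (real n powr s)\<^sup>2 / (2 * (1 + 2 * ln n)\<^sup>2))) \<longlonglongrightarrow> 0" using s(1) by real_asymp
  from tendsto_bounded_above[OF this] obtain K5 where K5: "\<And>n::nat. (real n)\<^sup>2 * exp (- (real n powr s)\<^sup>2 / (2 * (1 + 2 * ln n)\<^sup>2)) \<le> K5" by blast
  have "(\<lambda>n::nat. real n * exp (- (real n powr s)\<^sup>2 / 8)) \<longlonglongrightarrow> 0" using s(1) by real_asymp
  from tendsto_bounded_above[OF this] obtain K6 where K6: "\<And>n::nat. real n * exp (- (real n powr s)\<^sup>2 / 8) \<le> K6" by blast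
  have "(\<lambda>n::nat. real n * exp (- (real n powr \<tau>)\<^sup>2 / 2)) \<longlonglongrightarrow> 0" using s(2) by real_asymp
  from tendsto_bounded_above[OF this] obtain K7 where K7: "\<And>n::nat. real n * exp (- (real n powr \<tau>)\<^sup>2 / 2) \<le> K7" by blast
  have "(\<lambda>n::nat. real n ^ 6 * exp (- (b\<^sub>0 * ln n)\<^sup>2 / 16)) \<longlonglongrightarrow> 0" using rb(2) by real_asymp
  from tendsto_bounded_above[OF this] obtain K8 where K8: "\<And>n::nat. real n ^ 6 * exp (- (b\<^sub>0 * ln n)\<^sup>2 / 16) \<le> K8" by blast
  define K where "K = Max {1, K1, K2, K3, K4, K5, K6, K7, K8}"
  have K: "1 \<le> K" "K1 \<le> K" "K2 \<le> K" "K3 \<le> K" "K4 \<le> K" "K5 \<le> K" "K6 \<le> K" "K7 \<le> K" "K8 \<le> K"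
    unfolding K_def by (rule Max_ge; simp)+
  show ?thesis
    unfolding rate_const_def
  proof (intro exI[of _ K] conjI K(1) allI impI)
    fix n :: nat assume n: "n \<ge> 2"
    have np: "real n powr s > 0" "sqrt (real n) > 0" "real n > 0" using n by auto
    have sq: "sqrt (2 * ln n / n) = sqrt (2 * ln n) / sqrt n" by (rule real_sqrt_divide)
    have ln: "sqrt (2 * ln n) > 0" using n by simp
    \<comment> \<open>Convergence of \<open>\<eta>\<close> controls only large \<open>n\<close>; for
      the remaining ones the sign comes from the positivity of \<open>geb_rho\<close>.\<close>
    have eta_pos: "1 + \<eta> n > 0"
      using rho[rule_format, OF n] rb ln np unfolding geb_rho_def sq
      by (simp add: zero_less_mult_iff zero_less_divide_iff)
    show "1 + 2 * ln n \<le> K * real n powr s"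
      using order_trans[OF K1 K(2), of n] np by (simp add: divide_le_eq)
    have "inverse (1 + \<eta> n) * inverse \<rho>\<^sub>0 * inverse (sqrt (2 * ln n)) \<le> K"
      by (rule order_trans[OF K2 K(3)])
    moreover define Y where "Y = (1 + \<eta> n) * \<rho>\<^sub>0 * sqrt (2 * ln n)"
    ultimately have "inverse Y \<le> K" by (simp only: inverse_mult_distrib)
    moreover have Y: "Y > 0" unfolding Y_def using eta_pos rb ln by (intro mult_pos_pos)
    ultimately have "inverse Y * Y \<le> K * Y" by (intro mult_right_mono) simp_all
    then have "1 \<le> K * Y" using Y by simp
    then have "1 / K \<le> Y" using K(1) by (simp add: divide_le_eq mult.commute)
    then have "1 / K / sqrt n \<le> Y / sqrt n" using np by (intro divide_right_mono) simp_all
    then show "1 / (K * sqrt n) \<le> geb_rho \<rho>\<^sub>0 \<eta> n"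
      unfolding geb_rho_def sq Y_def by simp
    show "geb_rho \<rho>\<^sub>0 \<eta> n \<le> K * real n powr s / sqrt n"
      unfolding geb_rho_def sq using order_trans[OF K3 K(4), of n] np by (simp add: divide_right_mono pos_divide_le_eq)
    show "geb_b b\<^sub>0 n \<le> K * real n powr s / sqrt n"
      unfolding geb_b_def using order_trans[OF K4 K(5), of n] np by (intro divide_right_mono) (simp_all add: pos_divide_le_eq)
    show "exp (- (real n powr s)\<^sup>2 / (2 * (1 + 2 * ln n)\<^sup>2)) \<le> K / (real n)\<^sup>2"
      using order_trans[OF K5 K(6), of n] np by (subst pos_le_divide_eq) (simp_all only: mult.commute zero_less_power)
    show "exp (- (real n powr s)\<^sup>2 / 8) \<le> K / n"
      using order_trans[OF K6 K(7), of n] np by (subst pos_le_divide_eq) (simp_all only: mult.commute)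
    show "exp (- (real n powr \<tau>)\<^sup>2 / 2) \<le> K / n"
      using order_trans[OF K7 K(8), of n] np by (subst pos_le_divide_eq) (simp_all only: mult.commute)
    \<comment> \<open>The logarithm in \<open>geb_b\<close> makes the exponent quadratic in
      \<open>ln n\<close>, so the tail probability beats every power of \<open>n\<close>.\<close>
    have "n * (geb_b b\<^sub>0 n / 2)\<^sup>2 / 4 = (b\<^sub>0 * ln n)\<^sup>2 / 16"
      using n by (simp add: geb_b_def power_divide)
    then have e: "- (n * (geb_b b\<^sub>0 n / 2)\<^sup>2 / 4) = - (b\<^sub>0 * ln n)\<^sup>2 / 16" by simp
    show "exp (- (n * (geb_b b\<^sub>0 n / 2)\<^sup>2 / 4)) \<le> K / real n ^ 6"
      unfolding e using order_trans[OF K8 K(9), of n] np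
      by (subst pos_le_divide_eq) (simp_all only: mult.commute zero_less_power)
  qed
qed

lemma geb_level_oracle:
  fixes \<rho>\<^sub>0 b\<^sub>0 s \<tau> :: real
  assumes rb: "\<rho>\<^sub>0 > 0" "b\<^sub>0 > 0" and eta: "\<eta> \<longlonglongrightarrow> 0" and rho: "\<forall>n\<ge>2. geb_rho \<rho>\<^sub>0 \<eta> n > 0"
    and s: "s > 0" "s \<le> 1" "\<tau> > 0"
  shows "\<exists>A>0. \<forall>n\<ge>2. \<forall>\<theta>. \<forall>h\<in>borel_measurable borel.
    level_risk (geb_rho \<rho>\<^sub>0 \<eta>) (geb_b b\<^sub>0) n \<theta> \<le> separable_risk n \<theta> h +
      ennreal (A * real n powr s * (real n powr (1/2 + \<tau>) + card {k\<in>{1..n}. \<bar>\<theta> k\<bar> > real n powr \<tau>}))"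
proof -
  \<comment> \<open>The oracle bound carries \<open>L ^ 12\<close>, so \<open>L\<close> receives a
    twelfth of the exponent.\<close>
  have s12: "s / 12 > 0" using s by simp
  obtain K where K: "rate_const K (s / 12) \<tau> (geb_rho \<rho>\<^sub>0 \<eta>) (geb_b b\<^sub>0)"
    using rate_const_exists[OF rb eta rho s12 s(3)] by blast
  note K = rate_constD[OF K]
  show ?thesis
  proof (intro exI[of _ "4200000 * K ^ 21"] conjI allI ballI impI)
    show "4200000 * K ^ 21 > 0" using K(1) by simp
    fix n \<theta> and h :: "real \<Rightarrow> real" assume n: "n \<ge> (2::nat)" and h: "h \<in> borel_measurable borel"
    define L M where "L = real n powr (s / 12)" and "M = real n powr \<tau>"
    have L: "1 \<le> L" "L \<le> n" and M: "1 \<le> M"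
      using n s powr_mono[of "s / 12" 1 "real n"] by (simp_all add: L_def M_def ge_one_powr_ge_zero)
    have b0: "0 \<le> geb_b b\<^sub>0 n" using n rb by (simp add: geb_b_def)
    have L12: "L ^ 12 = real n powr s" using n by (simp add: L_def powr_power)
    have Mn: "M * sqrt n = real n powr (1/2 + \<tau>)" using n by (simp add: M_def powr_add powr_half_sqrt)
    have "level_risk (geb_rho \<rho>\<^sub>0 \<eta>) (geb_b b\<^sub>0) n \<theta> \<le> separable_risk n \<theta> h +
      ennreal (4200000 * K ^ 21 * L ^ 12 * (M * sqrt n + card {k\<in>{1..n}. \<bar>\<theta> k\<bar> > M}))"
      by (rule level_risk_le_oracle)
        (rule n L K(1) M b0 h K(2,3,4,5,6,7,8,9)[OF n, folded L_def M_def])+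
    then show "level_risk (geb_rho \<rho>\<^sub>0 \<eta>) (geb_b b\<^sub>0) n \<theta> \<le> separable_risk n \<theta> h +
      ennreal (4200000 * K ^ 21 * real n powr s * (real n powr (1/2 + \<tau>) + card {k\<in>{1..n}. \<bar>\<theta> k\<bar> > real n powr \<tau>}))"
      unfolding L12 Mn unfolding M_def .
  qed
qed

lemma geb_level_sparse:
  fixes \<rho>\<^sub>0 b\<^sub>0 :: real
  assumes rb: "\<rho>\<^sub>0 > 0" "b\<^sub>0 > 0" and eta: "\<eta> \<longlonglongrightarrow> 0" and rho: "\<forall>n\<ge>2. geb_rho \<rho>\<^sub>0 \<eta> n > 0"
  shows "\<exists>A>0. \<forall>n\<ge>2. \<forall>\<theta>. clipped_energy n \<theta> \<le> b\<^sub>0 / 2 * ln n * sqrt n \<longrightarrow>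
    level_risk (geb_rho \<rho>\<^sub>0 \<eta>) (geb_b b\<^sub>0) n \<theta> \<le>
      ennreal (A * (1 / (sqrt (ln n)) ^ 3 + ln n * clipped_energy n \<theta> + 1 / n))"
proof -
  \<comment> \<open>In the sparse bound \<open>L\<close> enters only through the crude size of the
    score, so the largest choice \<open>L = n\<close> is good enough.\<close>
  obtain K where K: "rate_const K 1 1 (geb_rho \<rho>\<^sub>0 \<eta>) (geb_b b\<^sub>0)"
    using rate_const_exists[OF rb eta rho, of 1 1] by auto
  note K = rate_constD[OF K]
  show ?thesis
  proof (intro exI[of _ "14 * K ^ 5"] conjI allI impI)
    show "14 * K ^ 5 > 0" using K(1) by simp
    fix n \<theta> assume n: "n \<ge> (2::nat)" and sparse: "clipped_energy n \<theta> \<le> b\<^sub>0 / 2 * ln n * sqrt n"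
    have b0: "0 \<le> geb_b b\<^sub>0 n" using n rb by (simp add: geb_b_def)
    have "ln 2 \<le> ln (real n)" using n by simp
    then have ln: "ln (real n) \<ge> 1 / 2" using ln2_ge_two_thirds by linarith
    have "n * (geb_b b\<^sub>0 n / 2) = b\<^sub>0 / 2 * ln n * (n / sqrt n)"
      unfolding geb_b_def by (simp add: mult_ac)
    also have "n / sqrt n = sqrt n" by (simp add: real_div_sqrt)
    finally have "n * (geb_b b\<^sub>0 n / 2) = b\<^sub>0 / 2 * ln n * sqrt n" .
    with sparse have sp: "clipped_energy n \<theta> \<le> n * (geb_b b\<^sub>0 n / 2)" by simp
    have ce: "0 \<le> clipped_energy n \<theta>" by (auto simp: clipped_energy_def intro!: sum_nonneg)
    have "level_risk (geb_rho \<rho>\<^sub>0 \<eta>) (geb_b b\<^sub>0) n \<theta> \<le>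
        ennreal (8 / (sqrt (2 * ln n)) ^ 3 + (2 + 4 * ln n) * clipped_energy n \<theta> + 14 * K ^ 5 / n)"
      by (rule level_risk_le_sparse[where L="real n" and K=K])
        (use n K(1) K(2,3,9)[OF n] b0 sp in simp_all)
    also have "\<dots> \<le> ennreal (14 * K ^ 5 * (1 / (sqrt (ln n)) ^ 3 + ln n * clipped_energy n \<theta> + 1 / n))"
    proof (rule ennreal_leI)
      have K5: "1 \<le> K ^ 5" using K(1) by (rule one_le_power)
      have "8 / (sqrt (2 * ln n)) ^ 3 \<le> 8 / (sqrt (ln n)) ^ 3"
        using ln by (intro divide_left_mono power_mono mult_pos_pos zero_less_power) auto
      also have "\<dots> \<le> 14 * K ^ 5 / (sqrt (ln n)) ^ 3" using ln K5 by (intro divide_right_mono) auto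
      finally have 1: "8 / (sqrt (2 * ln n)) ^ 3 \<le> 14 * K ^ 5 * (1 / (sqrt (ln n)) ^ 3)" by simp
      have "2 + 4 * ln n \<le> 14 * ln n" using ln by simp
      also have "\<dots> \<le> 14 * K ^ 5 * ln n" using K5 ln by (intro mult_right_mono) auto
      finally have "(2 + 4 * ln n) * clipped_energy n \<theta> \<le> 14 * K ^ 5 * ln n * clipped_energy n \<theta>"
        using ce by (rule mult_right_mono)
      with 1 show "8 / (sqrt (2 * ln n)) ^ 3 + (2 + 4 * ln n) * clipped_energy n \<theta> + 14 * K ^ 5 / n \<le>
          14 * K ^ 5 * (1 / (sqrt (ln n)) ^ 3 + ln n * clipped_energy n \<theta> + 1 / n)"
        by (simp add: distrib_left mult.assoc)
    qed
    finally show "level_risk (geb_rho \<rho>\<^sub>0 \<eta>) (geb_b b\<^sub>0) n \<theta> \<le>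
      ennreal (14 * K ^ 5 * (1 / (sqrt (ln n)) ^ 3 + ln n * clipped_energy n \<theta> + 1 / n))" .
  qed
qed

subsection \<open>From one level to the array of coefficients\<close>

lemma prob_space_noise: "prob_space noise"
  unfolding noise_def by (intro prob_space_PiM prob_space_gauss)

lemma distr_gauss_shift: "distr (gauss 0) borel (\<lambda>x. m + x) = gauss m"
proof (rule measure_eqI)
  fix A assume "A \<in> sets (distr (gauss 0) borel (\<lambda>x. m + x))"
  then have [measurable]: "A \<in> sets borel" by simp
  have "emeasure (distr (gauss 0) borel (\<lambda>x. m + x)) A = (\<integral>\<^sup>+x. indicator A x \<partial>distr (gauss 0) borel (\<lambda>x. m + x))"
    by simp
  also have "\<dots> = (\<integral>\<^sup>+x. indicator A (m + x) \<partial>gauss 0)"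
    by (rule nn_integral_distr) measurable
  also have "\<dots> = (\<integral>\<^sup>+x. indicator A x \<partial>gauss m)"
    by (rule nn_integral_gauss_shift[symmetric]) measurable
  also have "\<dots> = emeasure (gauss m) A" by simp
  finally show "emeasure (distr (gauss 0) borel (\<lambda>x. m + x)) A = emeasure (gauss m) A" .
qed simp

lemma distr_standard_shift:
  assumes n: "n \<ge> 1"
  shows "distr (obs_law n (\<lambda>_. 0)) (PiM {1..n} (\<lambda>_. borel)) (\<lambda>u. \<lambda>l\<in>{1..n}. \<theta> l + u l) = obs_law n \<theta>"
proof -
  interpret P: prob_space "obs_law n (\<lambda>_. 0)" by (rule prob_space_obs_law)
  have "P.indep_vars (\<lambda>_. gauss 0) (\<lambda>l u. u l) {1..n}"
    unfolding obs_law_def using n by (intro indep_vars_PiM_coordinates prob_space_gauss) auto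
  then have ind: "P.indep_vars (\<lambda>_. borel) (\<lambda>l u. \<theta> l + u l) {1..n}"
    by (rule P.indep_vars_compose2) auto
  have rv: "(\<lambda>u. \<theta> l + u l) \<in> borel_measurable (obs_law n (\<lambda>_. 0))" if "l \<in> {1..n}" for l
    using obs_law_component[OF that] by simp
  have "distr (obs_law n (\<lambda>_. 0)) (PiM {1..n} (\<lambda>_. borel)) (\<lambda>u. \<lambda>l\<in>{1..n}. \<theta> l + u l) =
      PiM {1..n} (\<lambda>l. distr (obs_law n (\<lambda>_. 0)) borel (\<lambda>u. \<theta> l + u l))"
    by (rule iffD1[OF P.indep_vars_iff_distr_eq_PiM'[where I="{1..n}" and X="\<lambda>l u. \<theta> l + u l" and M'="\<lambda>_. borel", OF _ rv] ind])
      (use n in simp)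
  also have "\<dots> = obs_law n \<theta>"
    unfolding obs_law_def[of n \<theta>]
  proof (rule PiM_cong[OF refl])
    fix l assume l: "l \<in> {1..n}"
    have "gauss (\<theta> l) = distr (distr (obs_law n (\<lambda>_. 0)) borel (\<lambda>u. u l)) borel (\<lambda>x. \<theta> l + x)"
      unfolding distr_obs_law_component[OF l] by (rule distr_gauss_shift[symmetric])
    also have "\<dots> = distr (obs_law n (\<lambda>_. 0)) borel (\<lambda>u. \<theta> l + u l)"
      using obs_law_component[OF l] by (subst distr_distr) (auto simp: comp_def)
    finally show "distr (obs_law n (\<lambda>_. 0)) borel (\<lambda>u. \<theta> l + u l) = gauss (\<theta> l)" by simp
  qed
  finally show ?thesis .
qed

lemma level_size_ge_1: "level_size j \<ge> 1"
  by (simp add: level_size_def)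

lemma coeff_index_level: "j \<ge> -1 \<Longrightarrow> l \<in> {1..level_size j} \<Longrightarrow> (j, l) \<in> coeff_index"
  by (simp add: coeff_index_def)

lemma distr_noise_level:
  assumes j: "j \<ge> -1"
  shows "distr noise (PiM {1..level_size j} (\<lambda>_. borel)) (\<lambda>z. \<lambda>l\<in>{1..level_size j}. z (j, l)) = obs_law (level_size j) (\<lambda>_. 0)"
proof -
  have "distr noise (PiM {1..level_size j} (\<lambda>l. gauss 0)) (\<lambda>z. \<lambda>l\<in>{1..level_size j}. z (j, l)) =
      PiM {1..level_size j} (\<lambda>_. gauss 0)"
    unfolding noise_def
    by (rule distr_PiM_reindex[where f="\<lambda>l. (j, l)"])
       (use coeff_index_level[OF j] in \<open>auto simp: inj_on_def intro: prob_space_gauss\<close>)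
  moreover have "sets (PiM {1..level_size j} (\<lambda>l. gauss 0)) = sets (PiM {1..level_size j} (\<lambda>_. borel))"
    by (rule sets_PiM_cong) auto
  ultimately show ?thesis
    unfolding obs_law_def by (subst distr_cong[OF refl _ refl]) auto
qed

lemma noise_level_measurable:
  assumes j: "j \<ge> -1"
  shows "(\<lambda>z. \<lambda>l\<in>{1..level_size j}. z (j, l)) \<in> measurable noise (PiM {1..level_size j} (\<lambda>_. borel))"
proof (rule measurable_restrict)
  fix l assume "l \<in> {1..level_size j}"
  then have "(\<lambda>z. z (j, l)) \<in> measurable noise (gauss 0)"
    unfolding noise_def by (rule measurable_component_singleton[OF coeff_index_level[OF j]])
  then show "(\<lambda>z. z (j, l)) \<in> borel_measurable noise" by simp
qed

text \<open>This is the passage from the infinite array to one level: all coordinates outside level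
  \<open>j\<close> integrate out.\<close>

lemma nn_integral_noise_level:
  assumes j: "j \<ge> -1" and f: "f \<in> borel_measurable (PiM {1..level_size j} (\<lambda>_. borel))"
  shows "(\<integral>\<^sup>+z. f (\<lambda>l\<in>{1..level_size j}. \<theta> l + z (j, l)) \<partial>noise) = (\<integral>\<^sup>+u. f u \<partial>obs_law (level_size j) \<theta>)"
proof -
  let ?n = "level_size j"
  let ?B = "PiM {1..?n} (\<lambda>_. borel :: real measure)"
  let ?g = "\<lambda>u. \<lambda>l\<in>{1..?n}. \<theta> l + u l"
  have g: "?g \<in> measurable ?B ?B"
    by (intro measurable_restrict) simp
  have "(\<integral>\<^sup>+u. f u \<partial>obs_law ?n \<theta>) = (\<integral>\<^sup>+u. f (?g u) \<partial>obs_law ?n (\<lambda>_. 0))"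
    unfolding distr_standard_shift[OF level_size_ge_1, of j \<theta>, symmetric]
    using g f by (subst nn_integral_distr) (auto simp: measurable_cong_sets[OF sets_obs_law refl])
  also have "\<dots> = (\<integral>\<^sup>+z. f (?g (\<lambda>l\<in>{1..?n}. z (j, l))) \<partial>noise)"
    unfolding distr_noise_level[OF j, symmetric]
    by (rule nn_integral_distr[OF noise_level_measurable[OF j]])
       (simp only: measurable_distr_eq1 measurable_compose[OF g f])
  also have "\<dots> = (\<integral>\<^sup>+z. f (\<lambda>l\<in>{1..?n}. \<theta> l + z (j, l)) \<partial>noise)"
    by (intro nn_integral_cong arg_cong[where f=f]) (auto simp: fun_eq_iff)
  finally show ?thesis by simp
qed

lemma t_hat_measurable:
  assumes k: "k \<in> {1..n}"
  shows "(\<lambda>u. ennreal ((t_hat \<rho> b n u (u k) - c)\<^sup>2)) \<in> borel_measurable (PiM {1..n} (\<lambda>_. borel))"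
proof -
  have eq: "ennreal ((t_hat \<rho> b n u (u k) - c)\<^sup>2) =
      (if b n < kappa_hat n u then ennreal ((u k - c + score (\<rho> n) n {1..n} u (u k))\<^sup>2)
       else ennreal ((soft (sqrt (2 * ln n)) (u k) - c)\<^sup>2))" for u
    by (simp add: t_hat_eq algebra_simps)
  have "(\<lambda>u. ennreal ((t_hat \<rho> b n u (u k) - c)\<^sup>2)) \<in> borel_measurable (obs_law n (\<lambda>_. 0))"
    unfolding eq
  proof (rule measurable_If)
    show "{u \<in> space (obs_law n (\<lambda>_. 0)). b n < kappa_hat n u} \<in> sets (obs_law n (\<lambda>_. 0))"
      by (rule kappa_hat_event_sets)
  qed (rule score_square_measurable[OF k] soft_square_measurable(1)[OF k])+
  then show ?thesis by (simp only: measurable_cong_sets[OF sets_obs_law refl])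
qed

lemma t_hat_cong:
  assumes "\<And>l. l \<in> {1..n} \<Longrightarrow> u l = v l"
  shows "t_hat \<rho> b n u x = t_hat \<rho> b n v x"
proof -
  have "phi_hat n u = phi_hat n v" "kappa_hat n u = kappa_hat n v"
    using assms unfolding phi_hat_def kappa_hat_def by (auto intro!: ext sum.cong arg_cong2[where f="(*)"] arg_cong2[where f="(-)"])
  then show ?thesis by (simp add: t_hat_def)
qed

lemma geb_level_risk:
  assumes j: "j \<ge> -1" "\<not> j < j_star N" and e: "\<epsilon> > 0"
  shows "(\<Sum>k=1..level_size j. \<integral>\<^sup>+z. ennreal ((geb_estimator N \<rho>\<^sub>0 b\<^sub>0 \<eta> \<epsilon> (observation \<epsilon> \<beta> z) (j, k) - \<beta> (j, k))\<^sup>2) \<partial>noise) =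
    ennreal (\<epsilon>\<^sup>2) * level_risk (geb_rho \<rho>\<^sub>0 \<eta>) (geb_b b\<^sub>0) (level_size j) (\<lambda>l. \<beta> (j, l) / \<epsilon>)"
  unfolding level_risk_def sum_distrib_left
proof (rule sum.cong[OF refl])
  fix k assume k: "k \<in> {1..level_size j}"
  let ?n = "level_size j"
  let ?t = "t_hat (geb_rho \<rho>\<^sub>0 \<eta>) (geb_b b\<^sub>0) ?n"
  let ?\<theta> = "\<lambda>l. \<beta> (j, l) / \<epsilon>"
  let ?v = "\<lambda>z. \<lambda>l\<in>{1..?n}. ?\<theta> l + z (j, l)"
  have "(\<integral>\<^sup>+z. ennreal ((geb_estimator N \<rho>\<^sub>0 b\<^sub>0 \<eta> \<epsilon> (observation \<epsilon> \<beta> z) (j, k) - \<beta> (j, k))\<^sup>2) \<partial>noise) =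
    (\<integral>\<^sup>+z. ennreal (\<epsilon>\<^sup>2) * ennreal ((?t (?v z) (?v z k) - ?\<theta> k)\<^sup>2) \<partial>noise)"
  proof (rule nn_integral_cong)
    fix z
    have obs: "observation \<epsilon> \<beta> z (j, l) / \<epsilon> = ?v z l" if "l \<in> {1..?n}" for l
      using that coeff_index_level[OF j(1) that] e by (simp add: observation_def add_divide_distrib)
    have "geb_estimator N \<rho>\<^sub>0 b\<^sub>0 \<eta> \<epsilon> (observation \<epsilon> \<beta> z) (j, k) = \<epsilon> * ?t (?v z) (?v z k)"
    proof -
      have "?t (\<lambda>l. observation \<epsilon> \<beta> z (j, l) / \<epsilon>) (observation \<epsilon> \<beta> z (j, k) / \<epsilon>) = ?t (?v z) (?v z k)"
        unfolding obs[OF k] by (rule t_hat_cong[OF obs])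
      then show ?thesis using j(2) by (simp only: geb_estimator_def split_conv if_False)
    qed
    then have "(geb_estimator N \<rho>\<^sub>0 b\<^sub>0 \<eta> \<epsilon> (observation \<epsilon> \<beta> z) (j, k) - \<beta> (j, k))\<^sup>2 = \<epsilon>\<^sup>2 * (?t (?v z) (?v z k) - ?\<theta> k)\<^sup>2"
      using e by (simp add: power_mult_distrib[symmetric] right_diff_distrib del: restrict_apply)
    then show "ennreal ((geb_estimator N \<rho>\<^sub>0 b\<^sub>0 \<eta> \<epsilon> (observation \<epsilon> \<beta> z) (j, k) - \<beta> (j, k))\<^sup>2) =
        ennreal (\<epsilon>\<^sup>2) * ennreal ((?t (?v z) (?v z k) - ?\<theta> k)\<^sup>2)"
      by (simp only: ennreal_mult zero_le_power2)
  qed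
  also have "\<dots> = (\<integral>\<^sup>+u. ennreal (\<epsilon>\<^sup>2) * ennreal ((?t u (u k) - ?\<theta> k)\<^sup>2) \<partial>obs_law ?n ?\<theta>)"
    by (rule nn_integral_noise_level[OF j(1), where f="\<lambda>u. ennreal (\<epsilon>\<^sup>2) * ennreal ((?t u (u k) - ?\<theta> k)\<^sup>2)"])
       (rule borel_measurable_times_ennreal borel_measurable_const t_hat_measurable[OF k])+
  also have "\<dots> = ennreal (\<epsilon>\<^sup>2) * (\<integral>\<^sup>+u. ennreal ((?t u (u k) - ?\<theta> k)\<^sup>2) \<partial>obs_law ?n ?\<theta>)"
    using t_hat_measurable[OF k] by (intro nn_integral_cmult) (simp only: measurable_cong_sets[OF sets_obs_law refl])
  finally show "(\<integral>\<^sup>+z. ennreal ((geb_estimator N \<rho>\<^sub>0 b\<^sub>0 \<eta> \<epsilon> (observation \<epsilon> \<beta> z) (j, k) - \<beta> (j, k))\<^sup>2) \<partial>noise) =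
      ennreal (\<epsilon>\<^sup>2) * (\<integral>\<^sup>+u. ennreal ((?t u (u k) - ?\<theta> k)\<^sup>2) \<partial>obs_law ?n ?\<theta>)" .
qed

lemma noise_component_integral:
  assumes i: "i \<in> coeff_index" and f: "f \<in> borel_measurable borel"
  shows "(\<integral>\<^sup>+z. f (z i) \<partial>noise) = (\<integral>\<^sup>+x. f x \<partial>gauss 0)"
proof -
  interpret product_prob_space "\<lambda>_. gauss 0" coeff_index
    by (simp add: product_prob_space_def product_prob_space_axioms_def product_sigma_finite_def
        prob_space_imp_sigma_finite prob_space_gauss)
  have d: "distr noise (gauss 0) (\<lambda>z. z i) = gauss 0"
    unfolding noise_def by (rule PiM_component[OF i])
  have "(\<integral>\<^sup>+x. f x \<partial>gauss 0) = (\<integral>\<^sup>+x. f x \<partial>distr noise (gauss 0) (\<lambda>z. z i))" by (simp only: d)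
  also have "\<dots> = (\<integral>\<^sup>+z. f (z i) \<partial>noise)"
    using i f by (intro nn_integral_distr) (auto simp: noise_def)
  finally show ?thesis by simp
qed

lemma separable_level_risk:
  assumes j: "j \<ge> -1" and e: "\<epsilon> > 0" and h: "h j \<in> borel_measurable borel"
  shows "(\<Sum>k=1..level_size j. \<integral>\<^sup>+z. ennreal ((separable_estimator h (observation \<epsilon> \<beta> z) (j, k) - \<beta> (j, k))\<^sup>2) \<partial>noise) =
    ennreal (\<epsilon>\<^sup>2) * separable_risk (level_size j) (\<lambda>l. \<beta> (j, l) / \<epsilon>) (\<lambda>x. h j (\<epsilon> * x) / \<epsilon>)"
  unfolding separable_risk_def sum_distrib_left
proof (rule sum.cong[OF refl])
  fix k assume k: "k \<in> {1..level_size j}"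
  note h[measurable]
  note i = coeff_index_level[OF j k]
  have "(\<integral>\<^sup>+z. ennreal ((separable_estimator h (observation \<epsilon> \<beta> z) (j, k) - \<beta> (j, k))\<^sup>2) \<partial>noise) =
    (\<integral>\<^sup>+z. ennreal ((h j (\<beta> (j, k) + \<epsilon> * z (j, k)) - \<beta> (j, k))\<^sup>2) \<partial>noise)"
    using i by (simp add: separable_estimator_def observation_def)
  also have "\<dots> = (\<integral>\<^sup>+x. ennreal ((h j (\<beta> (j, k) + \<epsilon> * x) - \<beta> (j, k))\<^sup>2) \<partial>gauss 0)"
    by (rule noise_component_integral[OF i]) measurable
  also have "\<dots> = (\<integral>\<^sup>+x. ennreal (\<epsilon>\<^sup>2) * ennreal ((h j (\<epsilon> * (\<beta> (j, k) / \<epsilon> + x)) / \<epsilon> - \<beta> (j, k) / \<epsilon>)\<^sup>2) \<partial>gauss 0)"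
  proof (rule nn_integral_cong)
    fix x
    have "(h j (\<beta> (j, k) + \<epsilon> * x) - \<beta> (j, k))\<^sup>2 = \<epsilon>\<^sup>2 * (h j (\<epsilon> * (\<beta> (j, k) / \<epsilon> + x)) / \<epsilon> - \<beta> (j, k) / \<epsilon>)\<^sup>2"
      using e by (simp add: power_mult_distrib[symmetric] right_diff_distrib distrib_left)
    then show "ennreal ((h j (\<beta> (j, k) + \<epsilon> * x) - \<beta> (j, k))\<^sup>2) =
        ennreal (\<epsilon>\<^sup>2) * ennreal ((h j (\<epsilon> * (\<beta> (j, k) / \<epsilon> + x)) / \<epsilon> - \<beta> (j, k) / \<epsilon>)\<^sup>2)"
      by (simp only: ennreal_mult zero_le_power2)
  qed
  also have "\<dots> = ennreal (\<epsilon>\<^sup>2) * (\<integral>\<^sup>+x. ennreal ((h j (\<epsilon> * (\<beta> (j, k) / \<epsilon> + x)) / \<epsilon> - \<beta> (j, k) / \<epsilon>)\<^sup>2) \<partial>gauss 0)"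
    by (rule nn_integral_cmult) measurable
  also have "(\<integral>\<^sup>+x. ennreal ((h j (\<epsilon> * (\<beta> (j, k) / \<epsilon> + x)) / \<epsilon> - \<beta> (j, k) / \<epsilon>)\<^sup>2) \<partial>gauss 0) =
      (\<integral>\<^sup>+x. ennreal ((h j (\<epsilon> * x) / \<epsilon> - \<beta> (j, k) / \<epsilon>)\<^sup>2) \<partial>gauss (\<beta> (j, k) / \<epsilon>))"
    by (rule nn_integral_gauss_shift[symmetric]) measurable
  finally show "(\<integral>\<^sup>+z. ennreal ((separable_estimator h (observation \<epsilon> \<beta> z) (j, k) - \<beta> (j, k))\<^sup>2) \<partial>noise) =
      ennreal (\<epsilon>\<^sup>2) * (\<integral>\<^sup>+x. ennreal ((h j (\<epsilon> * x) / \<epsilon> - \<beta> (j, k) / \<epsilon>)\<^sup>2) \<partial>gauss (\<beta> (j, k) / \<epsilon>))" .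
qed

text \<open>An untouched level uses the identity as its separable rule, so the unit-noise
  computation applies.\<close>

lemma geb_coarse_level_risk:
  assumes j: "j \<ge> -1" "j < j_star N" and e: "\<epsilon> > 0"
  shows "(\<Sum>k=1..level_size j. \<integral>\<^sup>+z. ennreal ((geb_estimator N \<rho>\<^sub>0 b\<^sub>0 \<eta> \<epsilon> (observation \<epsilon> \<beta> z) (j, k) - \<beta> (j, k))\<^sup>2) \<partial>noise) =
    ennreal (\<epsilon>\<^sup>2 * level_size j)"
proof -
  have "(\<Sum>k=1..level_size j. \<integral>\<^sup>+z. ennreal ((geb_estimator N \<rho>\<^sub>0 b\<^sub>0 \<eta> \<epsilon> (observation \<epsilon> \<beta> z) (j, k) - \<beta> (j, k))\<^sup>2) \<partial>noise) =
    (\<Sum>k=1..level_size j. \<integral>\<^sup>+z. ennreal ((separable_estimator (\<lambda>_ y. y) (observation \<epsilon> \<beta> z) (j, k) - \<beta> (j, k))\<^sup>2) \<partial>noise)"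
    using j by (simp add: geb_estimator_def separable_estimator_def)
  also have "\<dots> = ennreal (\<epsilon>\<^sup>2) * separable_risk (level_size j) (\<lambda>l. \<beta> (j, l) / \<epsilon>) (\<lambda>x. (\<epsilon> * x) / \<epsilon>)"
    by (rule separable_level_risk[OF j(1) e]) simp
  also have "(\<lambda>x. (\<epsilon> * x) / \<epsilon>) = (\<lambda>x. x)" using e by simp
  finally show ?thesis by (simp only: separable_risk_id ennreal_mult zero_le_power2 of_nat_0_le_iff)
qed

subsection \<open>Lower bound for the minimax risk\<close>

text \<open>An arbitrary estimator may use the whole array, so a two-point comparison at coordinate
  \<open>i\<close> has to be made with all other coordinates frozen.\<close>

lemma nn_integral_noise_split:
  assumes i: "i \<in> coeff_index" and F: "F \<in> borel_measurable noise"
  shows "(\<integral>\<^sup>+z. F z \<partial>noise) =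
    (\<integral>\<^sup>+w. (\<integral>\<^sup>+x. F (w(i := x)) \<partial>gauss 0) \<partial>PiM (coeff_index - {i}) (\<lambda>_. gauss 0))"
proof -
  let ?P = "PiM (coeff_index - {i}) (\<lambda>_. gauss 0)"
  interpret G: prob_space "gauss 0" by (rule prob_space_gauss)
  interpret P: prob_space ?P by (intro prob_space_PiM prob_space_gauss)
  interpret pair_sigma_finite "gauss 0" ?P ..
  have ins: "insert i (coeff_index - {i}) = coeff_index" using i by auto
  have noise: "noise = distr (gauss 0 \<Otimes>\<^sub>M ?P) noise (\<lambda>(x, X). X(i := x))"
    unfolding noise_def
    by (rule distr_pair_PiM_eq_PiM[of "coeff_index - {i}" "\<lambda>_. gauss 0" i, OF prob_space_gauss prob_space_gauss, unfolded ins, symmetric])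
  have "(\<lambda>(x, X). X(i := x)) \<in> measurable (gauss 0 \<Otimes>\<^sub>M ?P) (PiM (insert i (coeff_index - {i})) (\<lambda>_. gauss 0))"
    unfolding case_prod_unfold
    by (rule measurable_fun_upd[where J="coeff_index - {i}"]) (simp, (rule measurable_fst measurable_snd)+)
  then have m: "(\<lambda>(x, X). X(i := x)) \<in> measurable (gauss 0 \<Otimes>\<^sub>M ?P) noise"
    unfolding ins noise_def .
  have "(\<integral>\<^sup>+z. F z \<partial>noise) = (\<integral>\<^sup>+z. F z \<partial>distr (gauss 0 \<Otimes>\<^sub>M ?P) noise (\<lambda>(x, X). X(i := x)))"
    by (simp only: noise[symmetric])
  also have "\<dots> = (\<integral>\<^sup>+p. F ((\<lambda>(x, X). X(i := x)) p) \<partial>(gauss 0 \<Otimes>\<^sub>M ?P))"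
    by (rule nn_integral_distr[OF m]) (simp only: measurable_distr_eq1 F)
  also have "\<dots> = (\<integral>\<^sup>+w. (\<integral>\<^sup>+x. F ((\<lambda>(x, X). X(i := x)) (x, w)) \<partial>gauss 0) \<partial>?P)"
    by (rule nn_integral_snd[symmetric]) (rule measurable_compose[OF m F])
  finally show ?thesis by (simp only: split_conv)
qed

lemma observation_measurable: "observation \<epsilon> \<beta> \<in> measurable noise (PiM coeff_index (\<lambda>_. borel))"
  unfolding observation_def
proof (rule measurable_restrict)
  fix i assume "i \<in> coeff_index"
  then have "(\<lambda>z. z i) \<in> measurable noise (gauss 0)"
    unfolding noise_def by (rule measurable_component_singleton)
  then have "(\<lambda>z. z i) \<in> borel_measurable noise" by simp
  then show "(\<lambda>z. \<beta> i + \<epsilon> * z i) \<in> borel_measurable noise"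
    by (intro borel_measurable_add borel_measurable_times borel_measurable_const)
qed

text \<open>On \<open>0 \<le> x \<le> 1\<close> both the density of \<open>N(0, 1)\<close> and that of \<open>N(c, 1)\<close> are at least
  \<open>exp (- 1 / 2) / sqrt (2 * pi)\<close>; the factor \<open>c\<^sup>2 / 2\<close> comes from
  \<open>(d - 0)\<^sup>2 + (d - c)\<^sup>2 \<ge> c\<^sup>2 / 2\<close>.\<close>

definition two_point_const :: "real \<Rightarrow> real" where
  "two_point_const c = exp (- 1 / 2) / sqrt (2 * pi) * (c\<^sup>2 / 2)"

text \<open>With the other coordinates frozen, the two parameters give the laws
  \<open>N(0, 1)\<close> and \<open>N(c, 1)\<close> to the argument of the same function. On the
  unit interval both densities have a common lower bound, and one estimate cannot be close to both
  \<open>0\<close> and \<open>c * \<epsilon>\<close>.\<close>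

lemma two_point_bound:
  assumes i: "i \<in> coeff_index" and c: "0 < c" "c \<le> 1"
    and d: "d \<in> estimators" and \<gamma>: "\<gamma> i = 0"
  shows "ennreal (two_point_const c * \<epsilon>\<^sup>2) \<le>
    (\<integral>\<^sup>+z. ennreal ((d (observation \<epsilon> \<gamma> z) i - \<gamma> i)\<^sup>2) \<partial>noise) +
    (\<integral>\<^sup>+z. ennreal ((d (observation \<epsilon> (\<gamma>(i := c * \<epsilon>)) z) i - (\<gamma>(i := c * \<epsilon>)) i)\<^sup>2) \<partial>noise)"
proof -
  let ?P = "PiM (coeff_index - {i}) (\<lambda>_. gauss 0)"
  interpret G: prob_space "gauss 0" by (rule prob_space_gauss)
  interpret P: prob_space ?P by (intro prob_space_PiM prob_space_gauss)
  \<comment> \<open>The estimate as a function of the scaled observation \<open>x\<close> at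
    \<open>i\<close>. Changing the parameter only shifts \<open>x\<close> by \<open>c\<close>, so
    both risks involve this one function.\<close>
  define D where "D w x = d (\<lambda>l\<in>coeff_index. if l = i then \<epsilon> * x else \<gamma> l + \<epsilon> * w l) i" for w x
  have di: "(\<lambda>y. d y i) \<in> borel_measurable (PiM coeff_index (\<lambda>_. borel))"
    using d i by (simp add: estimators_def)
  have mF: "(\<lambda>z. ennreal ((d (observation \<epsilon> \<beta> z) i - a)\<^sup>2)) \<in> borel_measurable noise" for \<beta> a
    by (intro measurable_compose[OF _ measurable_ennreal] borel_measurable_power borel_measurable_diff
        borel_measurable_const measurable_compose[OF observation_measurable di, of \<epsilon> \<beta>])
  have D0: "d (observation \<epsilon> \<gamma> (w(i := x))) i = D w x" for w x
    unfolding D_def observation_def using \<gamma> by (intro arg_cong2[where f="\<lambda>y i. d y i"]) (auto simp: fun_eq_iff)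
  have D1: "d (observation \<epsilon> (\<gamma>(i := c * \<epsilon>)) (w(i := x))) i = D w (c + x)" for w x
    unfolding D_def observation_def using \<gamma>
    by (intro arg_cong2[where f="\<lambda>y i. d y i"]) (auto simp: fun_eq_iff algebra_simps)
  have mD: "D w \<in> borel_measurable borel" if "w \<in> space ?P" for w
  proof -
    have "(\<lambda>x. \<lambda>l\<in>coeff_index. if l = i then \<epsilon> * x else \<gamma> l + \<epsilon> * w l) \<in> measurable borel (PiM coeff_index (\<lambda>_. borel))"
    proof (rule measurable_restrict)
      fix l
      show "(\<lambda>x. if l = i then \<epsilon> * x else \<gamma> l + \<epsilon> * w l) \<in> borel_measurable borel"
        by (cases "l = i") simp_all
    qed
    from measurable_compose[OF this di] show ?thesis by (simp add: D_def[abs_def])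
  qed
  let ?m = "exp (- 1 / 2) / sqrt (2 * pi)"
  let ?a = "two_point_const c * \<epsilon>\<^sup>2"
  have I1: "(\<integral>\<^sup>+z. ennreal ((d (observation \<epsilon> \<gamma> z) i - \<gamma> i)\<^sup>2) \<partial>noise) = (\<integral>\<^sup>+w. (\<integral>\<^sup>+x. ennreal ((D w x)\<^sup>2) \<partial>gauss 0) \<partial>?P)"
    by (subst nn_integral_noise_split[OF i mF]) (simp only: D0 \<gamma> diff_0_right)
  have I2: "(\<integral>\<^sup>+z. ennreal ((d (observation \<epsilon> (\<gamma>(i := c * \<epsilon>)) z) i - (\<gamma>(i := c * \<epsilon>)) i)\<^sup>2) \<partial>noise) =
      (\<integral>\<^sup>+w. (\<integral>\<^sup>+x. ennreal ((D w (c + x) - c * \<epsilon>)\<^sup>2) \<partial>gauss 0) \<partial>?P)"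
    by (subst nn_integral_noise_split[OF i mF]) (simp only: D1 fun_upd_same)
  have dens: "?m \<le> normal_density b 1 x" if "0 \<le> x" "x \<le> 1" "0 \<le> b" "b \<le> 1" for b x
  proof -
    have "\<bar>x - b\<bar>\<^sup>2 \<le> 1\<^sup>2" using that by (intro power_mono) auto
    then have "exp (- 1 / 2) \<le> exp (- (x - b)\<^sup>2 / 2)" by simp
    then show ?thesis by (simp add: normal_density_def divide_right_mono)
  qed
  have inner: "ennreal ?a \<le> (\<integral>\<^sup>+x. ennreal ((D w x)\<^sup>2) \<partial>gauss 0) + (\<integral>\<^sup>+x. ennreal ((D w (c + x) - c * \<epsilon>)\<^sup>2) \<partial>gauss 0)"
    if w: "w \<in> space ?P" for w
  proof -
    have [measurable]: "D w \<in> borel_measurable borel" by (rule mD[OF w])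
    have "(\<integral>\<^sup>+x. ennreal ((D w (c + x) - c * \<epsilon>)\<^sup>2) \<partial>gauss 0) = (\<integral>\<^sup>+x. ennreal ((D w x - c * \<epsilon>)\<^sup>2) \<partial>gauss c)"
      by (rule nn_integral_gauss_shift[symmetric]) measurable
    also have "\<dots> = (\<integral>\<^sup>+x. ennreal (normal_density c 1 x) * ennreal ((D w x - c * \<epsilon>)\<^sup>2) \<partial>lborel)"
      by (rule nn_integral_gauss) measurable
    finally have J2: "(\<integral>\<^sup>+x. ennreal ((D w (c + x) - c * \<epsilon>)\<^sup>2) \<partial>gauss 0) =
        (\<integral>\<^sup>+x. ennreal (normal_density c 1 x) * ennreal ((D w x - c * \<epsilon>)\<^sup>2) \<partial>lborel)" .
    have J1: "(\<integral>\<^sup>+x. ennreal ((D w x)\<^sup>2) \<partial>gauss 0) = (\<integral>\<^sup>+x. ennreal (normal_density 0 1 x) * ennreal ((D w x)\<^sup>2) \<partial>lborel)"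
      by (rule nn_integral_gauss) measurable
    have "ennreal ?a = (\<integral>\<^sup>+x. ennreal ?a * indicator {0..1::real} x \<partial>lborel)"
      by (subst nn_integral_cmult_indicator) simp_all
    also have "\<dots> \<le> (\<integral>\<^sup>+x. ennreal (normal_density 0 1 x) * ennreal ((D w x)\<^sup>2) + ennreal (normal_density c 1 x) * ennreal ((D w x - c * \<epsilon>)\<^sup>2) \<partial>lborel)"
    proof (rule nn_integral_mono)
      fix x :: real
      show "ennreal ?a * indicator {0..1} x \<le>
          ennreal (normal_density 0 1 x) * ennreal ((D w x)\<^sup>2) + ennreal (normal_density c 1 x) * ennreal ((D w x - c * \<epsilon>)\<^sup>2)"
      proof (cases "x \<in> {0..1}")
        case True
        have "0 \<le> (2 * D w x - c * \<epsilon>)\<^sup>2" by simp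
        then have q: "(c * \<epsilon>)\<^sup>2 / 2 \<le> (D w x)\<^sup>2 + (D w x - c * \<epsilon>)\<^sup>2" by (simp add: power2_eq_square algebra_simps)
        have "?a = ?m * ((c * \<epsilon>)\<^sup>2 / 2)" by (simp add: two_point_const_def power_mult_distrib)
        also have "\<dots> \<le> ?m * ((D w x)\<^sup>2 + (D w x - c * \<epsilon>)\<^sup>2)" using q by (intro mult_left_mono) auto
        also have "\<dots> = ?m * (D w x)\<^sup>2 + ?m * (D w x - c * \<epsilon>)\<^sup>2" by (rule distrib_left)
        also have "\<dots> \<le> normal_density 0 1 x * (D w x)\<^sup>2 + normal_density c 1 x * (D w x - c * \<epsilon>)\<^sup>2"
          using True c by (intro add_mono mult_right_mono dens) auto
        finally have "ennreal ?a \<le> ennreal (normal_density 0 1 x * (D w x)\<^sup>2 + normal_density c 1 x * (D w x - c * \<epsilon>)\<^sup>2)"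
          by (rule ennreal_leI)
        then show ?thesis using True by (simp add: ennreal_mult)
      qed simp
    qed
    also have "\<dots> = (\<integral>\<^sup>+x. ennreal ((D w x)\<^sup>2) \<partial>gauss 0) + (\<integral>\<^sup>+x. ennreal ((D w (c + x) - c * \<epsilon>)\<^sup>2) \<partial>gauss 0)"
      unfolding J1 J2 by (rule nn_integral_add) measurable
    finally show ?thesis .
  qed
  have meas: "(\<lambda>w. \<integral>\<^sup>+x. F (w(i := x)) \<partial>gauss 0) \<in> borel_measurable ?P" if F: "F \<in> borel_measurable noise" for F :: "coeffs \<Rightarrow> ennreal"
  proof -
    have ins: "insert i (coeff_index - {i}) = coeff_index" using i by auto
    have "(\<lambda>p. (fst p)(i := snd p)) \<in> measurable (?P \<Otimes>\<^sub>M gauss 0) (PiM (insert i (coeff_index - {i})) (\<lambda>_. gauss 0))"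
      by (rule measurable_fun_upd[where J="coeff_index - {i}"]) (simp, (rule measurable_fst measurable_snd)+)
    then have "(\<lambda>p. (fst p)(i := snd p)) \<in> measurable (?P \<Otimes>\<^sub>M gauss 0) noise"
      unfolding ins noise_def .
    from measurable_compose[OF this F] have "(\<lambda>(w, x). F (w(i := x))) \<in> borel_measurable (?P \<Otimes>\<^sub>M gauss 0)"
      by (simp add: case_prod_unfold)
    then show ?thesis by (rule G.borel_measurable_nn_integral)
  qed
  have m1: "(\<lambda>w. \<integral>\<^sup>+x. ennreal ((D w x)\<^sup>2) \<partial>gauss 0) \<in> borel_measurable ?P"
    using meas[OF mF[of \<gamma> 0]] by (simp only: D0 diff_0_right)
  have m2: "(\<lambda>w. \<integral>\<^sup>+x. ennreal ((D w (c + x) - c * \<epsilon>)\<^sup>2) \<partial>gauss 0) \<in> borel_measurable ?P"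
    using meas[OF mF[of "\<gamma>(i := c * \<epsilon>)" "c * \<epsilon>"]] by (simp only: D1)
  have "ennreal ?a = (\<integral>\<^sup>+w. ennreal ?a \<partial>?P)" by (simp add: P.emeasure_space_1)
  also have "\<dots> \<le> (\<integral>\<^sup>+w. (\<integral>\<^sup>+x. ennreal ((D w x)\<^sup>2) \<partial>gauss 0) + (\<integral>\<^sup>+x. ennreal ((D w (c + x) - c * \<epsilon>)\<^sup>2) \<partial>gauss 0) \<partial>?P)"
    by (rule nn_integral_mono) (rule inner)
  also have "\<dots> = (\<integral>\<^sup>+w. (\<integral>\<^sup>+x. ennreal ((D w x)\<^sup>2) \<partial>gauss 0) \<partial>?P) + (\<integral>\<^sup>+w. (\<integral>\<^sup>+x. ennreal ((D w (c + x) - c * \<epsilon>)\<^sup>2) \<partial>gauss 0) \<partial>?P)"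
    by (rule nn_integral_add[OF m1 m2])
  finally show ?thesis unfolding I1 I2 .
qed

lemma level_risk_le_risk:
  assumes j: "j \<ge> -1"
  shows "(\<Sum>k=1..level_size j. \<integral>\<^sup>+z. ennreal ((d (observation \<epsilon> \<beta> z) (j, k) - \<beta> (j, k))\<^sup>2) \<partial>noise) \<le> risk \<epsilon> d \<beta>"
proof -
  let ?f = "\<lambda>j. \<Sum>k=1..level_size j. \<integral>\<^sup>+z. ennreal ((d (observation \<epsilon> \<beta> z) (j, k) - \<beta> (j, k))\<^sup>2) \<partial>noise"
  have "infsum ?f {j} \<le> infsum ?f {-1..}"
    by (rule infsum_mono_neutral) (use j in \<open>auto intro: nonneg_summable_on_complete\<close>)
  then show ?thesis unfolding risk_def by simp
qed

definition cube_vertex :: "int \<Rightarrow> real \<Rightarrow> nat set \<Rightarrow> coeffs" where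
  "cube_vertex j a S = (\<lambda>(j', k). if j' = j \<and> k \<in> S then a else 0)"

lemma sum_Pow_insert:
  fixes f :: "'a set \<Rightarrow> 'b :: comm_monoid_add"
  assumes "finite A" "k \<notin> A"
  shows "(\<Sum>S\<in>Pow (insert k A). f S) = (\<Sum>S\<in>Pow A. f S + f (insert k S))"
proof -
  have inj: "inj_on (insert k) (Pow A)" using assms(2) by (auto simp: inj_on_def)
  have "(\<Sum>S\<in>Pow (insert k A). f S) = (\<Sum>S\<in>Pow A. f S) + (\<Sum>S\<in>insert k ` Pow A. f S)"
    unfolding Pow_insert using assms by (intro sum.union_disjoint) auto
  also have "(\<Sum>S\<in>insert k ` Pow A. f S) = (\<Sum>S\<in>Pow A. f (insert k S))"
    by (rule sum.reindex_cong[OF inj]) auto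
  finally show ?thesis by (simp add: sum.distrib)
qed

text \<open>The supremum is at least the average over the vertices. For each coordinate the vertices
  split into pairs that differ only there, half as many pairs as vertices, and every pair costs at
  least \<open>?a\<close>. This explains the factor 1/2.\<close>

lemma minimax_risk_ge_cube:
  assumes j: "j \<ge> 0" and c: "0 < c" "c \<le> 1"
    and B: "\<And>S. S \<subseteq> {1..level_size j} \<Longrightarrow> cube_vertex j (c * \<epsilon>) S \<in> B"
  shows "ennreal (level_size j * (two_point_const c * \<epsilon>\<^sup>2 / 2)) \<le> minimax_risk \<epsilon> B"
  unfolding minimax_risk_def
proof (rule INF_greatest)
  fix d assume d: "d \<in> estimators"
  let ?n = "level_size j"
  let ?v = "cube_vertex j (c * \<epsilon>)"
  let ?a = "two_point_const c * \<epsilon>\<^sup>2"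
  have a0: "?a \<ge> 0" by (simp add: two_point_const_def)
  define r where "r S k = (\<integral>\<^sup>+z. ennreal ((d (observation \<epsilon> (?v S) z) (j, k) - ?v S (j, k))\<^sup>2) \<partial>noise)" for S k
  define X where "X = (SUP \<beta>\<in>B. risk \<epsilon> d \<beta>)"
  have n1: "?n \<ge> 1" by (simp add: level_size_def)
  have up: "(\<Sum>k=1..?n. r S k) \<le> X" if "S \<in> Pow {1..?n}" for S
  proof -
    have "(\<Sum>k=1..?n. r S k) \<le> risk \<epsilon> d (?v S)"
      unfolding r_def using j by (intro level_risk_le_risk) auto
    also have "\<dots> \<le> X" unfolding X_def using B that by (intro SUP_upper) auto
    finally show ?thesis .
  qed
  have pair: "ennreal ?a \<le> r S k + r (insert k S) k" if k: "k \<in> {1..?n}" and S: "k \<notin> S" for S k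
  proof -
    have "?v (insert k S) = (?v S)((j, k) := c * \<epsilon>)" "?v S (j, k) = 0"
      using S by (auto simp: cube_vertex_def fun_eq_iff)
    moreover have "(j, k) \<in> coeff_index" using k j by (intro coeff_index_level) auto
    ultimately show ?thesis
      unfolding r_def using two_point_bound[OF _ c d, of "(j, k)" "?v S"] by simp
  qed
  have half: "ennreal (2 ^ (?n - 1) * ?a) \<le> (\<Sum>S\<in>Pow {1..?n}. r S k)" if k: "k \<in> {1..?n}" for k
  proof -
    let ?A = "{1..?n} - {k}"
    have ins: "{1..?n} = insert k ?A" using k by auto
    have "ennreal (2 ^ (?n - 1) * ?a) = (\<Sum>S\<in>Pow ?A. ennreal ?a)"
    proof -
      have "(\<Sum>S\<in>Pow ?A. ennreal ?a) = of_nat (2 ^ (?n - 1)) * ennreal ?a"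
        using k by (simp only: sum_constant card_Pow finite_Diff finite_atLeastAtMost card_Diff_singleton card_atLeastAtMost) simp
      also have "\<dots> = ennreal (2 ^ (?n - 1) * ?a)"
        using a0 by (simp only: ennreal_of_nat_eq_real_of_nat of_nat_power of_nat_numeral ennreal_mult zero_le_power zero_le_numeral)
      finally show ?thesis by simp
    qed
    also have "\<dots> \<le> (\<Sum>S\<in>Pow ?A. r S k + r (insert k S) k)"
      using k by (intro sum_mono pair) auto
    also have "\<dots> = (\<Sum>S\<in>Pow (insert k ?A). r S k)"
      by (rule sum_Pow_insert[symmetric]) auto
    finally show ?thesis using ins by simp
  qed
  have "ennreal (2 ^ ?n) * ennreal (?n * (?a / 2)) = (\<Sum>k=1..?n. ennreal (2 ^ (?n - 1) * ?a))"
  proof -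
    have "(2::real) ^ ?n = 2 * 2 ^ (?n - 1)" using n1 by (cases ?n) auto
    then have "2 ^ ?n * (?n * (?a / 2)) = ?n * (2 ^ (?n - 1) * ?a)" by simp
    moreover have "ennreal (2 ^ ?n) * ennreal (?n * (?a / 2)) = ennreal (2 ^ ?n * (?n * (?a / 2)))"
      using a0 by (intro ennreal_mult[symmetric]) auto
    moreover have "ennreal (?n * (2 ^ (?n - 1) * ?a)) = (\<Sum>k=1..?n. ennreal (2 ^ (?n - 1) * ?a))"
      using a0 by (subst ennreal_mult) (simp_all only: sum_constant card_atLeastAtMost ennreal_of_nat_eq_real_of_nat, simp_all)
    ultimately show ?thesis by (simp only:)
  qed
  also have "\<dots> \<le> (\<Sum>k=1..?n. \<Sum>S\<in>Pow {1..?n}. r S k)"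
    by (intro sum_mono half)
  also have "\<dots> = (\<Sum>S\<in>Pow {1..?n}. \<Sum>k=1..?n. r S k)" by (rule sum.swap)
  also have "\<dots> \<le> (\<Sum>S\<in>Pow {1..?n}. X)" by (intro sum_mono up)
  also have "\<dots> = ennreal (2 ^ ?n) * X"
    by (simp only: sum_constant card_Pow finite_atLeastAtMost card_atLeastAtMost diff_Suc_1
        ennreal_of_nat_eq_real_of_nat of_nat_power of_nat_numeral)
  finally show "ennreal (?n * (?a / 2)) \<le> X"
    by (subst (asm) ennreal_mult_le_mult_iff) auto
qed

lemma infsum_levels_le:
  fixes f :: "int \<Rightarrow> ennreal" and g :: "nat \<Rightarrow> real"
  assumes a: "f (-1) \<le> ennreal a" "0 \<le> a" and g: "\<And>i. f (int i) \<le> ennreal (g i)" "\<And>i. 0 \<le> g i" "summable g"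
  shows "infsum f {-1..} \<le> ennreal (a + suminf g)"
proof (rule infsum_le_finite_sums)
  show "f summable_on {-1..}" by (rule nonneg_summable_on_complete) simp
  fix F :: "int set" assume F: "finite F" "F \<subseteq> {-1..}"
  define G where "G = F - {-1}"
  have G: "finite G" "G \<subseteq> {0..}" using F by (auto simp: G_def)
  have inj: "inj_on nat G" using G by (intro inj_onI) (metis atLeast_iff eq_nat_nat_iff subsetD)
  have "sum f F \<le> sum f (insert (-1) G)"
    using F by (intro sum_mono2) (auto simp: G_def)
  also have "\<dots> = f (-1) + sum f G" using G by (intro sum.insert) (auto simp: G_def)
  also have "sum f G = (\<Sum>i\<in>nat ` G. f (int i))"
    using G by (subst sum.reindex[OF inj]) (auto intro!: sum.cong)
  also have "\<dots> \<le> (\<Sum>i\<in>nat ` G. ennreal (g i))" by (intro sum_mono g)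
  also have "\<dots> = ennreal (\<Sum>i\<in>nat ` G. g i)" using g by (intro sum_ennreal) auto
  also have "\<dots> \<le> ennreal (suminf g)"
    using G g by (intro ennreal_leI sum_le_suminf) auto
  also have "f (-1) + ennreal (suminf g) \<le> ennreal a + ennreal (suminf g)"
    using a by (intro add_right_mono)
  also have "\<dots> = ennreal (a + suminf g)"
    using a suminf_nonneg[OF g(3,2)] by (intro ennreal_plus[symmetric]) auto
  finally show "sum f F \<le> ennreal (a + suminf g)" by (simp add: add_left_mono)
qed

subsection \<open>Besov balls\<close>

lemma ennreal_powr_ennreal: "x \<ge> 0 \<Longrightarrow> ennreal_powr (ennreal x) r = ennreal (x powr r)"
  by (simp add: ennreal_powr_def)

lemma ennreal_powr_mono: "x \<le> y \<Longrightarrow> 0 < r \<Longrightarrow> ennreal_powr x r \<le> ennreal_powr y r"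
proof (cases "y = \<infinity>")
  case False
  assume le: "x \<le> y" and r: "0 < r"
  have "x \<noteq> \<infinity>" using le False by (auto simp: top_unique)
  moreover have "enn2real x \<le> enn2real y" using le False by (intro enn2real_mono) (auto simp: top.not_eq_extremum)
  ultimately show ?thesis using False r by (simp add: ennreal_powr_def ennreal_leI powr_mono2)
qed (simp add: ennreal_powr_def)

lemma ennreal_powr_inverse: "0 < r \<Longrightarrow> ennreal_powr (ennreal_powr x r) (1 / r) = x"
  by (cases x) (auto simp: ennreal_powr_def powr_powr)

lemma enn2real_pos_exponent: "0 < p \<Longrightarrow> p \<noteq> \<infinity> \<Longrightarrow> 0 < enn2real p"
  by (cases p) auto

lemma lp_norm_ge:
  assumes p: "0 < p" and i: "i \<in> A"
  shows "f i \<le> lp_norm p A f"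
proof (cases "p = \<infinity>")
  case True
  then show ?thesis using i by (simp add: lp_norm_def SUP_upper)
next
  case False
  let ?r = "enn2real p"
  have r: "?r > 0" using p False by (rule enn2real_pos_exponent)
  have "infsum (\<lambda>i. ennreal_powr (f i) ?r) {i} \<le> infsum (\<lambda>i. ennreal_powr (f i) ?r) A"
    by (rule infsum_mono_neutral) (use i in \<open>auto intro: nonneg_summable_on_complete\<close>)
  then have "ennreal_powr (ennreal_powr (f i) ?r) (1 / ?r) \<le> ennreal_powr (infsum (\<lambda>i. ennreal_powr (f i) ?r) A) (1 / ?r)"
    using r by (intro ennreal_powr_mono) auto
  then show ?thesis using False by (simp add: lp_norm_def ennreal_powr_inverse[OF r])
qed

lemma lp_norm_single:
  assumes p: "0 < p" and i: "i \<in> A" and z: "\<And>k. k \<in> A \<Longrightarrow> k \<noteq> i \<Longrightarrow> f k = 0"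
  shows "lp_norm p A f = f i"
proof (cases "p = \<infinity>")
  case True
  have "(SUP k\<in>A. f k) = f i"
  proof (rule antisym)
    show "(SUP k\<in>A. f k) \<le> f i" using z by (intro SUP_least) (metis order_refl zero_le)
  qed (use i in \<open>rule SUP_upper\<close>)
  then show ?thesis using True by (simp add: lp_norm_def)
next
  case False
  let ?r = "enn2real p"
  have r: "?r > 0" using p False by (rule enn2real_pos_exponent)
  have "infsum (\<lambda>i. ennreal_powr (f i) ?r) A = infsum (\<lambda>i. ennreal_powr (f i) ?r) {i}"
    using i z r by (intro infsum_cong_neutral) (auto simp: ennreal_powr_def)
  then show ?thesis using False by (simp add: lp_norm_def ennreal_powr_inverse[OF r])
qed

lemma lp_norm_finite:
  assumes "finite A" "p \<noteq> \<infinity>" "\<And>k. k \<in> A \<Longrightarrow> 0 \<le> x k"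
  shows "lp_norm p A (\<lambda>k. ennreal (x k)) = ennreal ((\<Sum>k\<in>A. x k powr enn2real p) powr (1 / enn2real p))"
proof -
  have "(\<Sum>\<^sub>\<infinity>k\<in>A. ennreal_powr (ennreal (x k)) (enn2real p)) = (\<Sum>k\<in>A. ennreal (x k powr enn2real p))"
    using assms by (simp add: ennreal_powr_ennreal)
  also have "\<dots> = ennreal (\<Sum>k\<in>A. x k powr enn2real p)" by (rule sum_ennreal) simp
  finally show ?thesis
    using assms(2) by (simp add: lp_norm_def ennreal_powr_ennreal sum_nonneg)
qed

lemma enn2real_one_divide: "p \<noteq> \<infinity> \<Longrightarrow> 0 < p \<Longrightarrow> enn2real (1 / p) = 1 / enn2real p"
  by (cases p) (auto simp: divide_ennreal simp flip: ennreal_1)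

lemma level_size_powr: "j \<ge> 0 \<Longrightarrow> real (level_size j) = 2 powr real_of_int j"
  by (simp add: level_size_def flip: powr_realpow)

lemma besov_ball_level:
  assumes \<beta>: "\<beta> \<in> besov_ball \<alpha> p q C" and q: "0 < q" and j: "j \<ge> 0"
  shows "lp_norm p {1..level_size j} (\<lambda>k. ennreal \<bar>\<beta> (j, k)\<bar>) \<le>
    ennreal (C * 2 powr (- (real_of_int j * (\<alpha> + 1/2 - enn2real (1 / p)))))"
proof -
  let ?e = "real_of_int j * (\<alpha> + 1/2 - enn2real (1 / p))"
  let ?X = "lp_norm p {1..level_size j} (\<lambda>k. ennreal \<bar>\<beta> (j, k)\<bar>)"
  have "ennreal (2 powr ?e) * ?X \<le> besov_norm \<alpha> p q \<beta>"
    unfolding besov_norm_def using lp_norm_ge[OF q, of j "{-1..}" "\<lambda>j. if j = -1 then ennreal \<bar>\<beta> (-1, 1)\<bar>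
     else ennreal (2 powr (real_of_int j * (\<alpha> + 1/2 - enn2real (1 / p))))
            * lp_norm p {1..level_size j} (\<lambda>k. ennreal \<bar>\<beta> (j, k)\<bar>)"] j by simp
  also have "\<dots> \<le> ennreal C" using \<beta> by (simp add: besov_ball_def)
  finally have "ennreal (2 powr (- ?e)) * (ennreal (2 powr ?e) * ?X) \<le> ennreal (2 powr (- ?e)) * ennreal C"
    by (rule mult_left_mono) simp
  moreover have "ennreal (2 powr (- ?e)) * (ennreal (2 powr ?e) * ?X) = ?X"
    unfolding mult.assoc[symmetric] by (simp add: powr_minus flip: ennreal_mult)
  moreover have "ennreal (2 powr (- ?e)) * ennreal C = ennreal (C * 2 powr (- ?e))"
    by (simp add: ennreal_mult'' mult.commute)
  ultimately show ?thesis by simp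
qed

lemma besov_ball_father:
  assumes \<beta>: "\<beta> \<in> besov_ball \<alpha> p q C" and q: "0 < q" and C: "0 < C"
  shows "\<bar>\<beta> (-1, 1)\<bar> \<le> C"
proof -
  have "ennreal \<bar>\<beta> (-1, 1)\<bar> \<le> besov_norm \<alpha> p q \<beta>"
    unfolding besov_norm_def using lp_norm_ge[OF q, of "-1" "{-1..}" "\<lambda>j. if j = -1 then ennreal \<bar>\<beta> (-1, 1)\<bar>
     else ennreal (2 powr (real_of_int j * (\<alpha> + 1/2 - enn2real (1 / p))))
            * lp_norm p {1..level_size j} (\<lambda>k. ennreal \<bar>\<beta> (j, k)\<bar>)"] by simp
  also have "\<dots> \<le> ennreal C" using \<beta> by (simp add: besov_ball_def)
  finally show ?thesis using C by simp
qed

text \<open>\<open>m\<close> is the size that a coefficient has when the energy of its level is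
  spread evenly. For \<open>s \<le> P\<close> one has
  \<open>x powr s \<le> m powr s * (1 + (x / m) powr P)\<close>; summed over the level, each of the
  two terms gives at most \<open>m powr s\<close> times the level size, hence the factor 2.\<close>

lemma besov_ball_moment:
  assumes \<beta>: "\<beta> \<in> besov_ball \<alpha> p q C" and q: "0 < q" and C: "0 < C" and j: "j \<ge> 0"
    and s: "0 < s" "ennreal s \<le> p"
  shows "(\<Sum>k=1..level_size j. \<bar>\<beta> (j, k)\<bar> powr s) \<le> 2 * C powr s * 2 powr (real_of_int j * (1 - s * (\<alpha> + 1/2)))"
proof -
  let ?n = "level_size j"
  define m where "m = C * 2 powr (- (real_of_int j * (\<alpha> + 1/2)))"
  have m: "m > 0" using C by (simp add: m_def)
  have p0: "0 < p" using s by (auto intro: less_le_trans[of 0 "ennreal s"])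
  have n: "real ?n = 2 powr real_of_int j" using j by (rule level_size_powr)
  have pt: "x powr s \<le> m powr s * (1 + (x / m) powr P)" if "0 \<le> x" "s \<le> P" for x P
  proof -
    have "(x / m) powr s \<le> 1 + (x / m) powr P"
    proof (cases "x / m \<le> 1")
      case True
      then have "(x / m) powr s \<le> 1 powr s" using that m s by (intro powr_mono2) auto
      then show ?thesis by (simp add: add_increasing2)
    next
      case False
      then have "(x / m) powr s \<le> (x / m) powr P" using that by (intro powr_mono) auto
      then show ?thesis by simp
    qed
    then have "m powr s * (x / m) powr s \<le> m powr s * (1 + (x / m) powr P)" by (intro mult_left_mono) auto
    moreover have "m powr s * (x / m) powr s = x powr s"
      using m that by (simp add: powr_mult[symmetric])
    ultimately show ?thesis by simp
  qed
  have "(\<Sum>k=1..?n. \<bar>\<beta> (j, k)\<bar> powr s) \<le> 2 * (m powr s * ?n)"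
  proof (cases "p = \<infinity>")
    case True
    have "\<bar>\<beta> (j, k)\<bar> powr s \<le> 2 * m powr s" if k: "k \<in> {1..?n}" for k
    proof -
      have "ennreal \<bar>\<beta> (j, k)\<bar> \<le> ennreal m"
        using order_trans[OF lp_norm_ge[OF p0 k, of "\<lambda>k. ennreal \<bar>\<beta> (j, k)\<bar>"] besov_ball_level[OF \<beta> q j]] True
        by (simp add: m_def)
      then have "\<bar>\<beta> (j, k)\<bar> \<le> m" using m by simp
      then have "\<bar>\<beta> (j, k)\<bar> powr s \<le> m powr s" using s by (intro powr_mono2) auto
      then show ?thesis using powr_ge_zero[of m s] by linarith
    qed
    then have "(\<Sum>k=1..?n. \<bar>\<beta> (j, k)\<bar> powr s) \<le> (\<Sum>k=1..?n. 2 * m powr s)" by (rule sum_mono)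
    then show ?thesis by (simp add: mult_ac)
  next
    case False
    define P where "P = enn2real p"
    have P: "P > 0" unfolding P_def using p0 False by (rule enn2real_pos_exponent)
    have pP: "p = ennreal P" using False by (simp add: P_def less_top)
    have sP: "s \<le> P" using s(2) P unfolding pP by simp
    let ?S = "\<Sum>k=1..?n. \<bar>\<beta> (j, k)\<bar> powr P"
    have S0: "?S \<ge> 0" by (intro sum_nonneg) auto
    have "ennreal (?S powr (1 / P)) \<le> ennreal (C * 2 powr (- (real_of_int j * (\<alpha> + 1/2 - 1 / P))))"
      using besov_ball_level[OF \<beta> q j] lp_norm_finite[of "{1..?n}" p "\<lambda>k. \<bar>\<beta> (j, k)\<bar>"] False p0
      by (simp add: enn2real_one_divide P_def)
    then have "?S powr (1 / P) \<le> C * 2 powr (- (real_of_int j * (\<alpha> + 1/2 - 1 / P)))"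
      using C by (subst (asm) ennreal_le_iff) auto
    also have "\<dots> = m * 2 powr (real_of_int j / P)"
    proof -
      have "- (real_of_int j * (\<alpha> + 1/2 - 1 / P)) = - (real_of_int j * (\<alpha> + 1/2)) + real_of_int j / P"
        by (simp add: algebra_simps)
      then show ?thesis by (simp only: m_def powr_add mult.assoc)
    qed
    finally have "(?S powr (1 / P)) powr P \<le> (m * 2 powr (real_of_int j / P)) powr P"
      using P by (intro powr_mono2) auto
    then have S: "?S \<le> m powr P * ?n"
      using P S0 m by (simp add: powr_powr powr_mult n)
    have "(\<Sum>k=1..?n. \<bar>\<beta> (j, k)\<bar> powr s) \<le> (\<Sum>k=1..?n. m powr s * (1 + (\<bar>\<beta> (j, k)\<bar> / m) powr P))"
      using sP by (intro sum_mono pt) auto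
    also have "\<dots> = m powr s * (?n + ?S / m powr P)"
      using m by (simp add: sum_distrib_left[symmetric] sum.distrib powr_divide sum_divide_distrib[symmetric])
    also have "\<dots> \<le> m powr s * (?n + ?n)"
      using S m by (intro mult_left_mono add_left_mono) (auto simp: divide_le_eq mult.commute)
    finally show ?thesis by simp
  qed
  also have "m powr s * ?n = C powr s * 2 powr (real_of_int j * (1 - s * (\<alpha> + 1/2)))"
  proof -
    have "m powr s = C powr s * 2 powr (- (real_of_int j * (\<alpha> + 1/2)) * s)"
      using C by (simp add: m_def powr_mult powr_powr)
    then have "m powr s * ?n = C powr s * 2 powr (- (real_of_int j * (\<alpha> + 1/2)) * s + real_of_int j)"
      unfolding n by (simp only: powr_add mult.assoc)
    also have "- (real_of_int j * (\<alpha> + 1/2)) * s + real_of_int j = real_of_int j * (1 - s * (\<alpha> + 1/2))"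
      by (simp add: algebra_simps)
    finally show ?thesis .
  qed
  finally show ?thesis by simp
qed


text \<open>Only one level is nonzero, so \<open>q\<close> has no influence; for coefficients
  bounded by \<open>a\<close> the powers of 2 that contain \<open>p\<close> cancel.\<close>

lemma cube_vertex_in_besov_ball:
  assumes q: "0 < q" and p: "0 < p" and j: "j \<ge> 0" and a: "0 \<le> a" and C: "0 < C"
    and le: "a * 2 powr (real_of_int j * (\<alpha> + 1/2)) \<le> C"
  shows "cube_vertex j a S \<in> besov_ball \<alpha> p q C"
proof -
  let ?\<beta> = "cube_vertex j a S"
  let ?n = "level_size j"
  have n: "real ?n = 2 powr real_of_int j" using j by (rule level_size_powr)
  let ?X = "\<lambda>j'. lp_norm p {1..level_size j'} (\<lambda>k. ennreal \<bar>?\<beta> (j', k)\<bar>)"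
  have zero: "?X j' = 0" if "j' \<noteq> j" for j'
  proof -
    have "lp_norm p {1..level_size j'} (\<lambda>k. 0) = (0 :: ennreal)"
      using p lp_norm_single[OF p, of 1 "{1..level_size j'}" "\<lambda>k. 0"] by (simp add: level_size_def)
    then show ?thesis using that by (simp add: cube_vertex_def)
  qed
  have b: "\<bar>?\<beta> (j, k)\<bar> \<le> a" for k using a by (simp add: cube_vertex_def)
  have X: "?X j \<le> ennreal (a * 2 powr (real_of_int j * enn2real (1 / p)))"
  proof (cases "p = \<infinity>")
    case True
    then show ?thesis using b by (auto simp: lp_norm_def intro!: SUP_least ennreal_leI)
  next
    case False
    define P where "P = enn2real p"
    have P: "P > 0" unfolding P_def using p False by (rule enn2real_pos_exponent)
    have "(\<Sum>k=1..?n. \<bar>?\<beta> (j, k)\<bar> powr P) \<le> (\<Sum>k=1..?n. a powr P)"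
      using b P by (intro sum_mono powr_mono2) auto
    also have "\<dots> = 2 powr real_of_int j * a powr P" by (simp add: n)
    finally have "(\<Sum>k=1..?n. \<bar>?\<beta> (j, k)\<bar> powr P) powr (1 / P) \<le> (2 powr real_of_int j * a powr P) powr (1 / P)"
      using P by (intro powr_mono2) (auto intro!: sum_nonneg)
    also have "\<dots> = a * 2 powr (real_of_int j * (1 / P))"
      using P a by (simp add: powr_mult powr_powr)
    finally show ?thesis
      using lp_norm_finite[of "{1..?n}" p "\<lambda>k. \<bar>?\<beta> (j, k)\<bar>"] False p
      by (simp add: enn2real_one_divide P_def ennreal_leI)
  qed
  let ?g = "\<lambda>j'. if j' = -1 then ennreal \<bar>?\<beta> (-1, 1)\<bar>
     else ennreal (2 powr (real_of_int j' * (\<alpha> + 1/2 - enn2real (1 / p)))) * ?X j'"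
  have "besov_norm \<alpha> p q ?\<beta> = ?g j"
    unfolding besov_norm_def
  proof (rule lp_norm_single[OF q])
    show "j \<in> {-1..}" using j by simp
    show "?g k = 0" if "k \<in> {-1..}" "k \<noteq> j" for k
      using that zero[OF that(2)] by (simp add: cube_vertex_def)
  qed
  also have "\<dots> = ennreal (2 powr (real_of_int j * (\<alpha> + 1/2 - enn2real (1 / p)))) * ?X j"
    using j by simp
  also have "\<dots> \<le> ennreal (2 powr (real_of_int j * (\<alpha> + 1/2 - enn2real (1 / p)))) * ennreal (a * 2 powr (real_of_int j * enn2real (1 / p)))"
    by (intro mult_left_mono X) simp
  also have "\<dots> = ennreal (2 powr (real_of_int j * (\<alpha> + 1/2 - enn2real (1 / p))) * (a * 2 powr (real_of_int j * enn2real (1 / p))))"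
    using a by (intro ennreal_mult[symmetric]) auto
  also have "2 powr (real_of_int j * (\<alpha> + 1/2 - enn2real (1 / p))) * (a * 2 powr (real_of_int j * enn2real (1 / p))) = a * 2 powr (real_of_int j * (\<alpha> + 1/2))"
  proof -
    have "real_of_int j * (\<alpha> + 1/2) = real_of_int j * (\<alpha> + 1/2 - enn2real (1 / p)) + real_of_int j * enn2real (1 / p)"
      by (simp add: algebra_simps)
    then show ?thesis by (simp only: powr_add mult_ac)
  qed
  also have "ennreal \<dots> \<le> ennreal C" using le by (rule ennreal_leI)
  finally show ?thesis by (simp add: besov_ball_def)
qed

text \<open>The bound makes the ideal and the minimax risk finite, so that they can be subtracted
  and divided by later. The moment of order \<open>s\<close> decays geometrically and also bounds
  each single coefficient, and \<open>s < 2\<close> allows writing the square as a bounded power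
  times the power \<open>s\<close>.\<close>

lemma besov_ball_zero_risk:
  assumes q: "0 < q" and C: "0 < C" and s: "0 < s" "s < 2" "ennreal s \<le> p" "s * (\<alpha> + 1/2) > 1"
  shows "\<exists>R. \<forall>\<epsilon> > 0. \<forall>\<beta> \<in> besov_ball \<alpha> p q C. risk \<epsilon> (separable_estimator (\<lambda>_ _. 0)) \<beta> \<le> ennreal R"
proof -
  define \<delta> where "\<delta> = s * (\<alpha> + 1/2) - 1"
  have \<delta>: "\<delta> > 0" using s by (simp add: \<delta>_def)
  define D where "D = 2 * C powr s"
  have D: "D > 0" using C by (simp add: D_def)
  define g where "g i = D * D powr ((2 - s) / s) * (2 powr (- \<delta>)) ^ i" for i :: nat
  have g: "\<And>i. 0 \<le> g i" "summable g"
    using D \<delta> unfolding g_def by (auto intro!: summable_mult summable_geometric simp: powr_less_one)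
  have "risk \<epsilon> (separable_estimator (\<lambda>_ _. 0)) \<beta> \<le> ennreal (C\<^sup>2 + suminf g)" if \<beta>: "\<beta> \<in> besov_ball \<alpha> p q C" for \<epsilon> \<beta>
  proof -
    have r: "risk \<epsilon> (separable_estimator (\<lambda>_ _. 0)) \<beta> = (\<Sum>\<^sub>\<infinity>j\<in>{-1..}. \<Sum>k=1..level_size j. ennreal ((\<beta> (j, k))\<^sup>2))"
      unfolding risk_def separable_estimator_def by (simp add: prob_space.emeasure_space_1[OF prob_space_noise])
    show ?thesis
      unfolding r
    proof (rule infsum_levels_le)
      have "\<bar>\<beta> (-1, 1)\<bar>\<^sup>2 \<le> C\<^sup>2" using besov_ball_father[OF \<beta> q C] by (intro power_mono) auto
      then show "(\<Sum>k=1..level_size (-1). ennreal ((\<beta> (-1, k))\<^sup>2)) \<le> ennreal (C\<^sup>2)"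
        by (simp add: level_size_def ennreal_leI)
      fix i :: nat
      let ?n = "level_size (int i)"
      let ?b = "\<lambda>k. \<bar>\<beta> (int i, k)\<bar>"
      have S: "(\<Sum>k=1..?n. ?b k powr s) \<le> D * (2 powr (- \<delta>)) ^ i"
        using besov_ball_moment[OF \<beta> q C _ s(1,3), of "int i"]
        by (simp add: D_def \<delta>_def powr_realpow[symmetric] powr_powr mult.commute)
      have "(\<Sum>k=1..?n. (\<beta> (int i, k))\<^sup>2) \<le> (\<Sum>k=1..?n. D powr ((2 - s) / s) * ?b k powr s)"
      proof (rule sum_mono)
        fix k assume k: "k \<in> {1..?n}"
        have "?b k powr s \<le> (\<Sum>k=1..?n. ?b k powr s)" using k by (intro member_le_sum) auto
        also have "\<dots> \<le> D * 1"
          using \<delta> D powr_mono[of "- \<delta>" 0 2] by (intro order_trans[OF S] mult_left_mono power_le_one) auto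
        finally have "(?b k powr s) powr ((2 - s) / s) \<le> D powr ((2 - s) / s)"
          using s by (intro powr_mono2) auto
        then have "?b k powr (2 - s) \<le> D powr ((2 - s) / s)" using s by (simp add: powr_powr)
        then have "?b k powr (2 - s) * ?b k powr s \<le> D powr ((2 - s) / s) * ?b k powr s"
          by (rule mult_right_mono) simp
        moreover have "?b k powr (2 - s) * ?b k powr s = (\<beta> (int i, k))\<^sup>2"
          by (cases "\<beta> (int i, k) = 0") (simp_all add: powr_add[symmetric])
        ultimately show "(\<beta> (int i, k))\<^sup>2 \<le> D powr ((2 - s) / s) * ?b k powr s" by simp
      qed
      also have "\<dots> \<le> D powr ((2 - s) / s) * (D * (2 powr (- \<delta>)) ^ i)"
        unfolding sum_distrib_left[symmetric] using S by (intro mult_left_mono) auto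
      also have "\<dots> = g i" by (simp add: g_def)
      finally show "(\<Sum>k=1..?n. ennreal ((\<beta> (int i, k))\<^sup>2)) \<le> ennreal (g i)"
        by (subst sum_ennreal) (auto intro: ennreal_leI)
    qed (use g in auto)
  qed
  then show ?thesis by blast
qed

subsection \<open>Excess risk of a level\<close>

lemma clipped_energy_le_moment:
  assumes "0 < s" "s \<le> 2"
  shows "clipped_energy n \<theta> \<le> (\<Sum>k=1..n. \<bar>\<theta> k\<bar> powr s)"
  unfolding clipped_energy_def
proof (rule sum_mono)
  fix k
  show "min ((\<theta> k)\<^sup>2) 1 \<le> \<bar>\<theta> k\<bar> powr s"
  proof (cases "\<bar>\<theta> k\<bar> \<le> 1")
    case True
    have "\<bar>\<theta> k\<bar> powr 2 = (\<theta> k)\<^sup>2" by (cases "\<theta> k = 0") simp_all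
    moreover have "\<bar>\<theta> k\<bar> powr 2 \<le> \<bar>\<theta> k\<bar> powr s"
      using True assms by (intro powr_mono') auto
    ultimately have "(\<theta> k)\<^sup>2 \<le> \<bar>\<theta> k\<bar> powr s" by (simp only:)
    then show ?thesis by simp
  next
    case False
    then have "1 \<le> \<bar>\<theta> k\<bar> powr s" using assms by (intro ge_one_powr_ge_zero) auto
    then show ?thesis by simp
  qed
qed

text \<open>Markov's inequality for the moment of order \<open>s\<close>.\<close>

lemma card_large_le_moment:
  fixes n :: nat
  assumes "0 < s" "0 < M"
  shows "card {k\<in>{1..n}. \<bar>\<theta> k\<bar> > M} \<le> (\<Sum>k=1..n. \<bar>\<theta> k\<bar> powr s) * M powr (- s)"
proof -
  have "card {k\<in>{1..n}. \<bar>\<theta> k\<bar> > M} * M powr s = (\<Sum>k\<in>{k\<in>{1..n}. \<bar>\<theta> k\<bar> > M}. M powr s)" by simp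
  also have "\<dots> \<le> (\<Sum>k\<in>{k\<in>{1..n}. \<bar>\<theta> k\<bar> > M}. \<bar>\<theta> k\<bar> powr s)"
    using assms by (intro sum_mono powr_mono2) auto
  also have "\<dots> \<le> (\<Sum>k=1..n. \<bar>\<theta> k\<bar> powr s)" by (intro sum_mono2) auto
  finally show ?thesis using assms by (simp add: powr_minus field_simps)
qed

text \<open>The number of large means is bounded both by \<open>n\<close> and by a moment.
  Interpolating between the two yields decay in \<open>n\<close> together with a power of
  \<open>T\<close> below 1.\<close>

lemma min_le_geometric_mean:
  fixes a b l :: real
  assumes "0 \<le> a" "0 \<le> b" "0 < l" "l < 1"
  shows "min a b \<le> a powr l * b powr (1 - l)"
proof -
  define m where "m = min a b"
  have m: "0 \<le> m" "m \<le> a" "m \<le> b" using assms by (auto simp: m_def)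
  have "m = m powr l * m powr (1 - l)" using m by (cases "m = 0") (simp_all add: powr_add[symmetric])
  also have "\<dots> \<le> a powr l * b powr (1 - l)" using m assms by (intro mult_mono powr_mono2) auto
  finally show ?thesis by (simp add: m_def)
qed

text \<open>The exponents in the next lemma are tuned so that, with \<open>n\<close> the size of the level, the
  oracle bound beats \<open>T\<close> as long as \<open>n \<le> T powr (2 - \<xi>)\<close>, whereas for larger \<open>n\<close> the energy of
  the level lies below the detection boundary \<open>sqrt n\<close>.\<close>

lemma level_excess_exists:
  fixes \<rho>\<^sub>0 b\<^sub>0 s \<delta> D :: real
  assumes rb: "\<rho>\<^sub>0 > 0" "b\<^sub>0 > 0" and eta: "\<eta> \<longlonglongrightarrow> 0" and rho: "\<forall>n\<ge>2. geb_rho \<rho>\<^sub>0 \<eta> n > 0"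
    and s: "0 < s" "s \<le> 2" and \<delta>: "\<delta> > 0" and D: "D > 0"
  shows "\<exists>A a c T0. 0 < A \<and> 0 \<le> a \<and> a < 1 \<and> 0 < c \<and> 1 \<le> T0 \<and> (\<forall>T\<ge>T0. \<forall>i\<ge>1. \<forall>\<theta>. \<forall>h\<in>borel_measurable borel.
    (\<Sum>k=1..2 ^ i. \<bar>\<theta> k\<bar> powr s) \<le> D * T powr (1 + \<delta>) * (2 ^ i) powr (- \<delta>) \<longrightarrow>
    level_risk (geb_rho \<rho>\<^sub>0 \<eta>) (geb_b b\<^sub>0) (2 ^ i) \<theta> \<le> separable_risk (2 ^ i) \<theta> h +
      ennreal (A * (T powr a * (2 ^ i) powr (- c) + real i powr (- 3 / 2))))"
proof -
  \<comment> \<open>In the exponent, \<open>2 - \<xi>\<close> is the midpoint between 2, where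
    \<open>sqrt n\<close> reaches \<open>T\<close>, and
    \<open>(2 + 2 * \<delta>) / (2 * \<delta> + 1)\<close>, where the moment bound meets
    \<open>sqrt n\<close>.\<close>
  define \<xi> where "\<xi> = \<delta> / (2 * \<delta> + 1)"
  have \<xi>: "0 < \<xi>" "\<xi> < 1 / 2" using \<delta> by (simp_all add: \<xi>_def divide_less_eq)
  define \<tau> where "\<tau> = \<xi> / 16"
  define m where "m = s * \<tau> / 2"
  have m: "0 < m" "m \<le> \<tau>" using s \<xi> by (simp_all add: m_def \<tau>_def)
  \<comment> \<open>Chosen so that \<open>l - (\<delta> + 2 * m) * (1 - l) = - 2 * t\<close>: the
    interpolated count still decays like \<open>n powr (- t)\<close> after multiplication by
    \<open>n powr t\<close>.\<close>
  define l where "l = (\<delta> + m) / (1 + \<delta> + m)"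
  have l: "0 < l" "l < 1" "1 - l = 1 / (1 + \<delta> + m)" using \<delta> m by (simp_all add: l_def field_simps)
  define t where "t = (m / 2) / (1 + \<delta> + m)"
  have t: "0 < t" "t \<le> m / 2"
    unfolding t_def using m \<delta> by (simp_all add: divide_le_eq mult_left_le mult_le_cancel_left1)
  have t1: "t \<le> 1" using t m \<xi> by (simp add: \<tau>_def)
  define u where "u = \<delta> / 8"
  have u: "u > 0" using \<delta> by (simp add: u_def)
  define c where "c = min t u"
  have c: "c > 0" "c \<le> t" "c \<le> u" using t u by (simp_all add: c_def)
  \<comment> \<open>The exponents of \<open>T\<close> in the three contributions: the
    \<open>sqrt n\<close> term, the number of large means, and the energy of a thresholded
    level.\<close>
  define a1 a2 a3 where "a1 = (2 - \<xi>) * (1 / 2 + \<tau> + 2 * t)" and "a2 = (1 + \<delta>) * (1 - l)"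
    and "a3 = 1 + \<delta> + (2 - \<xi>) * (- \<delta> + 2 * u)"
  have a1: "a1 < 1"
  proof -
    have "\<tau> + 2 * t \<le> 2 * \<tau>" using t m by simp
    then have "(2 - \<xi>) * (\<tau> + 2 * t) \<le> 2 * (2 * \<tau>)" using \<xi> t m by (intro mult_mono) auto
    then have "a1 \<le> (2 - \<xi>) / 2 + 4 * \<tau>" by (simp add: a1_def algebra_simps)
    also have "\<dots> < 1" using \<xi> by (simp add: \<tau>_def field_simps)
    finally show ?thesis .
  qed
  have a2: "a2 < 1" using m \<delta> by (simp add: a2_def l(3))
  have a3: "a3 < 1"
  proof -
    have "(2 - \<xi>) * (- \<delta> + 2 * u) = - ((2 - \<xi>) * (3 / 4 * \<delta>))" by (simp add: u_def algebra_simps)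
    moreover have "(3 / 2) * (3 / 4 * \<delta>) \<le> (2 - \<xi>) * (3 / 4 * \<delta>)" using \<xi> \<delta> by (intro mult_right_mono) auto
    ultimately show ?thesis using \<delta> by (simp add: a3_def)
  qed
  define a where "a = max 0 (max a1 (max a2 a3))"
  have a: "0 \<le> a" "a < 1" "a1 \<le> a" "a2 \<le> a" "a3 \<le> a" using a1 a2 a3 by (auto simp: a_def)
  have tau: "\<tau> > 0" using \<xi> by (simp add: \<tau>_def)
  obtain A1 where A1: "A1 > 0" "\<forall>n\<ge>2. \<forall>\<theta>. \<forall>h\<in>borel_measurable borel.
    level_risk (geb_rho \<rho>\<^sub>0 \<eta>) (geb_b b\<^sub>0) n \<theta> \<le> separable_risk n \<theta> h +
      ennreal (A1 * real n powr t * (real n powr (1/2 + \<tau>) + card {k\<in>{1..n}. \<bar>\<theta> k\<bar> > real n powr \<tau>}))"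
    using geb_level_oracle[OF rb eta rho t(1) t1 tau] by blast
  obtain A2 where A2: "A2 > 0" "\<forall>n\<ge>2. \<forall>\<theta>. clipped_energy n \<theta> \<le> b\<^sub>0 / 2 * ln n * sqrt n \<longrightarrow>
    level_risk (geb_rho \<rho>\<^sub>0 \<eta>) (geb_b b\<^sub>0) n \<theta> \<le>
      ennreal (A2 * (1 / (sqrt (ln n)) ^ 3 + ln n * clipped_energy n \<theta> + 1 / n))"
    using geb_level_sparse[OF rb eta rho] by blast
  define D2 where "D2 = D powr (1 - l)"
  have D2: "D2 > 0" using D by (simp add: D2_def)
  \<comment> \<open>For \<open>T \<ge> T0\<close> one gets
    \<open>D * T powr (- \<delta> / 2) \<le> b\<^sub>0 / 2 * ln 2\<close>, which puts the energy of
    every fine level below the detection boundary.\<close>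
  define B where "B = b\<^sub>0 / 2 * ln 2 / D"
  have B: "B > 0" using rb D by (simp add: B_def)
  define T0 where "T0 = max 1 (B powr (- 2 / \<delta>))"
  define A where "A = max (A1 * (1 + D2)) (A2 * (D / u + 10))"
  have Age: "A1 * (1 + D2) \<le> A" "A2 * (D / u + 10) \<le> A" by (simp_all add: A_def)
  have A0: "A > 0" using A1(1) D2 by (intro less_le_trans[OF _ Age(1)]) auto
  have main: "level_risk (geb_rho \<rho>\<^sub>0 \<eta>) (geb_b b\<^sub>0) (2 ^ i) \<theta> \<le> separable_risk (2 ^ i) \<theta> h +
      ennreal (A * (T powr a * (2 ^ i) powr (- c) + real i powr (- 3 / 2)))"
    if T: "T \<ge> T0" and i: "i \<ge> 1" and h: "h \<in> borel_measurable borel"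
      and S: "(\<Sum>k=1..2 ^ i. \<bar>\<theta> k\<bar> powr s) \<le> D * T powr (1 + \<delta>) * (2 ^ i) powr (- \<delta>)" for T i \<theta> h
  proof -
    define n :: nat where "n = 2 ^ i"
    obtain i' where i': "i = Suc i'" using i by (cases i) auto
    then have n2: "n \<ge> 2" by (simp add: n_def)
    define x where "x = real n"
    have "real 2 \<le> x" unfolding x_def using n2 by (rule of_nat_mono)
    then have x: "x \<ge> 2" "x = 2 ^ i" by (simp_all add: x_def n_def)
    have T1: "T \<ge> 1" "B powr (- 2 / \<delta>) \<le> T" using T by (simp_all add: T0_def)
    have lnx: "ln x = i * ln 2" using x by (simp add: ln_realpow)
    have Ta: "T powr e \<le> T powr a" if "e \<le> a" for e using T1 that by (intro powr_mono) auto
    have xc: "x powr (- e) \<le> x powr (- c)" if "c \<le> e" for e using x that by (intro powr_mono) auto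
    have ip: "0 \<le> real i powr (- 3 / 2)" by simp
    define V where "V = (\<Sum>k=1..n. \<bar>\<theta> k\<bar> powr s)"
    have V: "0 \<le> V" "V \<le> D * T powr (1 + \<delta>) * x powr (- \<delta>)"
      using S by (auto simp: V_def n_def x(2) intro!: sum_nonneg)
    have TP: "0 \<le> T powr a * x powr (- c)" by simp
    show ?thesis
    proof (cases "x \<le> T powr (2 - \<xi>)")
      case True
      define N where "N = real (card {k\<in>{1..n}. \<bar>\<theta> k\<bar> > x powr \<tau>})"
      have N: "0 \<le> N" "N \<le> x" "N \<le> V * x powr (- 2 * m)"
      proof -
        have "card {k\<in>{1..n}. \<bar>\<theta> k\<bar> > x powr \<tau>} \<le> card {1..n}" by (intro card_mono) auto
        then show "N \<le> x" by (simp add: N_def x_def)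
        have "N \<le> V * (x powr \<tau>) powr (- s)"
          unfolding N_def V_def using x s by (intro card_large_le_moment) auto
        then show "N \<le> V * x powr (- 2 * m)" by (simp add: powr_powr m_def mult.commute)
      qed (simp add: N_def)
      have e1: "x powr t * x powr (1 / 2 + \<tau>) \<le> T powr a * x powr (- c)"
      proof -
        have "x powr t * x powr (1 / 2 + \<tau>) = x powr (1 / 2 + \<tau> + 2 * t) * x powr (- t)"
          by (simp add: powr_add[symmetric])
        also have "\<dots> \<le> (T powr (2 - \<xi>)) powr (1 / 2 + \<tau> + 2 * t) * x powr (- t)"
          using True x t \<xi> m by (intro mult_right_mono powr_mono2) auto
        also have "\<dots> = T powr a1 * x powr (- t)" by (simp add: powr_powr a1_def)
        also have "\<dots> \<le> T powr a * x powr (- c)" using Ta[OF a(3)] xc[OF c(2)] by (intro mult_mono) auto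
        finally show ?thesis .
      qed
      have e2: "x powr t * N \<le> D2 * (T powr a * x powr (- c))"
      proof -
        have "N \<le> min x (V * x powr (- 2 * m))" using N by simp
        also have "\<dots> \<le> x powr l * (V * x powr (- 2 * m)) powr (1 - l)"
          using x V l(1,2) by (intro min_le_geometric_mean) auto
        also have "\<dots> \<le> x powr l * ((D * T powr (1 + \<delta>) * x powr (- \<delta>)) * x powr (- 2 * m)) powr (1 - l)"
          using V l(1,2) by (intro mult_left_mono powr_mono2 mult_right_mono) auto
        also have "(D * T powr (1 + \<delta>) * x powr (- \<delta>)) * x powr (- 2 * m) = D * T powr (1 + \<delta>) * x powr (- \<delta> - 2 * m)"
          by (simp add: powr_add[symmetric] mult.assoc)
        also have "x powr l * (D * T powr (1 + \<delta>) * x powr (- \<delta> - 2 * m)) powr (1 - l) =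
            D2 * T powr a2 * x powr (l + (- \<delta> - 2 * m) * (1 - l))"
        proof -
          have "(D * T powr (1 + \<delta>) * x powr e) powr (1 - l) = D2 * T powr a2 * x powr (e * (1 - l))" for e
            using D by (simp add: powr_mult powr_powr D2_def a2_def)
          then show ?thesis by (simp only: powr_add mult_ac)
        qed
        finally have "x powr t * N \<le> x powr t * (D2 * T powr a2 * x powr (l + (- \<delta> - 2 * m) * (1 - l)))"
          by (intro mult_left_mono) auto
        also have "\<dots> = D2 * (T powr a2 * x powr (t + (l + (- \<delta> - 2 * m) * (1 - l))))"
          by (simp add: powr_add)
        also have "t + (l + (- \<delta> - 2 * m) * (1 - l)) = - t"
        proof -
          define r where "r = 1 / (1 + \<delta> + m)"
          have r: "t = m / 2 * r" "l = (\<delta> + m) * r" "1 - l = r"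
            unfolding l(3) by (simp_all add: t_def l_def r_def)
          have "t + (l + (- \<delta> - 2 * m) * (1 - l)) = m / 2 * r + ((\<delta> + m) * r + (- \<delta> - 2 * m) * r)"
            unfolding r(3) by (simp only: r(1,2))
          also have "\<dots> = - t" unfolding r(1) by (simp add: algebra_simps)
          finally show ?thesis .
        qed
        also have "D2 * (T powr a2 * x powr (- t)) \<le> D2 * (T powr a * x powr (- c))"
          using Ta[OF a(4)] xc[OF c(2)] D2 by (intro mult_left_mono mult_mono) auto
        finally show ?thesis .
      qed
      have "A1 * x powr t * (x powr (1/2 + \<tau>) + N) = A1 * (x powr t * x powr (1/2 + \<tau>) + x powr t * N)"
        by (simp add: algebra_simps)
      also have "\<dots> \<le> A1 * (T powr a * x powr (- c) + D2 * (T powr a * x powr (- c)))"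
        using e1 e2 A1(1) by (intro mult_left_mono add_mono) auto
      also have "\<dots> = A1 * (1 + D2) * (T powr a * x powr (- c))" by (simp add: algebra_simps)
      also have "\<dots> \<le> A * (T powr a * x powr (- c))" using Age(1) by (intro mult_right_mono) auto
      also have "\<dots> \<le> A * (T powr a * x powr (- c) + real i powr (- 3 / 2))" using A0 ip by (intro mult_left_mono) auto
      finally have fin: "A1 * x powr t * (x powr (1/2 + \<tau>) + N) \<le> A * (T powr a * x powr (- c) + real i powr (- 3 / 2))" .
      have "level_risk (geb_rho \<rho>\<^sub>0 \<eta>) (geb_b b\<^sub>0) n \<theta> \<le> separable_risk n \<theta> h + ennreal (A1 * x powr t * (x powr (1/2 + \<tau>) + N))"
        unfolding x_def N_def by (rule A1(2)[rule_format, OF n2 h])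
      also have "\<dots> \<le> separable_risk n \<theta> h + ennreal (A * (T powr a * x powr (- c) + real i powr (- 3 / 2)))"
        by (intro add_left_mono ennreal_leI fin)
      finally show ?thesis unfolding x(2) n_def .
    next
      case False
      then have big: "T powr (2 - \<xi>) \<le> x" by simp
      have neg: "x powr (- e) \<le> T powr (- (2 - \<xi>) * e)" if "e \<ge> 0" for e
      proof -
        have "x powr (- e) \<le> (T powr (2 - \<xi>)) powr (- e)"
          using big T1 that x by (intro powr_mono2') auto
        then show ?thesis unfolding powr_powr by (simp only: mult_minus_left mult_minus_right)
      qed
      have CE: "clipped_energy n \<theta> \<le> V" unfolding V_def using s by (intro clipped_energy_le_moment) auto
      have sq: "sqrt x = x powr (1 / 2)" using x by (simp add: powr_half_sqrt)
      have "V \<le> D * T powr (1 + \<delta>) * x powr (- \<delta>)" by (rule V(2))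
      also have "\<dots> = D * T powr (1 + \<delta>) * x powr (- (\<delta> + 1 / 2)) * sqrt x"
        unfolding sq by (simp add: mult.assoc powr_add[symmetric])
      also have "\<dots> \<le> D * T powr (1 + \<delta>) * T powr (- (2 - \<xi>) * (\<delta> + 1 / 2)) * sqrt x"
        using neg[of "\<delta> + 1 / 2"] D \<delta> x by (intro mult_right_mono mult_left_mono) auto
      also have "\<dots> = D * T powr (- \<delta> / 2) * sqrt x"
      proof -
        have "(2 * \<delta> + 1) * \<xi> = \<delta>" using \<delta> by (simp add: \<xi>_def)
        moreover have "(2 - \<xi>) * (\<delta> + 1 / 2) = (2 * \<delta> + 1) - ((2 * \<delta> + 1) * \<xi>) / 2"
          by (simp add: field_simps)
        ultimately have "(2 - \<xi>) * (\<delta> + 1 / 2) = (2 * \<delta> + 1) - \<delta> / 2" by (simp only:)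
        then have "1 + \<delta> + (- (2 - \<xi>) * (\<delta> + 1 / 2)) = - \<delta> / 2" unfolding mult_minus_left by simp
        then have "T powr (1 + \<delta>) * T powr (- (2 - \<xi>) * (\<delta> + 1 / 2)) = T powr (- \<delta> / 2)"
          by (simp only: powr_add[symmetric])
        then show ?thesis by (simp only: mult.assoc)
      qed
      also have "\<dots> \<le> D * B * sqrt x"
      proof -
        have "T powr (- \<delta> / 2) \<le> (B powr (- 2 / \<delta>)) powr (- \<delta> / 2)"
          using T1 \<delta> B by (intro powr_mono2') auto
        also have "\<dots> = B" using \<delta> B by (simp add: powr_powr)
        finally show ?thesis using D x by (intro mult_right_mono mult_left_mono) auto
      qed
      also have "D * B = b\<^sub>0 / 2 * ln 2" using D by (simp add: B_def)
      also have "b\<^sub>0 / 2 * ln 2 * sqrt x \<le> b\<^sub>0 / 2 * ln x * sqrt x"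
        using rb x by (intro mult_right_mono mult_left_mono) auto
      finally have sparse: "clipped_energy n \<theta> \<le> b\<^sub>0 / 2 * ln n * sqrt n" using CE by (simp add: x_def)
      \<comment> \<open>Since \<open>ln x = i * ln 2\<close>, the pure-noise cost of thresholding is
        summable in \<open>i\<close>. The 8 comes from the generous bound
        \<open>ln 2 \<ge> 1 / 4\<close>.\<close>
      have q1: "1 / (sqrt (ln x)) ^ 3 \<le> 8 * real i powr (- 3 / 2)"
      proof -
        have "1 / 4 * i \<le> ln x" unfolding lnx using ln2_ge_two_thirds i by simp
        then have "sqrt (1 / 4 * i) \<le> sqrt (ln x)" by (rule real_sqrt_le_mono)
        then have "(1 / 2 * sqrt i) ^ 3 \<le> (sqrt (ln x)) ^ 3" by (intro power_mono) (auto simp: real_sqrt_mult real_sqrt_divide)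
        then have "1 / (sqrt (ln x)) ^ 3 \<le> 1 / (1 / 2 * sqrt i) ^ 3" using i lnx by (intro divide_left_mono) (auto intro!: mult_pos_pos zero_less_power)
        also have "\<dots> = 8 * (sqrt i powr (- 3))" using i by (simp add: powr_minus powr_numeral power_mult_distrib power_divide field_simps)
        also have "sqrt i powr (- 3) = real i powr (- 3 / 2)" using i by (simp add: powr_half_sqrt[symmetric] powr_powr)
        finally show ?thesis .
      qed
      have q3: "1 / x \<le> 2 * real i powr (- 3 / 2)"
      proof -
        have "real i powr (3 / 2) \<le> real i powr 2" using i by (intro powr_mono) auto
        also have "\<dots> = real i ^ 2" using i by simp
        also have "\<dots> \<le> 2 * 2 ^ i"
        proof -
          have "real j ^ 2 \<le> 2 * 2 ^ j" for j :: nat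
          proof (cases "j \<le> 3")
            case True
            then have "j = 0 \<or> j = 1 \<or> j = 2 \<or> j = 3" by auto
            then show ?thesis by auto
          next
            case False
            then have "4 \<le> j" by simp
            then show ?thesis
            proof (induction j rule: dec_induct)
              case (step k)
              have "real (Suc k) ^ 2 = real k ^ 2 + 2 * real k + 1" by (simp add: power2_eq_square algebra_simps)
              also have "\<dots> \<le> 2 * real k ^ 2"
              proof -
                have "4 * real k \<le> real k * real k" using step(1) by (intro mult_right_mono) auto
                moreover have "4 \<le> real k" using step(1) by simp
                ultimately show ?thesis unfolding power2_eq_square by linarith
              qed
              also have "\<dots> \<le> 2 * (2 * 2 ^ k)" using step by simp
              finally show ?case by simp
            qed simp
          qed
          then show ?thesis .
        qed
        finally have "real i powr (3 / 2) \<le> 2 * x" by (simp add: x(2))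
        moreover have "0 < real i powr (3 / 2)" "0 < x" using i x(1) by simp_all
        ultimately have "1 / x \<le> 2 / real i powr (3 / 2)" by (simp add: divide_simps)
        also have "\<dots> = 2 * real i powr (- (3 / 2))" unfolding powr_minus divide_inverse ..
        finally show ?thesis by simp
      qed
      \<comment> \<open>One factor \<open>x powr u\<close> absorbs the logarithm, and a second one
        is set aside as decay in the level.\<close>
      have q2: "ln x * V \<le> D / u * (T powr a * x powr (- c))"
      proof -
        have "ln x \<le> x powr u / u" using x(1) u by (intro ln_powr_bound) auto
        then have "ln x * V \<le> (x powr u / u) * (D * T powr (1 + \<delta>) * x powr (- \<delta>))"
          using V u x(1) by (intro mult_mono) auto
        also have "\<dots> = D / u * (T powr (1 + \<delta>) * (x powr u * x powr (- \<delta>)))" by simp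
        also have "x powr u * x powr (- \<delta>) = x powr (- (\<delta> - 2 * u)) * x powr (- u)"
          unfolding powr_add[symmetric] by simp
        also have "D / u * (T powr (1 + \<delta>) * (x powr (- (\<delta> - 2 * u)) * x powr (- u))) =
            D / u * (T powr (1 + \<delta>) * x powr (- (\<delta> - 2 * u)) * x powr (- u))" by (simp only: mult.assoc)
        also have "\<dots> \<le> D / u * (T powr (1 + \<delta>) * T powr (- (2 - \<xi>) * (\<delta> - 2 * u)) * x powr (- u))"
          using neg[of "\<delta> - 2 * u"] D u by (intro mult_left_mono mult_right_mono) (auto simp: u_def)
        also have "T powr (1 + \<delta>) * T powr (- (2 - \<xi>) * (\<delta> - 2 * u)) = T powr a3"
        proof -
          have "1 + \<delta> + (- (2 - \<xi>) * (\<delta> - 2 * u)) = a3" by (simp add: a3_def algebra_simps)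
          then show ?thesis by (simp only: powr_add[symmetric])
        qed
        also have "D / u * (T powr a3 * x powr (- u)) \<le> D / u * (T powr a * x powr (- c))"
          using Ta[OF a(5)] xc[OF c(3)] D u by (intro mult_left_mono mult_mono) auto
        finally show ?thesis .
      qed
      have "ln x * clipped_energy n \<theta> \<le> ln x * V" using CE x(1) by (intro mult_left_mono) auto
      with q1 q2 q3 have "1 / (sqrt (ln x)) ^ 3 + ln x * clipped_energy n \<theta> + 1 / x \<le>
          D / u * (T powr a * x powr (- c)) + 10 * real i powr (- 3 / 2)" by linarith
      also have "\<dots> \<le> (D / u + 10) * (T powr a * x powr (- c)) + (D / u + 10) * real i powr (- 3 / 2)"
        using D u TP ip by (intro add_mono mult_right_mono) auto
      also have "\<dots> = (D / u + 10) * (T powr a * x powr (- c) + real i powr (- 3 / 2))" by (simp only: distrib_left)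
      finally have "A2 * (1 / (sqrt (ln x)) ^ 3 + ln x * clipped_energy n \<theta> + 1 / x) \<le>
          A2 * ((D / u + 10) * (T powr a * x powr (- c) + real i powr (- 3 / 2)))"
        using A2(1) by (intro mult_left_mono) auto
      also have "\<dots> \<le> A * (T powr a * x powr (- c) + real i powr (- 3 / 2))"
        unfolding mult.assoc[symmetric] using Age(2) TP ip by (intro mult_right_mono) auto
      finally have fin: "A2 * (1 / (sqrt (ln x)) ^ 3 + ln x * clipped_energy n \<theta> + 1 / x) \<le> A * (T powr a * x powr (- c) + real i powr (- 3 / 2))" .
      have "level_risk (geb_rho \<rho>\<^sub>0 \<eta>) (geb_b b\<^sub>0) n \<theta> \<le> ennreal (A2 * (1 / (sqrt (ln x)) ^ 3 + ln x * clipped_energy n \<theta> + 1 / x))"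
        unfolding x_def by (rule A2(2)[rule_format, OF n2 sparse])
      also have "\<dots> \<le> ennreal (A * (T powr a * x powr (- c) + real i powr (- 3 / 2)))"
        by (rule ennreal_leI[OF fin])
      also have "\<dots> \<le> separable_risk n \<theta> h + \<dots>" by (simp add: add_increasing)
      finally show ?thesis unfolding x(2) n_def .
    qed
  qed
  show ?thesis
    by (intro exI[of _ A] exI[of _ a] exI[of _ c] exI[of _ T0] conjI allI ballI impI A0 a c(1) main)
       (simp_all add: T0_def)
qed

subsection \<open>Excess risk over a Besov ball\<close>

text \<open>Consequently every level handled by \<open>t_hat\<close> has at least two coefficients,
  so that \<open>ln n\<close> is positive there.\<close>

lemma j_star_ge_1:
  assumes "N > 2"
  shows "j_star N \<ge> 1"
proof -
  have iff: "2 powi j \<le> N \<longleftrightarrow> j \<le> \<lfloor>log 2 N\<rfloor>" for j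
  proof -
    have "2 powi j \<le> N \<longleftrightarrow> 2 powr real_of_int j \<le> N" by (simp add: powr_real_of_int')
    also have "\<dots> \<longleftrightarrow> real_of_int j \<le> log 2 N" using assms by (simp add: le_log_iff)
    also have "\<dots> \<longleftrightarrow> j \<le> \<lfloor>log 2 N\<rfloor>" by (simp add: le_floor_iff)
    finally show ?thesis .
  qed
  have "j_star N = \<lfloor>log 2 N\<rfloor>"
    unfolding j_star_def iff by (rule Greatest_equality) auto
  moreover have "1 \<le> log 2 N" using assms by (simp add: le_log_iff)
  ultimately show ?thesis by (simp add: le_floor_iff)
qed

lemma level_size_int: "level_size (int i) = 2 ^ i"
  by (simp add: level_size_def)

text \<open>The comparison is made with a fixed separable rule, level by level, and the infimum is
  taken at the end. \<open>K1\<close> collects the errors that do not involve \<open>T\<close>,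
  \<open>K2\<close> those that grow like \<open>T powr a\<close>.\<close>

lemma geb_excess_risk:
  fixes \<rho>\<^sub>0 b\<^sub>0 s \<alpha> C N :: real
  assumes N: "N > 2" and rb: "\<rho>\<^sub>0 > 0" "b\<^sub>0 > 0" and eta: "\<eta> \<longlonglongrightarrow> 0" and rho: "\<forall>n\<ge>2. geb_rho \<rho>\<^sub>0 \<eta> n > 0"
    and q: "0 < q" and C: "0 < C" and s: "0 < s" "s < 2" "ennreal s \<le> p" "s * (\<alpha> + 1/2) > 1" and \<alpha>: "0 < \<alpha>"
  shows "\<exists>K1 K2 a T0. 0 \<le> K1 \<and> 0 \<le> K2 \<and> 0 \<le> a \<and> a < 1 \<and> 1 \<le> T0 \<and>
    (\<forall>\<epsilon>>0. T0 \<le> \<epsilon> powr (- (1 / (\<alpha> + 1/2))) \<longrightarrow> (\<forall>\<beta>\<in>besov_ball \<alpha> p q C.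
      risk \<epsilon> (geb_estimator N \<rho>\<^sub>0 b\<^sub>0 \<eta> \<epsilon>) \<beta> \<le> ideal_risk \<epsilon> \<beta> +
        ennreal (\<epsilon>\<^sup>2 * (K1 + K2 * (\<epsilon> powr (- (1 / (\<alpha> + 1/2)))) powr a))))"
proof -
  define \<delta> where "\<delta> = s * (\<alpha> + 1/2) - 1"
  have \<delta>: "\<delta> > 0" using s by (simp add: \<delta>_def)
  define D where "D = 2 * C powr s"
  have D: "D > 0" using C by (simp add: D_def)
  obtain A a c T0 where A: "0 < A" "0 \<le> a" "a < 1" "0 < c" "1 \<le> T0" and
    excess: "\<forall>T\<ge>T0. \<forall>i\<ge>1. \<forall>\<theta>. \<forall>h\<in>borel_measurable borel.
    (\<Sum>k=1..2 ^ i. \<bar>\<theta> k\<bar> powr s) \<le> D * T powr (1 + \<delta>) * (2 ^ i) powr (- \<delta>) \<longrightarrow>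
    level_risk (geb_rho \<rho>\<^sub>0 \<eta>) (geb_b b\<^sub>0) (2 ^ i) \<theta> \<le> separable_risk (2 ^ i) \<theta> h +
      ennreal (A * (T powr a * (2 ^ i) powr (- c) + real i powr (- 3 / 2)))"
    using level_excess_exists[OF rb eta rho s(1) less_imp_le[OF s(2)] \<delta> D] by blast
  \<comment> \<open>\<open>g0\<close> charges the finitely many untouched levels with their whole
    risk; the other two are the level errors, one geometric and one a convergent power
    series.\<close>
  define g0 g1 g2 :: "nat \<Rightarrow> real" where "g0 i = (if i < nat (j_star N) then 2 ^ i else 0)"
    and "g1 i = (2 ^ i) powr (- c)" and "g2 i = real i powr (- 3 / 2)" for i
  have nn: "0 \<le> g0 i" "0 \<le> g1 i" "0 \<le> g2 i" for i by (simp_all add: g0_def g1_def g2_def)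
  have s0: "summable g0" by (rule summable_finite[of "{..<nat (j_star N)}"]) (auto simp: g0_def)
  have "g1 = (\<lambda>i. (2 powr (- c)) ^ i)"
    by (simp add: g1_def fun_eq_iff powr_realpow[symmetric] powr_powr mult.commute)
  then have s1: "summable g1"
    using A(4) by (auto intro!: summable_geometric simp: powr_less_one)
  have s2: "summable g2" unfolding g2_def by (subst summable_real_powr_iff) simp
  define G0 G1 G2 where "G0 = suminf g0" and "G1 = suminf g1" and "G2 = suminf g2"
  have G: "0 \<le> G0" "0 \<le> G1" "0 \<le> G2"
    unfolding G0_def G1_def G2_def using s0 s1 s2 nn by (auto intro!: suminf_nonneg)
  have main: "risk \<epsilon> (geb_estimator N \<rho>\<^sub>0 b\<^sub>0 \<eta> \<epsilon>) \<beta> \<le> ideal_risk \<epsilon> \<beta> +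
        ennreal (\<epsilon>\<^sup>2 * ((1 + G0 + A * G2) + (A * G1) * T powr a))"
    if e: "\<epsilon> > 0" and T: "T = \<epsilon> powr (- (1 / (\<alpha> + 1/2)))" "T0 \<le> T" and \<beta>: "\<beta> \<in> besov_ball \<alpha> p q C" for \<epsilon> T \<beta>
  proof -
    let ?d = "geb_estimator N \<rho>\<^sub>0 b\<^sub>0 \<eta> \<epsilon>"
    let ?r = "\<lambda>d j. \<Sum>k=1..level_size j. \<integral>\<^sup>+z. ennreal ((d (observation \<epsilon> \<beta> z) (j, k) - \<beta> (j, k))\<^sup>2) \<partial>noise"
    define g where "g i = \<epsilon>\<^sup>2 * (g0 i + A * (T powr a * g1 i + g2 i))" for i
    have g0': "0 \<le> g i" for i using nn A by (simp add: g_def)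
    have gs: "g sums (\<epsilon>\<^sup>2 * (G0 + A * (T powr a * G1 + G2)))"
      unfolding g_def G0_def G1_def G2_def
      by (intro sums_mult sums_add summable_sums s0 s1 s2)
    define E where "E = ennreal (\<epsilon>\<^sup>2 * ((1 + G0 + A * G2) + (A * G1) * T powr a))"
    define ex where "ex j = (if j = -1 then ennreal (\<epsilon>\<^sup>2) else ennreal (g (nat j)))" for j :: int
    have sum_ex: "infsum ex {-1..} \<le> E"
    proof -
      have "infsum ex {-1..} \<le> ennreal (\<epsilon>\<^sup>2 + suminf g)"
        by (rule infsum_levels_le) (use g0' gs in \<open>auto simp: ex_def sums_iff\<close>)
      also have "\<epsilon>\<^sup>2 + suminf g = \<epsilon>\<^sup>2 * ((1 + G0 + A * G2) + (A * G1) * T powr a)"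
        using gs by (simp add: sums_iff algebra_simps)
      finally show ?thesis by (simp add: E_def)
    qed
    \<comment> \<open>Because \<open>1 + \<delta> = s * (\<alpha> + 1/2)\<close>, this power of
      \<open>T\<close> is the factor created by dividing the coefficients by
      \<open>\<epsilon>\<close>.\<close>
    have Ts: "T powr (1 + \<delta>) = \<epsilon> powr (- s)"
    proof -
      have "- (1 / (\<alpha> + 1/2)) * (1 + \<delta>) = - s" using \<alpha> by (simp add: \<delta>_def)
      then show ?thesis unfolding T(1) powr_powr by (simp only:)
    qed
    have moment: "(\<Sum>k=1..2 ^ i. \<bar>\<beta> (int i, k) / \<epsilon>\<bar> powr s) \<le> D * T powr (1 + \<delta>) * (2 ^ i) powr (- \<delta>)" for i
    proof -
      have "(\<Sum>k=1..2 ^ i. \<bar>\<beta> (int i, k) / \<epsilon>\<bar> powr s) = (\<Sum>k=1..2 ^ i. \<bar>\<beta> (int i, k)\<bar> powr s) * \<epsilon> powr (- s)"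
        using e unfolding sum_distrib_right by (intro sum.cong refl) (simp add: powr_divide powr_minus_divide)
      also have "\<dots> \<le> (D * 2 powr (real_of_int (int i) * (1 - s * (\<alpha> + 1/2)))) * \<epsilon> powr (- s)"
        using besov_ball_moment[OF \<beta> q C _ s(1,3), of "int i"] unfolding level_size_int D_def
        by (intro mult_right_mono) auto
      also have "2 powr (real_of_int (int i) * (1 - s * (\<alpha> + 1/2))) = (2 ^ i) powr (- \<delta>)"
        by (simp add: \<delta>_def powr_realpow[symmetric] powr_powr)
      finally show ?thesis unfolding Ts by (simp add: mult_ac)
    qed
    have step: "risk \<epsilon> ?d \<beta> \<le> risk \<epsilon> (separable_estimator h) \<beta> + E" if h: "\<forall>j\<ge>-1. h j \<in> borel_measurable borel" for h
    proof -
      have lev: "?r ?d j \<le> ?r (separable_estimator h) j + ex j" if j: "j \<in> {-1..}" for j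
      proof (cases "j < j_star N")
        case True
        have "?r ?d j = ennreal (\<epsilon>\<^sup>2 * level_size j)" using j True e by (intro geb_coarse_level_risk) auto
        also have "\<dots> \<le> ex j"
        proof (cases "j = -1")
          case True then show ?thesis by (simp add: ex_def level_size_def)
        next
          case False
          then have j0: "0 \<le> j" using j by simp
          have "real (level_size j) = g0 (nat j)" using True j0 by (simp add: g0_def level_size_def nat_less_iff)
          also have "\<dots> \<le> g0 (nat j) + A * (T powr a * g1 (nat j) + g2 (nat j))" using nn A by simp
          finally have "\<epsilon>\<^sup>2 * level_size j \<le> g (nat j)" unfolding g_def by (rule mult_left_mono) simp
          then show ?thesis using False by (simp add: ex_def ennreal_leI)
        qed
        finally show ?thesis by (simp add: add_increasing)
      next
        case False
        then have j1: "1 \<le> j" using j_star_ge_1[OF N] by simp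
        define i where "i = nat j"
        have i: "j = int i" "1 \<le> i" using j1 by (simp_all add: i_def)
        let ?\<theta> = "\<lambda>l. \<beta> (j, l) / \<epsilon>"
        have hj: "h j \<in> borel_measurable borel" using h j by simp
        then have hm: "(\<lambda>x. h j (\<epsilon> * x) / \<epsilon>) \<in> borel_measurable borel" by measurable
        have "level_risk (geb_rho \<rho>\<^sub>0 \<eta>) (geb_b b\<^sub>0) (2 ^ i) ?\<theta> \<le> separable_risk (2 ^ i) ?\<theta> (\<lambda>x. h j (\<epsilon> * x) / \<epsilon>) +
            ennreal (A * (T powr a * (2 ^ i) powr (- c) + real i powr (- 3 / 2)))"
          using excess[rule_format, OF T(2) i(2) hm, of ?\<theta>] moment[of i] unfolding i(1) by blast
        also have "\<dots> \<le> separable_risk (2 ^ i) ?\<theta> (\<lambda>x. h j (\<epsilon> * x) / \<epsilon>) + ennreal (g0 i + A * (T powr a * g1 i + g2 i))"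
          using nn by (intro add_left_mono ennreal_leI) (simp add: g1_def g2_def)
        finally have "ennreal (\<epsilon>\<^sup>2) * level_risk (geb_rho \<rho>\<^sub>0 \<eta>) (geb_b b\<^sub>0) (2 ^ i) ?\<theta> \<le>
            ennreal (\<epsilon>\<^sup>2) * (separable_risk (2 ^ i) ?\<theta> (\<lambda>x. h j (\<epsilon> * x) / \<epsilon>) + ennreal (g0 i + A * (T powr a * g1 i + g2 i)))"
          by (rule mult_left_mono) simp
        also have "\<dots> = ennreal (\<epsilon>\<^sup>2) * separable_risk (2 ^ i) ?\<theta> (\<lambda>x. h j (\<epsilon> * x) / \<epsilon>) + ennreal (g i)"
        proof -
          have "ennreal (g i) = ennreal (\<epsilon>\<^sup>2) * ennreal (g0 i + A * (T powr a * g1 i + g2 i))"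
            unfolding g_def by (rule ennreal_mult) (use nn A in auto)
          then show ?thesis by (simp only: distrib_left[where 'a = ennreal])
        qed
        finally show ?thesis
          using geb_level_risk[of j N \<epsilon>, OF _ False e] separable_level_risk[of j \<epsilon> h, OF _ e hj] j j1 i
          by (simp add: ex_def level_size_int)
      qed
      have sm: "f summable_on A" for f :: "int \<Rightarrow> ennreal" and A by (rule nonneg_summable_on_complete) simp
      have "risk \<epsilon> ?d \<beta> \<le> infsum (\<lambda>j. ?r (separable_estimator h) j + ex j) {-1..}"
        unfolding risk_def by (intro infsum_mono sm lev)
      also have "\<dots> = risk \<epsilon> (separable_estimator h) \<beta> + infsum ex {-1..}"
        unfolding risk_def by (intro infsum_add sm)
      also have "\<dots> \<le> risk \<epsilon> (separable_estimator h) \<beta> + E" by (intro add_left_mono sum_ex)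
      finally show ?thesis .
    qed
    \<comment> \<open>Subtracting the finite \<open>E\<close> lets the bound pass to the infimum
      over all rules.\<close>
    have "risk \<epsilon> ?d \<beta> - E \<le> ideal_risk \<epsilon> \<beta>"
      unfolding ideal_risk_def
    proof (rule INF_greatest)
      fix h :: "int \<Rightarrow> real \<Rightarrow> real" assume "h \<in> {h. \<forall>j\<ge>-1. h j \<in> borel_measurable borel}"
      then have "risk \<epsilon> ?d \<beta> \<le> E + risk \<epsilon> (separable_estimator h) \<beta>" using step[of h] by (simp add: add.commute)
      then show "risk \<epsilon> ?d \<beta> - E \<le> risk \<epsilon> (separable_estimator h) \<beta>"
        by (simp add: ennreal_minus_le_iff E_def)
    qed
    then show ?thesis unfolding E_def[symmetric] by (simp add: ennreal_minus_le_iff add.commute)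
  qed
  have K: "0 \<le> 1 + G0 + A * G2" "0 \<le> A * G1" using G A by auto
  show ?thesis
    by (rule exI[of _ "1 + G0 + A * G2"], rule exI[of _ "A * G1"], rule exI[of _ a], rule exI[of _ T0],
        intro conjI K A allI impI ballI, rule main[OF _ refl])
qed

text \<open>On the level with between \<open>T / 2\<close> and \<open>T\<close> coefficients,
  vertices of height \<open>c * \<epsilon>\<close> have norm at most
  \<open>c * \<epsilon> * T powr (\<alpha> + 1/2) = c\<close>. The choice \<open>c = min C 1\<close>
  keeps them in the ball and keeps the two-point bound available.\<close>

lemma minimax_risk_lower:
  assumes e: "0 < \<epsilon>" "\<epsilon> \<le> 1" and q: "0 < q" and p: "0 < p" and C: "0 < C" and \<alpha>: "0 < \<alpha>"
  shows "ennreal (two_point_const (min C 1) / 4 * (\<epsilon>\<^sup>2 * \<epsilon> powr (- (1 / (\<alpha> + 1/2))))) \<le> minimax_risk \<epsilon> (besov_ball \<alpha> p q C)"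
proof -
  define T where "T = \<epsilon> powr (- (1 / (\<alpha> + 1/2)))"
  have "1 powr (- (1 / (\<alpha> + 1/2))) \<le> T" unfolding T_def using e \<alpha> by (intro powr_mono2') auto
  then have T: "1 \<le> T" by simp
  define j where "j = \<lfloor>log 2 T\<rfloor>"
  have j: "0 \<le> j" using T by (simp add: j_def)
  have jl: "2 powr real_of_int j \<le> T" "T / 2 \<le> 2 powr real_of_int j"
  proof -
    have "2 powr real_of_int j \<le> 2 powr (log 2 T)" unfolding j_def by (intro powr_mono) auto
    then show "2 powr real_of_int j \<le> T" using T by simp
    have "2 powr (log 2 T) \<le> 2 powr (real_of_int j + 1)" unfolding j_def by (intro powr_mono) linarith+
    then show "T / 2 \<le> 2 powr real_of_int j" using T by (simp add: powr_add)
  qed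
  define c where "c = min C 1"
  have c: "0 < c" "c \<le> 1" "c \<le> C" using C by (auto simp: c_def)
  have k0: "0 \<le> two_point_const c" by (simp add: two_point_const_def)
  have "2 powr (real_of_int j * (\<alpha> + 1/2)) = (2 powr real_of_int j) powr (\<alpha> + 1/2)" by (simp add: powr_powr)
  also have "\<dots> \<le> T powr (\<alpha> + 1/2)" using jl \<alpha> by (intro powr_mono2) auto
  also have "\<dots> = 1 / \<epsilon>"
  proof -
    have "- (1 / (\<alpha> + 1/2)) * (\<alpha> + 1/2) = - 1" using \<alpha> by simp
    then show ?thesis unfolding T_def powr_powr using e by (simp only: powr_minus_divide) simp
  qed
  finally have "c * \<epsilon> * 2 powr (real_of_int j * (\<alpha> + 1/2)) \<le> c * \<epsilon> * (1 / \<epsilon>)"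
    using c e by (intro mult_left_mono) auto
  also have "\<dots> \<le> C" using c e by simp
  finally have le: "c * \<epsilon> * 2 powr (real_of_int j * (\<alpha> + 1/2)) \<le> C" .
  have "ennreal (level_size j * (two_point_const c * \<epsilon>\<^sup>2 / 2)) \<le> minimax_risk \<epsilon> (besov_ball \<alpha> p q C)"
    using c e by (intro minimax_risk_ge_cube j cube_vertex_in_besov_ball q p C le) auto
  moreover have "two_point_const c / 4 * (\<epsilon>\<^sup>2 * T) \<le> level_size j * (two_point_const c * \<epsilon>\<^sup>2 / 2)"
  proof -
    have "T / 2 * (two_point_const c * \<epsilon>\<^sup>2 / 2) \<le> level_size j * (two_point_const c * \<epsilon>\<^sup>2 / 2)"
      unfolding level_size_powr[OF j] using k0 jl by (intro mult_right_mono) auto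
    then show ?thesis by (simp add: mult_ac)
  qed
  ultimately show ?thesis unfolding T_def c_def by (meson ennreal_leI order_trans)
qed

section \<open>Comparison of the excess with the minimax risk\<close>

lemma minimax_risk_le_SUP_zero:
  "minimax_risk \<epsilon> B \<le> (SUP \<beta>\<in>B. risk \<epsilon> (separable_estimator (\<lambda>_ _. 0)) \<beta>)"
  unfolding minimax_risk_def
  by (rule INF_lower) (simp add: estimators_def separable_estimator_def case_prod_unfold)

lemma ideal_risk_le_zero: "ideal_risk \<epsilon> \<beta> \<le> risk \<epsilon> (separable_estimator (\<lambda>_ _. 0)) \<beta>"
  unfolding ideal_risk_def by (rule INF_lower) simp

text \<open>The exponent must exceed \<open>c\<close> for the moments of the levels to decay. For
  \<open>p < 2\<close> it can be \<open>p\<close> itself, otherwise a value between \<open>c\<close>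
  and 2.\<close>

lemma exponent_exists:
  assumes "0 < (c :: real)" "c < 2" "ennreal c < p"
  obtains s where "c < s" "s < 2" "ennreal s \<le> p"
proof (cases "ennreal 2 \<le> p")
  case True
  have "ennreal ((c + 2) / 2) \<le> ennreal 2" using assms by (intro ennreal_leI) simp
  then show thesis using assms True by (intro that[of "(c + 2) / 2"]) auto
next
  case False
  then obtain P where P: "p = ennreal P" "0 \<le> P" by (cases p) auto
  then show thesis using assms False by (intro that[of P]) (auto simp: ennreal_less_iff)
qed

theorem theorem3p3:
  fixes N \<rho>\<^sub>0 b\<^sub>0 :: real and \<eta> :: "nat \<Rightarrow> real"
    and \<alpha> C :: real and p q :: ennreal
  assumes "N > 2" and "\<rho>\<^sub>0 > 0" and "b\<^sub>0 > 0"
    and "\<eta> \<longlonglongrightarrow> 0" and "\<forall>n\<ge>2. geb_rho \<rho>\<^sub>0 \<eta> n > 0"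
    and "0 < \<alpha>" and "ennreal (1 / (\<alpha> + 1/2)) < p" and "0 < q" and "0 < C"
  shows "\<exists>r \<in> o[at_right 0](\<lambda>_. 1 :: real). \<forall>\<^sub>F \<epsilon> in at_right (0 :: real).
    (SUP \<beta>\<in>besov_ball \<alpha> p q C.
       enn2ereal (risk \<epsilon> (geb_estimator N \<rho>\<^sub>0 b\<^sub>0 \<eta> \<epsilon>) \<beta>) - enn2ereal (ideal_risk \<epsilon> \<beta>))
    = ereal (r \<epsilon>) * enn2ereal (minimax_risk \<epsilon> (besov_ball \<alpha> p q C))"
proof -
  let ?B = "besov_ball \<alpha> p q C"
  define c where "c = 1 / (\<alpha> + 1/2)"
  have c: "0 < c" "c < 2" using \<open>0 < \<alpha>\<close> by (simp_all add: c_def divide_less_eq)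
  obtain s where s: "c < s" "s < 2" "ennreal s \<le> p"
    using exponent_exists[OF c] assms(7) unfolding c_def by blast
  have s': "0 < s" "s * (\<alpha> + 1/2) > 1"
  proof -
    show "0 < s" using s c by linarith
    show "s * (\<alpha> + 1/2) > 1" using s(1) \<open>0 < \<alpha>\<close> unfolding c_def by (subst (asm) divide_less_eq) auto
  qed
  have p: "0 < p" using assms(7) by (auto intro: le_less_trans)
  obtain K1 K2 a T0 where K: "0 \<le> K1" "0 \<le> K2" "0 \<le> a" "a < 1" "1 \<le> T0" and
    upper: "\<forall>\<epsilon>>0. T0 \<le> \<epsilon> powr (- c) \<longrightarrow> (\<forall>\<beta>\<in>?B.
      risk \<epsilon> (geb_estimator N \<rho>\<^sub>0 b\<^sub>0 \<eta> \<epsilon>) \<beta> \<le> ideal_risk \<epsilon> \<beta> + ennreal (\<epsilon>\<^sup>2 * (K1 + K2 * (\<epsilon> powr (- c)) powr a)))"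
    using geb_excess_risk[OF assms(1-5,8,9) s'(1) s(2,3) s'(2) assms(6)] unfolding c_def by blast
  obtain R where R: "\<forall>\<epsilon>>0. \<forall>\<beta>\<in>?B. risk \<epsilon> (separable_estimator (\<lambda>_ _. 0)) \<beta> \<le> ennreal R"
    using besov_ball_zero_risk[OF assms(8,9) s'(1) s(2,3) s'(2)] by blast
  define \<kappa> where "\<kappa> = two_point_const (min C 1) / 4"
  have \<kappa>: "\<kappa> > 0" using \<open>0 < C\<close> by (simp add: \<kappa>_def two_point_const_def)
  define F where "F \<epsilon> = (SUP \<beta>\<in>?B. enn2ereal (risk \<epsilon> (geb_estimator N \<rho>\<^sub>0 b\<^sub>0 \<eta> \<epsilon>) \<beta>) - enn2ereal (ideal_risk \<epsilon> \<beta>))" for \<epsilon>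
  define M where "M \<epsilon> = minimax_risk \<epsilon> ?B" for \<epsilon>
  \<comment> \<open>This real quotient is faithful only if the supremum is finite and the minimax
    risk is finite and positive; \<open>key\<close> derives both for small
    \<open>\<epsilon>\<close>.\<close>
  define r where "r \<epsilon> = real_of_ereal (F \<epsilon>) / enn2real (M \<epsilon>)" for \<epsilon>
  \<comment> \<open>The upper bound for the excess divided by the lower bound for the minimax risk.
    Both remaining exponents of \<open>\<epsilon>\<close> are positive because
    \<open>a < 1\<close>.\<close>
  define w where "w \<epsilon> = (K1 * \<epsilon> powr c + K2 * \<epsilon> powr (c * (1 - a))) / \<kappa>" for \<epsilon>
  have zero_in: "(\<lambda>_. 0) \<in> ?B"
    using cube_vertex_in_besov_ball[OF assms(8) p order_refl order_refl assms(9), of \<alpha> "{}"] assms(9)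
    by (simp add: cube_vertex_def case_prod_unfold)
  have key: "F \<epsilon> = ereal (r \<epsilon>) * enn2ereal (M \<epsilon>) \<and> 0 \<le> r \<epsilon> \<and> r \<epsilon> \<le> w \<epsilon>"
    if e: "0 < \<epsilon>" "\<epsilon> \<le> 1" and T: "T0 \<le> \<epsilon> powr (- c)" for \<epsilon>
  proof -
    define U where "U = \<epsilon>\<^sup>2 * (K1 + K2 * (\<epsilon> powr (- c)) powr a)"
    have U0: "0 \<le> U" using K by (simp add: U_def)
    have ideal: "ideal_risk \<epsilon> \<beta> \<le> ennreal R" if "\<beta> \<in> ?B" for \<beta>
      using R e that by (blast intro: order_trans[OF ideal_risk_le_zero])
    have F_le: "F \<epsilon> \<le> ereal U"
      unfolding F_def
    proof (rule SUP_least)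
      fix \<beta> assume \<beta>: "\<beta> \<in> ?B"
      from ideal[OF \<beta>] obtain y where y: "ideal_risk \<epsilon> \<beta> = ennreal y" "0 \<le> y"
        by (cases "ideal_risk \<epsilon> \<beta>") (auto simp: top_unique)
      have "risk \<epsilon> (geb_estimator N \<rho>\<^sub>0 b\<^sub>0 \<eta> \<epsilon>) \<beta> \<le> ennreal y + ennreal U"
        using upper e T \<beta> unfolding y(1)[symmetric] U_def by blast
      also have "\<dots> = ennreal (y + U)" using y U0 by simp
      finally have "enn2ereal (risk \<epsilon> (geb_estimator N \<rho>\<^sub>0 b\<^sub>0 \<eta> \<epsilon>) \<beta>) \<le> enn2ereal (ennreal (y + U))"
        by (simp only: less_eq_ennreal.rep_eq)
      then have "enn2ereal (risk \<epsilon> (geb_estimator N \<rho>\<^sub>0 b\<^sub>0 \<eta> \<epsilon>) \<beta>) \<le> ereal (y + U)"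
        using y U0 by (simp only: enn2ereal_ennreal add_nonneg_nonneg)
      then have "enn2ereal (risk \<epsilon> (geb_estimator N \<rho>\<^sub>0 b\<^sub>0 \<eta> \<epsilon>) \<beta>) - ereal y \<le> ereal U"
        by (cases "enn2ereal (risk \<epsilon> (geb_estimator N \<rho>\<^sub>0 b\<^sub>0 \<eta> \<epsilon>) \<beta>)") auto
      then show "enn2ereal (risk \<epsilon> (geb_estimator N \<rho>\<^sub>0 b\<^sub>0 \<eta> \<epsilon>) \<beta>) - enn2ereal (ideal_risk \<epsilon> \<beta>) \<le> ereal U"
        using y by simp
    qed
    \<comment> \<open>The zero array has ideal risk 0, so its excess is nonnegative. This excludes
      the value minus infinity and bounds \<open>r\<close> from below in the sandwich
      argument.\<close>
    have F_ge: "0 \<le> F \<epsilon>"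
    proof -
      have "risk \<epsilon> (separable_estimator (\<lambda>_ _. 0)) (\<lambda>_. 0) = 0"
        by (simp add: risk_def separable_estimator_def)
      then have "ideal_risk \<epsilon> (\<lambda>_. 0) = 0" using ideal_risk_le_zero[of \<epsilon> "\<lambda>_. 0"] by simp
      then have "0 \<le> enn2ereal (risk \<epsilon> (geb_estimator N \<rho>\<^sub>0 b\<^sub>0 \<eta> \<epsilon>) (\<lambda>_. 0)) - enn2ereal (ideal_risk \<epsilon> (\<lambda>_. 0))"
        by (simp add: zero_ennreal.rep_eq)
      also have "\<dots> \<le> F \<epsilon>" unfolding F_def using zero_in by (rule SUP_upper)
      finally show ?thesis .
    qed
    obtain f where f: "F \<epsilon> = ereal f" "0 \<le> f" "f \<le> U"
      using F_le F_ge by (cases "F \<epsilon>") auto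
    have "M \<epsilon> \<le> ennreal R"
      unfolding M_def by (rule order_trans[OF minimax_risk_le_SUP_zero]) (use R e in \<open>auto intro: SUP_least\<close>)
    then obtain y where y: "M \<epsilon> = ennreal y" "0 \<le> y" by (cases "M \<epsilon>") (auto simp: top_unique)
    have "ennreal (\<kappa> * (\<epsilon>\<^sup>2 * \<epsilon> powr (- c))) \<le> ennreal y"
      unfolding y(1)[symmetric] M_def \<kappa>_def c_def using e assms p by (intro minimax_risk_lower)
    then have y': "\<kappa> * (\<epsilon>\<^sup>2 * \<epsilon> powr (- c)) \<le> y" using y by simp
    have pos: "0 < \<kappa> * (\<epsilon>\<^sup>2 * \<epsilon> powr (- c))" using \<kappa> e by simp
    have r: "r \<epsilon> = f / y" using y f by (simp add: r_def)
    have "f / y \<le> U / (\<kappa> * (\<epsilon>\<^sup>2 * \<epsilon> powr (- c)))"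
      using f y' pos U0 by (intro frac_le) auto
    also have "\<dots> = w \<epsilon>"
    proof -
      have "(\<epsilon> powr (- c)) powr a * \<epsilon> powr c = \<epsilon> powr (c * (1 - a))"
        unfolding powr_powr powr_add[symmetric] by (simp add: algebra_simps)
      then have "(K1 + K2 * (\<epsilon> powr (- c)) powr a) * \<epsilon> powr c = K1 * \<epsilon> powr c + K2 * \<epsilon> powr (c * (1 - a))"
        by (simp only: distrib_right mult.assoc)
      moreover have "\<epsilon>\<^sup>2 * y / (\<kappa> * (\<epsilon>\<^sup>2 * \<epsilon> powr (- c))) = y * \<epsilon> powr c / \<kappa>" for y
        using e by (simp add: powr_minus divide_inverse)
      ultimately show ?thesis unfolding U_def w_def by (simp only:)
    qed
    finally have "r \<epsilon> \<le> w \<epsilon>" unfolding r .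
    moreover have "0 < y" using pos y' by linarith
    ultimately show ?thesis using f y by (simp add: r)
  qed
  have "filterlim (\<lambda>\<epsilon>. \<epsilon> powr (- c)) at_top (at_right 0)" using c by real_asymp
  then have evT: "\<forall>\<^sub>F \<epsilon> in at_right 0. T0 \<le> \<epsilon> powr (- c)" by (simp add: filterlim_at_top)
  have ev1: "\<forall>\<^sub>F \<epsilon> in at_right (0::real). 0 < \<epsilon> \<and> \<epsilon> \<le> 1"
    by (auto simp: eventually_at_right_field intro!: exI[of _ 1])
  have ev: "\<forall>\<^sub>F \<epsilon> in at_right 0. F \<epsilon> = ereal (r \<epsilon>) * enn2ereal (M \<epsilon>) \<and> 0 \<le> r \<epsilon> \<and> r \<epsilon> \<le> w \<epsilon>"
    using evT ev1 by eventually_elim (use key in blast)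
  have ca: "0 < c * (1 - a)" using c K by simp
  have "((\<lambda>\<epsilon>. \<epsilon> powr c) \<longlongrightarrow> 0) (at_right 0)" using c by real_asymp
  moreover have "((\<lambda>\<epsilon>. \<epsilon> powr (c * (1 - a))) \<longlongrightarrow> 0) (at_right 0)" using ca by real_asymp
  ultimately have "((\<lambda>\<epsilon>. (K1 * \<epsilon> powr c + K2 * \<epsilon> powr (c * (1 - a))) / \<kappa>) \<longlongrightarrow> (K1 * 0 + K2 * 0) / \<kappa>) (at_right 0)"
    using \<kappa> by (intro tendsto_intros) auto
  then have "(w \<longlongrightarrow> 0) (at_right 0)" by (simp add: w_def[abs_def])
  then have "(r \<longlongrightarrow> 0) (at_right 0)"
    using ev by (intro tendsto_sandwich[OF _ _ tendsto_const, of 0 r _ w]) (auto elim: eventually_mono)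
  then have "r \<in> o[at_right 0](\<lambda>_. 1 :: real)" by (intro smalloI_tendsto) auto
  moreover have "\<forall>\<^sub>F \<epsilon> in at_right 0. F \<epsilon> = ereal (r \<epsilon>) * enn2ereal (M \<epsilon>)"
    using ev by eventually_elim blast
  ultimately show ?thesis unfolding F_def M_def by blast
qed

end
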